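(* Let $n\ge1$, $\lambda>0$, and let $d\nu=f\,d\gamma$ be a probability measure on $\mathbb{R}^n$ in the class $\mathcal{P}(\lambda)$ with barycenter $b=b(\nu)=\int_{\mathbb{R}^n}x\,d\nu$. Then $$\delta_{\rm LSI}(\nu)\,\ge\, c_1(\lambda)\int_{\mathbb{R}^n}\big|\nabla(\log f)-b\big|^2\,d\nu,$$ where $c_1(\lambda)=\frac12\big(1-c(\lambda)\big)$, $c(\lambda)=\frac{1-\lambda+\lambda\log\lambda}{(1-\lambda)^2}$ for $\lambda\ne1$ and $c(1)=\frac12$.
   Context: $\gamma$ is the standard Gaussian measure on $\mathbb{R}^n$, $d\gamma(x) = (2\pi)^{-n/2}e^{-|x|^2/2}dx$. For a probability measure $d\nu=f\,d\gamma$, $\mathrm{H}(\nu)=\int_{\mathbb{R}^n} f\log f\,d\gamma$, $\mathrm{I}(\nu)=\int_{\mathbb{R}^n}\frac{|\nabla f|^2}{f}\,d\gamma$ (integral over $\{f>0\}$), and $\delta_{\rm LSI}(\nu)=\frac12\mathrm{I}(\nu)-\mathrm{H}(\nu)$. Standing convention: the density $f\ge 0$ is regular enough (weakly differentiable, $f\in W^{1,1}_{loc}$) for these quantities to be well-defined, and they are finite. $\mathcal{P}(\lambda)$ is the class of Borel probability measures $\nu$ on $\mathbb{R}^n$ satisfying a Poincaré inequality with constant $\lambda>0$: for every smooth $g:\mathbb{R}^n\to\mathbb{R}$ with $\int g\,d\nu=0$, $\lambda\int_{\mathbb{R}^n} g^2\,d\nu\le\int_{\mathbb{R}^n}|\nabla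 g|^2\,d\nu$. *)

theory Defs
  imports "HOL-Probability.Probability"
begin

section \<open>Smooth functions and gradients\<close>

definition grad :: "('a::euclidean_space \<Rightarrow> real) \<Rightarrow> 'a \<Rightarrow> 'a" where
  "grad g x = (\<Sum>b\<in>Basis. frechet_derivative g (at x) b *\<^sub>R b)"

lemma GDERIV_grad:
  fixes g :: "'a::euclidean_space \<Rightarrow> real"
  assumes "g differentiable (at x)"
  shows "GDERIV g x :> grad g x"
proof -
  have D: "(g has_derivative frechet_derivative g (at x)) (at x)"
    using assms by (simp add: frechet_derivative_works)
  have "frechet_derivative g (at x) h = h \<bullet> grad g x" for h
  proof -
    have "frechet_derivative g (at x) h
        = frechet_derivative g (at x) (\<Sum>b\<in>Basis. (h \<bullet> b) *\<^sub>R b)"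
      by (simp add: euclidean_representation)
    also have "\<dots> = (\<Sum>b\<in>Basis. (h \<bullet> b) * frechet_derivative g (at x) b)"
      using has_derivative_linear[OF D] by (simp add: linear_sum linear_cmul)
    finally show ?thesis
      by (simp add: grad_def inner_sum_right mult.commute)
  qed
  then have "frechet_derivative g (at x) = (\<lambda>h. h \<bullet> grad g x)" by blast
  with D show ?thesis by (simp add: gderiv_def)
qed

primrec Ck :: "nat \<Rightarrow> ('a::euclidean_space \<Rightarrow> real) \<Rightarrow> bool" where
  "Ck 0 g \<longleftrightarrow> continuous_on UNIV g"
| "Ck (Suc k) g \<longleftrightarrow> (\<forall>x. g differentiable (at x)) \<and>
     (\<forall>b\<in>Basis. Ck k (\<lambda>x. frechet_derivative g (at x) b))"

definition smooth :: "('a::euclidean_space \<Rightarrow> real) \<Rightarrow> bool" where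
  "smooth g \<longleftrightarrow> (\<forall>k. Ck k g)"

section \<open>The Sobolev space of locally integrable functions with locally integrable weak gradient\<close>

definition test_function :: "('a::euclidean_space \<Rightarrow> real) \<Rightarrow> bool" where
  "test_function \<phi> \<longleftrightarrow> smooth \<phi> \<and> compact (closure {x. \<phi> x \<noteq> 0})"

definition locally_integrable ::
    "('a::euclidean_space \<Rightarrow> 'b::{banach, second_countable_topology}) \<Rightarrow> bool" where
  "locally_integrable h \<longleftrightarrow> (\<forall>K. compact K \<longrightarrow> set_integrable lborel K h)"

definition has_weak_gradient ::
    "('a::euclidean_space \<Rightarrow> real) \<Rightarrow> ('a \<Rightarrow> 'a) \<Rightarrow> bool" where
  "has_weak_gradient f G \<longleftrightarrow> locally_integrable G \<and>
     (\<forall>\<phi>. test_function \<phi> \<longrightarrow>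
        (\<integral>x. f x *\<^sub>R grad \<phi> x \<partial>lborel) = - (\<integral>x. \<phi> x *\<^sub>R G x \<partial>lborel))"

definition W11_loc :: "('a::euclidean_space \<Rightarrow> real) \<Rightarrow> bool" where
  "W11_loc f \<longleftrightarrow> locally_integrable f \<and> (\<exists>G. has_weak_gradient f G)"

(* Determined up to Lebesgue null sets whenever W11_loc f; only its integrals against
   absolutely continuous measures are used. *)
definition weak_gradient :: "('a::euclidean_space \<Rightarrow> real) \<Rightarrow> 'a \<Rightarrow> 'a" where
  "weak_gradient f = (SOME G. has_weak_gradient f G)"

(* The gradient of log f is the weak gradient of f divided by f on {f > 0}, a set of full measure
   for f d\<gamma>; log f itself need not be locally integrable. Off this set the value is 0. *)
definition grad_log :: "('a::euclidean_space \<Rightarrow> real) \<Rightarrow> 'a \<Rightarrow> 'a" where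
  "grad_log f x = weak_gradient f x /\<^sub>R f x"

section \<open>Entropy, Fisher information and the log-Sobolev deficit\<close>

definition std_gaussian :: "'a::euclidean_space measure" where
  "std_gaussian = density lborel
     (\<lambda>x. ennreal ((2 * pi) powr (- real DIM('a) / 2) * exp (- (norm x)\<^sup>2 / 2)))"

(* The functionals of d\<nu> = f d\<gamma> are indexed by the density f. *)

definition rel_entropy :: "('a::euclidean_space \<Rightarrow> real) \<Rightarrow> real" where
  "rel_entropy f = (\<integral>x. f x * ln (f x) \<partial>std_gaussian)"

definition finite_entropy :: "('a::euclidean_space \<Rightarrow> real) \<Rightarrow> bool" where
  "finite_entropy f \<longleftrightarrow> integrable std_gaussian (\<lambda>x. f x * ln (f x))"

definition fisher_information :: "('a::euclidean_space \<Rightarrow> real) \<Rightarrow> real" where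
  "fisher_information f =
     (LINT x:{x. f x > 0}|std_gaussian. (norm (weak_gradient f x))\<^sup>2 / f x)"

definition finite_fisher_information :: "('a::euclidean_space \<Rightarrow> real) \<Rightarrow> bool" where
  "finite_fisher_information f \<longleftrightarrow>
     set_integrable std_gaussian {x. f x > 0} (\<lambda>x. (norm (weak_gradient f x))\<^sup>2 / f x)"

definition lsi_deficit :: "('a::euclidean_space \<Rightarrow> real) \<Rightarrow> real" where
  "lsi_deficit f = fisher_information f / 2 - rel_entropy f"

section \<open>Measures satisfying a Poincare inequality\<close>

(* Integrability of g is explicit because the Bochner integral of a non-integrable function is 0;
   the two sides of the inequality may be infinite. *)
definition poincare_class :: "real \<Rightarrow> 'a::euclidean_space measure set" where
  "poincare_class l = {\<nu>. sets \<nu> = sets borel \<and> prob_space \<nu> \<and>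
     (\<forall>g. smooth g \<and> integrable \<nu> g \<and> (\<integral>x. g x \<partial>\<nu>) = 0 \<longrightarrow>
        ennreal l * (\<integral>\<^sup>+x. ennreal ((g x)\<^sup>2) \<partial>\<nu>) \<le> (\<integral>\<^sup>+x. ennreal ((norm (grad g x))\<^sup>2) \<partial>\<nu>))}"

definition barycenter :: "'a::euclidean_space measure \<Rightarrow> 'a" where
  "barycenter \<nu> = (\<integral>x. x \<partial>\<nu>)"

definition c_const :: "real \<Rightarrow> real" where
  "c_const l = (if l = 1 then 1 / 2 else (1 - l + l * ln l) / (1 - l)\<^sup>2)"

definition c1_const :: "real \<Rightarrow> real" where
  "c1_const l = (1 - c_const l) / 2"

end

theory Submission
  imports Defs
begin

text \<open>
  Let \<open>X\<close> have law \<open>\<nu>\<close>, with Lebesgue density \<open>u\<close>, and run the heat flow: \<open>Y = X + sqrt s Z\<close> with \<open>Z\<close>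
  standard Gaussian has density \<open>u\<^sub>s\<close>, whose entropy satisfies de Bruijn's identity
  \<open>h'(s) = - J(s) / 2\<close> with \<open>J\<close> the Fisher information relative to Lebesgue measure. For
  \<open>T = \<nabla> log f\<close> one has \<open>E[T(X) | Y = y] = (1 + s) \<nabla> log u\<^sub>s(y) + y\<close>, so \<open>J(s)\<close> is controlled by the
  variance of this conditional expectation. That variance is at most \<open>Var T(X) / (1 + \<lambda> s)\<close>: by duality
  this says \<open>(1 + \<lambda> s) Var (Q\<^sub>s g)(X) \<le> Var g(Y)\<close> for the heat semigroup \<open>Q\<^sub>s\<close>, which follows from
  the reverse local Poincare inequality \<open>s |\<nabla> Q\<^sub>s g|\<^sup>2 \<le> Q\<^sub>s(g\<^sup>2) - (Q\<^sub>s g)\<^sup>2\<close> and the Poincare inequality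
  of \<open>\<nu>\<close> applied to the smooth function \<open>Q\<^sub>s g\<close>. Integrating the resulting bound on \<open>J\<close> over
  \<open>s > 0\<close> produces the integral of \<open>1 / ((1 + \<lambda> s) (1 + s)\<^sup>2)\<close>, which is \<open>c(\<lambda>)\<close>. Fatou's lemma handles
  \<open>s \<rightarrow> 0\<close>, and convexity of \<open>t log t\<close> compares \<open>h(s)\<close> with the Gaussian entropy as \<open>s \<rightarrow> \<infinity>\<close>.
\<close>

section \<open>Partial derivatives\<close>

text \<open>The weak gradient \<open>G\<close> of \<open>f\<close> is only locally integrable and
  the Poincare inequality accepts only smooth functions, so neither is used on the score
  \<open>G / f\<close> directly. The score enters through convolutions with heat kernels, and the
  Poincare inequality is applied only to heat-smoothed bounded functions. For this, score times
  density must agree almost everywhere with \<open>G\<close> times the Gaussian, hence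
  \<open>G\<close> must vanish almost everywhere on the zero set of \<open>f\<close>; that follows
  from nonnegativity of \<open>f\<close> and L1 continuity of translations. No moment is assumed:
  finite entropy forces a finite second moment. The mean of the score is the barycenter b, so with D
  the total variance of the score the Fisher information is D + |b|^2. The flow bounds the entropy
  by (c D + |b|^2) / 2, and the barycenter cancels in the deficit, leaving (1 - c) D / 2. The weight
  1 / (1 + s)^2 comes from solving the conditional expectation for the gradient of log u_s;
  dimension and second moment cancel between the integrated bound and the Gaussian entropy for large
  s.\<close>

lemma real_polynomial_function_has_derivative:
  fixes P :: "'a::euclidean_space \<Rightarrow> real"
  assumes "real_polynomial_function P"
  obtains D where "\<And>b. real_polynomial_function (D b)"
    "\<And>x. (P has_derivative (\<lambda>d. \<Sum>b\<in>Basis. (d \<bullet> b) * D b x)) (at x)"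
proof -
  have "\<exists>D. (\<forall>b. real_polynomial_function (D b)) \<and>
    (\<forall>x. (P has_derivative (\<lambda>d. \<Sum>b\<in>Basis. (d \<bullet> b) * D b x)) (at x))"
    using assms
  proof (induction P rule: real_polynomial_function.induct)
    case (linear f)
    have "(\<Sum>b\<in>Basis. (d \<bullet> b) * f b) = f d" for d
    proof -
      have "f d = f (\<Sum>b\<in>Basis. (d \<bullet> b) *\<^sub>R b)" by (simp add: euclidean_representation)
      also have "\<dots> = (\<Sum>b\<in>Basis. (d \<bullet> b) * f b)"
        using bounded_linear.linear[OF linear] by (simp add: linear_sum linear_cmul)
      finally show ?thesis by simp
    qed
    moreover have "(f has_derivative f) (at x)" for x
      using linear by (rule bounded_linear_imp_has_derivative)
    ultimately show ?case
      by (intro exI[of _ "\<lambda>b x. f b"]) (auto simp: real_polynomial_function.intros(2))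
  next
    case (const c)
    show ?case by (intro exI[of _ "\<lambda>b x. 0"]) (auto simp: real_polynomial_function.intros(2))
  next
    case (add f g)
    then obtain Df Dg where "\<And>b. real_polynomial_function (Df b)" "\<And>b. real_polynomial_function (Dg b)"
      and "\<And>x. (f has_derivative (\<lambda>d. \<Sum>b\<in>Basis. (d \<bullet> b) * Df b x)) (at x)"
      and "\<And>x. (g has_derivative (\<lambda>d. \<Sum>b\<in>Basis. (d \<bullet> b) * Dg b x)) (at x)"
      by auto
    then show ?case
      by (intro exI[of _ "\<lambda>b x. Df b x + Dg b x"])
        (auto simp: distrib_left sum.distrib intro!: derivative_intros)
  next
    case (mult f g)
    then obtain Df Dg where *: "\<And>b. real_polynomial_function (Df b)" "\<And>b. real_polynomial_function (Dg b)"
      and D: "\<And>x. (f has_derivative (\<lambda>d. \<Sum>b\<in>Basis. (d \<bullet> b) * Df b x)) (at x)"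
      "\<And>x. (g has_derivative (\<lambda>d. \<Sum>b\<in>Basis. (d \<bullet> b) * Dg b x)) (at x)"
      by auto
    have "((\<lambda>x. f x * g x) has_derivative
        (\<lambda>d. \<Sum>b\<in>Basis. (d \<bullet> b) * (f x * Dg b x + Df b x * g x))) (at x)" for x
      by (rule has_derivative_eq_rhs[OF has_derivative_mult[OF D]])
        (auto simp: fun_eq_iff sum_distrib_left sum_distrib_right sum.distrib[symmetric]
          algebra_simps intro!: sum.cong)
    moreover have "real_polynomial_function (\<lambda>x. f x * Dg b x + Df b x * g x)" for b
      using * mult.hyps by (intro real_polynomial_function.intros(3,4))
    ultimately show ?case by (intro exI[of _ "\<lambda>b x. f x * Dg b x + Df b x * g x"]) simp
  qed
  then show ?thesis using that by blast
qed

lemma sum_inner_Basis_delta: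
  fixes F :: "'a::euclidean_space \<Rightarrow> real"
  assumes "e \<in> Basis"
  shows "(\<Sum>b\<in>Basis. (e \<bullet> b) * F b) = F e"
proof -
  have "(\<Sum>b\<in>Basis. (e \<bullet> b) * F b) = (\<Sum>b\<in>Basis. if e = b then F e else 0)"
    using assms by (intro sum.cong) (auto simp: inner_Basis)
  then show ?thesis using assms by simp
qed

text \<open>The full Frechet derivative is recorded through its coordinate coefficients. Calculus
  rules can then be stated for explicit coefficient functions, and \<open>Ck\<close> and
  \<open>grad\<close>, which are built on \<open>frechet_derivative\<close>, are read off from
  them.\<close>

definition has_partials :: "('a::euclidean_space \<Rightarrow> real) \<Rightarrow> ('a \<Rightarrow> 'a \<Rightarrow> real) \<Rightarrow> bool" where
  "has_partials K D \<longleftrightarrow> (\<forall>x. (K has_derivative (\<lambda>d. \<Sum>b\<in>Basis. (d \<bullet> b) * D b x)) (at x))"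

lemma has_partials_frechet:
  assumes "has_partials K D" "b \<in> Basis"
  shows "frechet_derivative K (at x) b = D b x"
proof -
  have "frechet_derivative K (at x) = (\<lambda>d. \<Sum>b\<in>Basis. (d \<bullet> b) * D b x)"
    using assms by (intro frechet_derivative_at[symmetric]) (auto simp: has_partials_def)
  then show ?thesis using sum_inner_Basis_delta[OF assms(2), of "\<lambda>c. D c x"] by simp
qed

lemma has_partials_differentiable: "has_partials K D \<Longrightarrow> K differentiable (at x)"
  unfolding has_partials_def differentiable_def by blast

lemma has_partials_continuous: "has_partials K D \<Longrightarrow> continuous_on UNIV K"
  unfolding has_partials_def
  by (intro continuous_at_imp_continuous_on ballI has_derivative_continuous) (erule spec)

lemma has_partials_grad:
  assumes "has_partials K D"
  shows "grad K x = (\<Sum>b\<in>Basis. D b x *\<^sub>R b)"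
  unfolding grad_def using has_partials_frechet[OF assms] by simp

lemma Ck_Suc_partials:
  assumes "has_partials K D"
  shows "Ck (Suc k) K \<longleftrightarrow> (\<forall>b\<in>Basis. Ck k (D b))"
  using has_partials_frechet[OF assms] has_partials_differentiable[OF assms]
  by simp

lemma Ck_has_partials:
  assumes "Ck (Suc k) g"
  shows "has_partials g (\<lambda>b x. frechet_derivative g (at x) b)"
proof -
  have "(g has_derivative (\<lambda>d. \<Sum>b\<in>Basis. (d \<bullet> b) * frechet_derivative g (at x) b)) (at x)" for x
  proof -
    have D: "(g has_derivative frechet_derivative g (at x)) (at x)"
      using assms by (simp add: frechet_derivative_works)
    have "frechet_derivative g (at x) h = (\<Sum>b\<in>Basis. (h \<bullet> b) * frechet_derivative g (at x) b)" for h
    proof -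
      have "frechet_derivative g (at x) h
        = frechet_derivative g (at x) (\<Sum>b\<in>Basis. (h \<bullet> b) *\<^sub>R b)"
        by (simp add: euclidean_representation)
      also have "\<dots> = (\<Sum>b\<in>Basis. (h \<bullet> b) * frechet_derivative g (at x) b)"
        using has_derivative_linear[OF D] by (simp add: linear_sum linear_cmul)
      finally show ?thesis .
    qed
    then show ?thesis by (intro has_derivative_eq_rhs[OF D]) blast
  qed
  then show ?thesis by (simp add: has_partials_def)
qed

lemma Ck_Suc_imp: "Ck (Suc k) g \<Longrightarrow> Ck k g"
proof (induction k arbitrary: g)
  case 0
  then show ?case using Ck_has_partials has_partials_continuous by (metis Ck.simps(1))
next
  case (Suc k)
  then show ?case by (metis Ck.simps(2))
qed

lemma has_partials_add:
  assumes "has_partials f F" "has_partials g G"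
  shows "has_partials (\<lambda>x. f x + g x) (\<lambda>b x. F b x + G b x)"
  using assms unfolding has_partials_def
  by (auto simp: distrib_left sum.distrib intro!: derivative_intros)

lemma has_partials_mult:
  assumes "has_partials f F" "has_partials g G"
  shows "has_partials (\<lambda>x. f x * g x) (\<lambda>b x. f x * G b x + F b x * g x)"
  unfolding has_partials_def
proof
  fix x
  have D: "(f has_derivative (\<lambda>d. \<Sum>b\<in>Basis. (d \<bullet> b) * F b x)) (at x)"
      "(g has_derivative (\<lambda>d. \<Sum>b\<in>Basis. (d \<bullet> b) * G b x)) (at x)"
    using assms by (auto simp: has_partials_def)
  show "((\<lambda>x. f x * g x) has_derivative
        (\<lambda>d. \<Sum>b\<in>Basis. (d \<bullet> b) * (f x * G b x + F b x * g x))) (at x)"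
      by (rule has_derivative_eq_rhs[OF has_derivative_mult[OF D]])
        (auto simp: fun_eq_iff sum_distrib_left sum_distrib_right sum.distrib[symmetric]
          algebra_simps intro!: sum.cong)
qed

lemma has_partials_compose:
  assumes "has_partials f F" "\<And>t. (h has_real_derivative h' t) (at t)"
  shows "has_partials (\<lambda>x. h (f x)) (\<lambda>b x. h' (f x) * F b x)"
  unfolding has_partials_def
proof
  fix x
  have D: "(f has_derivative (\<lambda>d. \<Sum>b\<in>Basis. (d \<bullet> b) * F b x)) (at x)"
    using assms by (auto simp: has_partials_def)
  have H: "(h has_derivative (*) (h' (f x))) (at (f x))"
    using assms(2) by (simp add: has_field_derivative_def)
  show "((\<lambda>x. h (f x)) has_derivative (\<lambda>d. \<Sum>b\<in>Basis. (d \<bullet> b) * (h' (f x) * F b x))) (at x)"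
    by (rule has_derivative_eq_rhs[OF has_derivative_compose[OF D H]])
      (auto simp: fun_eq_iff sum_distrib_left mult_ac)
qed

lemma has_partials_norm_power2: "has_partials (\<lambda>x. (norm x)\<^sup>2) (\<lambda>b x. 2 * (x \<bullet> b))"
  unfolding has_partials_def power2_norm_eq_inner
proof
  fix x :: 'a
  have "(\<lambda>d. \<Sum>b\<in>Basis. (d \<bullet> b) * (2 * (x \<bullet> b))) = (\<lambda>d. x \<bullet> d + d \<bullet> x)"
  proof
    fix d
    have "(\<Sum>b\<in>Basis. (d \<bullet> b) * (2 * (x \<bullet> b))) = 2 * (d \<bullet> x)"
      unfolding euclidean_inner[of d x] sum_distrib_left by (intro sum.cong) auto
    then show "(\<Sum>b\<in>Basis. (d \<bullet> b) * (2 * (x \<bullet> b))) = x \<bullet> d + d \<bullet> x"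
      by (simp add: inner_commute)
  qed
  then show "((\<lambda>x. x \<bullet> x) has_derivative (\<lambda>d. \<Sum>b\<in>Basis. (d \<bullet> b) * (2 * (x \<bullet> b)))) (at x)"
    using has_derivative_inner[OF has_derivative_ident has_derivative_ident, of x UNIV] by simp
qed

lemma has_partials_translate:
  assumes "has_partials f F"
  shows "has_partials (\<lambda>x. f (x - y)) (\<lambda>b x. F b (x - y))"
  unfolding has_partials_def
proof
  fix x
  have D: "(f has_derivative (\<lambda>d. \<Sum>b\<in>Basis. (d \<bullet> b) * F b (x - y))) (at (x - y))"
    using assms by (auto simp: has_partials_def)
  have "((\<lambda>x. x - y) has_derivative (\<lambda>d. d)) (at x)" by (auto intro!: derivative_eq_intros)
  from has_derivative_compose[OF this D]
  show "((\<lambda>x. f (x - y)) has_derivative (\<lambda>d. \<Sum>b\<in>Basis. (d \<bullet> b) * F b (x - y))) (at x)"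
    by simp
qed

lemma has_partials_along_line:
  assumes "has_partials f F"
  shows "((\<lambda>t. f (x + t *\<^sub>R e)) has_real_derivative (\<Sum>b\<in>Basis. (e \<bullet> b) * F b (x + t *\<^sub>R e))) (at t)"
proof -
  have D: "(f has_derivative (\<lambda>d. \<Sum>b\<in>Basis. (d \<bullet> b) * F b (x + t *\<^sub>R e))) (at (x + t *\<^sub>R e))"
    using assms by (auto simp: has_partials_def)
  have "((\<lambda>t. x + t *\<^sub>R e) has_derivative (\<lambda>d. d *\<^sub>R e)) (at t)"
    by (auto intro!: derivative_eq_intros)
  from has_derivative_compose[OF this D] show ?thesis
    unfolding has_field_derivative_def
    by (rule has_derivative_eq_rhs) (auto simp: fun_eq_iff sum_distrib_left sum_distrib_right mult_ac)
qed

lemma Ck_add: "Ck k f \<Longrightarrow> Ck k g \<Longrightarrow> Ck k (\<lambda>x. f x + g x)"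
proof (induction k arbitrary: f g)
  case 0
  then show ?case by (auto intro: continuous_intros)
next
  case (Suc k)
  show ?case
    unfolding Ck_Suc_partials[OF has_partials_add[OF Suc.prems[THEN Ck_has_partials]]]
    using Suc by auto
qed

lemma Ck_mult: "Ck k f \<Longrightarrow> Ck k g \<Longrightarrow> Ck k (\<lambda>x. f x * g x)"
proof (induction k arbitrary: f g)
  case 0
  then show ?case by (auto intro: continuous_intros)
next
  case (Suc k)
  then have "Ck k f" "Ck k g" using Ck_Suc_imp by blast+
  with Suc show ?case
    unfolding Ck_Suc_partials[OF has_partials_mult[OF Suc.prems[THEN Ck_has_partials]]]
    by (auto intro!: Ck_add Suc.IH)
qed

lemma smooth_mult: "smooth f \<Longrightarrow> smooth g \<Longrightarrow> smooth (\<lambda>x. f x * g x)"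
  unfolding smooth_def using Ck_mult by blast

lemma smooth_add: "smooth f \<Longrightarrow> smooth g \<Longrightarrow> smooth (\<lambda>x. f x + g x)"
  unfolding smooth_def using Ck_add by blast

text \<open>Higher derivatives never have to be computed: induction on the order, over all members
  at once, works because the partial derivatives lie in the same class.\<close>

lemma smooth_closed_class:
  assumes "f \<in> C"
    and "\<And>f. f \<in> C \<Longrightarrow> \<exists>D. (\<forall>b\<in>Basis. D b \<in> C) \<and> has_partials f D"
  shows "smooth f"
proof -
  have "Ck k f" for k
    using assms(1)
  proof (induction k arbitrary: f)
    case 0
    then show ?case using assms(2) has_partials_continuous by fastforce
  next
    case (Suc k)
    then obtain D where "\<forall>b\<in>Basis. D b \<in> C" "has_partials f D" using assms(2) by blast
    then show ?case using Suc.IH Ck_Suc_partials by blast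
  qed
  then show ?thesis by (simp add: smooth_def)
qed

lemma smooth_const: "smooth (\<lambda>x::'a::euclidean_space. c)"
proof (rule smooth_closed_class[of _ "range (\<lambda>c (x::'a). c)"])
  fix f :: "'a \<Rightarrow> real" assume "f \<in> range (\<lambda>c x. c)"
  then obtain c where "f = (\<lambda>x. c)" by auto
  then show "\<exists>D. (\<forall>b\<in>Basis. D b \<in> range (\<lambda>c x. c)) \<and> has_partials f D"
    by (intro exI[of _ "\<lambda>b x. 0"]) (auto simp: has_partials_def)
qed auto

lemma smooth_has_partials: "smooth g \<Longrightarrow> has_partials g (\<lambda>b x. frechet_derivative g (at x) b)"
  unfolding smooth_def using Ck_has_partials by blast

section \<open>Polynomials times a Gaussian\<close>

lemma le_one_plus_power2: "t \<le> 1 + t\<^sup>2" for t :: real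
  using sum_squares_ge_zero[of "t - 1/2" 0] by (simp add: power2_eq_square algebra_simps)

text \<open>This class is closed under partial derivatives, so convolution with a member is smooth.\<close>
definition poly_gauss :: "real \<Rightarrow> ('a::euclidean_space \<Rightarrow> real) set" where
  "poly_gauss a = {K. \<exists>P. real_polynomial_function P \<and> K = (\<lambda>x. P x * exp (- a * (norm x)\<^sup>2))}"

lemma real_polynomial_function_inner: "real_polynomial_function (\<lambda>x::'a::euclidean_space. x \<bullet> b)"
  by (intro real_polynomial_function.intros(1) bounded_linear_inner_left)

lemma poly_gauss_partials:
  assumes "K \<in> poly_gauss a"
  shows "\<exists>D. (\<forall>b. D b \<in> poly_gauss a) \<and> has_partials K D"
proof -
  obtain P where P: "real_polynomial_function P" "K = (\<lambda>x. P x * exp (- a * (norm x)\<^sup>2))"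
    using assms by (auto simp: poly_gauss_def)
  obtain D where D: "\<And>b. real_polynomial_function (D b)" "has_partials P D"
    using real_polynomial_function_has_derivative[OF P(1)] unfolding has_partials_def by auto
  have "has_partials (\<lambda>x. exp (- a * (norm x)\<^sup>2)) (\<lambda>b x. (exp (- a * (norm x)\<^sup>2) * (- a)) * (2 * (x \<bullet> b)))"
    by (rule has_partials_compose[OF has_partials_norm_power2]) (auto intro!: derivative_eq_intros)
  from has_partials_mult[OF D(2) this]
  have "has_partials K (\<lambda>b x. (D b x + P x * ((- 2 * a) * (x \<bullet> b))) * exp (- a * (norm x)\<^sup>2))"
    unfolding P(2) by (simp add: algebra_simps)
  moreover have "real_polynomial_function (\<lambda>x. D b x + P x * ((- 2 * a) * (x \<bullet> b)))" for b
    using D(1) P(1) real_polynomial_function_inner by (intro real_polynomial_function.intros(2-4))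
  ultimately show ?thesis unfolding poly_gauss_def mem_Collect_eq
    by (intro exI[of _ "\<lambda>b x. (D b x + P x * ((- 2 * a) * (x \<bullet> b))) * exp (- a * (norm x)\<^sup>2)"])
      (auto simp del: minus_mult_left)
qed

lemma poly_gauss_smooth:
  assumes "K \<in> poly_gauss a"
  shows "smooth K"
proof (rule smooth_closed_class[OF assms])
  fix f :: "'a \<Rightarrow> real" assume "f \<in> poly_gauss a"
  from poly_gauss_partials[OF this] show "\<exists>D. (\<forall>b\<in>Basis. D b \<in> poly_gauss a) \<and> has_partials f D"
    by auto
qed

lemma poly_gauss_translate_smooth: "K \<in> poly_gauss a \<Longrightarrow> smooth (\<lambda>x. K (x - y))"
proof (rule smooth_closed_class[of _ "(\<lambda>K x. K (x - y)) ` poly_gauss a"])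
  fix f :: "'a \<Rightarrow> real" assume "f \<in> (\<lambda>K x. K (x - y)) ` poly_gauss a"
  then obtain K where K: "K \<in> poly_gauss a" "f = (\<lambda>x. K (x - y))" by auto
  then obtain D where D: "\<forall>b. D b \<in> poly_gauss a" "has_partials K D"
    using poly_gauss_partials by blast
  then show "\<exists>D. (\<forall>b\<in>Basis. D b \<in> (\<lambda>K x. K (x - y)) ` poly_gauss a) \<and> has_partials f D"
    using has_partials_translate[OF D(2)] K(2) by (intro exI[of _ "\<lambda>b x. D b (x - y)"]) auto
qed auto

text \<open>Half of the Gaussian exponent absorbs the polynomial factor, the other half remains as
  decay.\<close>

lemma poly_gauss_decay:
  fixes K :: "'a::euclidean_space \<Rightarrow> real"
  assumes "K \<in> poly_gauss a" "a > 0"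
  obtains C where "\<And>x. \<bar>K x\<bar> \<le> C * exp (- (a/2) * (norm x)\<^sup>2)" "C \<ge> 0"
proof -
  obtain P where P: "real_polynomial_function P" "K = (\<lambda>x. P x * exp (- a * (norm x)\<^sup>2))"
    using assms by (auto simp: poly_gauss_def)
  \<comment> \<open>The rate is arbitrary here because the product case applies the induction
    hypothesis to both factors at half the rate.\<close>
  have "\<exists>C. \<forall>x. \<bar>P x\<bar> \<le> C * exp (a * (norm x)\<^sup>2)" if "a > 0" for a :: real
    using P(1) that
  proof (induction P arbitrary: a rule: real_polynomial_function.induct)
    case (linear f)
    then obtain B where B: "B > 0" "\<And>x. norm (f x) \<le> norm x * B"
      using bounded_linear.pos_bounded by blast
    have "\<bar>f x\<bar> \<le> (B * (1 + 1 / a)) * exp (a * (norm x)\<^sup>2)" for x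
    proof -
      have "norm x \<le> 1 + (norm x)\<^sup>2" by (rule le_one_plus_power2)
      also have "\<dots> \<le> (1 + 1/a) * exp (a * (norm x)\<^sup>2)"
      proof -
        have "a * (norm x)\<^sup>2 \<le> exp (a * (norm x)\<^sup>2)" 
          using exp_ge_add_one_self[of "a * (norm x)\<^sup>2"] by linarith
        then have "(norm x)\<^sup>2 \<le> exp (a * (norm x)\<^sup>2) / a"
          using linear.prems by (simp add: field_simps)
        moreover have "1 \<le> exp (a * (norm x)\<^sup>2)" using linear.prems by simp
        ultimately show ?thesis by (simp only: distrib_right mult_1 times_divide_eq_left)
      qed
      finally have "norm x * B \<le> ((1 + 1/a) * exp (a * (norm x)\<^sup>2)) * B"
        using B(1) by (intro mult_right_mono) auto
      then show ?thesis using B(2)[of x] by (simp add: mult_ac)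
    qed
    then show ?case by blast
  next
    case (const c)
    have "\<bar>c\<bar> * 1 \<le> \<bar>c\<bar> * exp (a * (norm x)\<^sup>2)" for x :: 'a
      using const by (intro mult_left_mono) auto
    then show ?case by auto
  next
    case (add f g)
    then obtain C1 C2 where "\<And>x. \<bar>f x\<bar> \<le> C1 * exp (a * (norm x)\<^sup>2)"
      "\<And>x. \<bar>g x\<bar> \<le> C2 * exp (a * (norm x)\<^sup>2)" by metis
    then have "\<bar>f x + g x\<bar> \<le> (C1 + C2) * exp (a * (norm x)\<^sup>2)" for x
      using abs_triangle_ineq[of "f x" "g x"] by (simp add: distrib_right) (smt (verit))
    then show ?case by blast
  next
    case (mult f g)
    then have "a / 2 > 0" by simp
    from mult.IH[OF this] obtain C1 C2 where C: "\<And>x. \<bar>f x\<bar> \<le> C1 * exp (a/2 * (norm x)\<^sup>2)"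
      "\<And>x. \<bar>g x\<bar> \<le> C2 * exp (a/2 * (norm x)\<^sup>2)" by metis
    have "\<bar>f x * g x\<bar> \<le> (C1 * C2) * exp (a * (norm x)\<^sup>2)" for x
    proof -
      have "\<bar>f x * g x\<bar> \<le> (C1 * exp (a/2 * (norm x)\<^sup>2)) * (C2 * exp (a/2 * (norm x)\<^sup>2))"
        unfolding abs_mult by (intro mult_mono C order_trans[OF abs_ge_zero C(1)]) auto
      also have "\<dots> = (C1 * C2) * (exp (a/2 * (norm x)\<^sup>2) * exp (a/2 * (norm x)\<^sup>2))"
        by (simp add: mult_ac)
      also have "exp (a/2 * (norm x)\<^sup>2) * exp (a/2 * (norm x)\<^sup>2) = exp (a * (norm x)\<^sup>2)"
        by (simp add: exp_add[symmetric])
      finally show ?thesis .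
    qed
    then show ?case by blast
  qed
  from this[of "a/2"] assms(2) obtain C where C: "\<And>x. \<bar>P x\<bar> \<le> C * exp (a/2 * (norm x)\<^sup>2)" by auto
  have "\<bar>K x\<bar> \<le> C * exp (- (a/2) * (norm x)\<^sup>2)" for x
  proof -
    have "\<bar>K x\<bar> \<le> C * exp (a/2 * (norm x)\<^sup>2) * exp (- a * (norm x)\<^sup>2)"
      unfolding P(2) abs_mult abs_exp_cancel using C by (intro mult_right_mono) auto
    also have "\<dots> = C * exp (- (a/2) * (norm x)\<^sup>2)" by (simp add: mult.assoc exp_add[symmetric])
    finally show ?thesis .
  qed
  moreover have "C \<ge> 0" using C[of 0] by (smt (verit) exp_gt_zero mult_neg_pos)
  ultimately show ?thesis using that by blast
qed

lemma poly_gauss_poly_mult: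
  assumes "K \<in> poly_gauss a" "real_polynomial_function P"
  shows "(\<lambda>x. P x * K x) \<in> poly_gauss a"
proof -
  obtain Q where "real_polynomial_function Q" "K = (\<lambda>x. Q x * exp (- a * (norm x)\<^sup>2))"
    using assms by (auto simp: poly_gauss_def)
  then show ?thesis using assms(2) unfolding poly_gauss_def
    by (intro CollectI exI[of _ "\<lambda>x. P x * Q x"]) auto
qed


section \<open>Convolution on Euclidean space\<close>

lemma has_partials_borel [measurable_dest]: "has_partials K D \<Longrightarrow> K \<in> borel_measurable borel"
  by (intro borel_measurable_continuous_onI has_partials_continuous)

lemma lborel_distr_reflect: "distr lborel borel (\<lambda>x. t - x) = (lborel :: 'a::euclidean_space measure)"
  using lborel_affine[of "-1" t] by (simp add: density_1)

lemma integral_lborel_translate: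
  fixes f :: "'a::euclidean_space \<Rightarrow> 'b::{banach, second_countable_topology}"
  assumes "f \<in> borel_measurable borel"
  shows "(LBINT x. f (x + c)) = (LBINT x. f x)"
  using assms by (subst (2) lborel_distr_plus[of c, symmetric]) (simp add: integral_distr add.commute)

lemma integrable_lborel_translate:
  fixes f :: "'a::euclidean_space \<Rightarrow> 'b::{banach, second_countable_topology}"
  assumes "f \<in> borel_measurable borel"
  shows "integrable lborel (\<lambda>x. f (x + c)) \<longleftrightarrow> integrable lborel f"
  using assms by (subst (2) lborel_distr_plus[of c, symmetric]) (simp add: integrable_distr_eq add.commute)

lemma integral_lborel_reflect:
  fixes f :: "'a::euclidean_space \<Rightarrow> 'b::{banach, second_countable_topology}"
  assumes "f \<in> borel_measurable borel"
  shows "(LBINT x. f (c - x)) = (LBINT x. f x)"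
  using assms by (subst (2) lborel_distr_reflect[of c, symmetric]) (simp add: integral_distr)

lemma integrable_lborel_reflect:
  fixes f :: "'a::euclidean_space \<Rightarrow> 'b::{banach, second_countable_topology}"
  assumes "f \<in> borel_measurable borel"
  shows "integrable lborel (\<lambda>x. f (c - x)) \<longleftrightarrow> integrable lborel f"
  using assms by (subst (2) lborel_distr_reflect[of c, symmetric]) (simp add: integrable_distr_eq)

text \<open>Supplies the joint integrability needed to exchange an average over shifts with the
  space integral: by translation invariance the inner L1 norm does not depend on
  \<open>t\<close>.\<close>

lemma integrable_translates_pair:
  fixes D :: "'a::euclidean_space \<Rightarrow> real" and c :: "real \<Rightarrow> 'a"
  assumes D: "integrable lborel D" and c: "c \<in> borel_measurable borel"
  shows "integrable (lborel \<Otimes>\<^sub>M lborel) (\<lambda>(t::real, x). indicator {0..h} t * D (x + c t))"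
proof (rule lborel_pair.Fubini_integrable)
  have [measurable]: "D \<in> borel_measurable borel" "c \<in> borel_measurable borel"
    using borel_measurable_integrable[OF D] c by simp_all
  show "(\<lambda>(t, x). indicator {0..h} t * D (x + c t)) \<in> borel_measurable (lborel \<Otimes>\<^sub>M lborel)"
    by measurable
  have "(LBINT x. norm (indicator {0..h} t * D (x + c t))) = indicator {0..h} t * (LBINT x. norm (D x))" for t
    using integral_lborel_translate[of "\<lambda>x. norm (D x)" "c t"]
    by (simp add: norm_mult abs_mult)
  moreover have "integrable lborel (indicator {0..h} :: real \<Rightarrow> real)"
    by (rule integrable_real_indicator) (auto simp: emeasure_lborel_Icc_eq)
  ultimately show "integrable lborel (\<lambda>t. LBINT x. norm (case (t, x) of (t, x) \<Rightarrow> indicator {0..h} t * D (x + c t)))"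
    by simp
  show "AE t in lborel. integrable lborel (\<lambda>x. case (t, x) of (t, x) \<Rightarrow> indicator {0..h} t * D (x + c t))"
    using D by (simp add: integrable_lborel_translate)
qed

text \<open>Translation invariance makes the mean of an integrated difference quotient vanish.\<close>
lemma integral_partial_derivative_eq_0:
  assumes F: "has_partials F D" and e: "e \<in> Basis"
    and D: "continuous_on UNIV (D e)" "integrable lborel (D e)" and "integrable lborel F"
  shows "(LBINT x. D e x) = 0"
proof -
  have [measurable]: "D e \<in> borel_measurable borel" "F \<in> borel_measurable borel"
    using assms by auto
  have ftc: "(LBINT t. indicator {0..1} t * D e (x + t *\<^sub>R e)) = F (x + e) - F x" for x
  proof -
    have "((\<lambda>t. F (x + t *\<^sub>R e)) has_real_derivative D e (x + t *\<^sub>R e)) (at t)" for t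
      using has_partials_along_line[OF F, of x e t] sum_inner_Basis_delta[OF e, of "\<lambda>b. D b (x + t *\<^sub>R e)"] by simp
    moreover have "isCont (\<lambda>t. D e (x + t *\<^sub>R e)) t" for t
    proof (rule isCont_o2[of t "\<lambda>t. x + t *\<^sub>R e" "D e"])
      show "isCont (D e) (x + t *\<^sub>R e)"
        using D(1) continuous_on_eq_continuous_at[OF open_UNIV] by blast
    qed (intro continuous_intros)
    ultimately show ?thesis
      using integral_FTC_Icc_real[of 0 1 "\<lambda>t. F (x + t *\<^sub>R e)" "\<lambda>t. D e (x + t *\<^sub>R e)"]
      by (simp add: mult.commute)
  qed
  have "(LBINT x. (LBINT t. indicator {0..1} t * D e (x + t *\<^sub>R e)))
      = (LBINT t. (LBINT x. indicator {0..1} t * D e (x + t *\<^sub>R e)))"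
    by (rule lborel_pair.Fubini_integral) (rule integrable_translates_pair[OF D(2)], measurable)
  also have "\<dots> = (LBINT x. D e x)"
    using integral_lborel_translate[of "D e"] by simp
  finally show ?thesis
    using assms(5) unfolding ftc
    by (simp add: integral_lborel_translate integrable_lborel_translate Bochner_Integration.integral_diff)
qed

definition conv :: "('a::euclidean_space \<Rightarrow> real) \<Rightarrow> ('a \<Rightarrow> real) \<Rightarrow> 'a \<Rightarrow> real" where
  "conv h K x = (LBINT y. h y * K (x - y))"

lemma integrable_conv_kernel:
  fixes h K :: "'a::euclidean_space \<Rightarrow> real"
  assumes h: "integrable lborel h" and [measurable]: "K \<in> borel_measurable borel" and B: "\<And>z. \<bar>K z\<bar> \<le> B"
  shows "integrable lborel (\<lambda>y. h y * K (x - y))"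
proof (rule Bochner_Integration.integrable_bound)
  show "integrable lborel (\<lambda>y. B * h y)" using h by simp
  have [measurable]: "h \<in> borel_measurable borel" using borel_measurable_integrable[OF h] by simp
  show "(\<lambda>y. h y * K (x - y)) \<in> borel_measurable lborel" by measurable
  have "\<bar>K (x - y)\<bar> * \<bar>h y\<bar> \<le> \<bar>B\<bar> * \<bar>h y\<bar>" for y
    using B[of "x - y"] by (intro mult_right_mono) auto
  then show "AE y in lborel. norm (h y * K (x - y)) \<le> norm (B * h y)"
    by (simp add: abs_mult mult.commute)
qed

lemma has_partials_Lipschitz:
  fixes K :: "'a::euclidean_space \<Rightarrow> real"
  assumes K: "has_partials K D" and B: "\<And>b z. b \<in> Basis \<Longrightarrow> \<bar>D b z\<bar> \<le> B"
  shows "\<bar>K x - K y\<bar> \<le> real DIM('a) * B * norm (x - y)"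
proof -
  have *: "\<bar>\<Sum>b\<in>Basis. (d \<bullet> b) * D b z\<bar> \<le> real DIM('a) * B * norm d" for d z
  proof -
    have "\<bar>\<Sum>b\<in>Basis. (d \<bullet> b) * D b z\<bar> \<le> (\<Sum>b\<in>(Basis :: 'a set). norm d * B)"
      by (intro order_trans[OF sum_abs] sum_mono)
        (auto simp: abs_mult intro!: mult_mono B Basis_le_norm)
    then show ?thesis by (simp add: mult_ac)
  qed
  have "norm (K x - K y) \<le> real DIM('a) * B * norm (x - y)"
  proof (rule differentiable_bound[of UNIV])
    fix z show "(K has_derivative (\<lambda>d. \<Sum>b\<in>Basis. (d \<bullet> b) * D b z)) (at z within UNIV)"
      using K by (simp add: has_partials_def)
    show "onorm (\<lambda>d. \<Sum>b\<in>Basis. (d \<bullet> b) * D b z) \<le> real DIM('a) * B"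
      using * by (intro onorm_le) auto
  qed auto
  then show ?thesis by simp
qed

text \<open>The derivative falls on the kernel, so \<open>h\<close> need only be integrable. The
  Lipschitz bound on \<open>K\<close> dominates the first-order remainder quotient by a multiple of
  \<open>h\<close>, and dominated convergence applies.\<close>

lemma conv_has_partials:
  fixes h K :: "'a::euclidean_space \<Rightarrow> real"
  assumes h: "integrable lborel h" and K: "has_partials K D"
    and B: "\<And>z. \<bar>K z\<bar> \<le> B" "\<And>b z. b \<in> Basis \<Longrightarrow> \<bar>D b z\<bar> \<le> B"
    and D [measurable]: "\<And>b. b \<in> Basis \<Longrightarrow> D b \<in> borel_measurable borel"
  shows "has_partials (conv h K) (\<lambda>b. conv h (D b))"
  unfolding has_partials_def
proof
  fix x :: 'a
  have [measurable]: "h \<in> borel_measurable borel" using borel_measurable_integrable[OF h] by simp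
  have [measurable]: "K \<in> borel_measurable borel" using K by (rule has_partials_borel)
  define L where "L = (\<lambda>d. \<Sum>b\<in>Basis. (d \<bullet> b) * conv h (D b) x)"
  \<comment> \<open>The remainder quotient of \<open>K\<close> at \<open>x - y\<close>, weighted by
    \<open>h y\<close>; its integral is the remainder quotient of the convolution with candidate
    derivative \<open>L\<close>.\<close>
  define q where "q = (\<lambda>d y. h y * ((K (x + d - y) - K (x - y) - (\<Sum>b\<in>Basis. (d \<bullet> b) * D b (x - y))) / norm d))"
  have Lbl: "bounded_linear L" unfolding L_def
    by (intro bounded_linear_sum bounded_linear_mult_left[THEN bounded_linear_compose] bounded_linear_inner_left)
  have q_int: "(LBINT y. q d y) = (conv h K (x + d) - conv h K x - L d) / norm d" for d
  proof -
    have "(LBINT y. q d y)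
       = (LBINT y. (h y * K (x + d - y) - h y * K (x - y) - (\<Sum>b\<in>Basis. (d \<bullet> b) * (h y * D b (x - y)))) / norm d)"
      unfolding q_def by (intro Bochner_Integration.integral_cong) 
        (auto simp: algebra_simps diff_divide_distrib add_divide_distrib sum_distrib_left)
    also have "\<dots> = (conv h K (x + d) - conv h K x - L d) / norm d"
    proof -
      have 1: "integrable lborel (\<lambda>y. h y * K (x' - y))" for x'
        by (rule integrable_conv_kernel[OF h _ B(1)]) simp
      have 2: "integrable lborel (\<lambda>y. h y * D b (x - y))" if "b \<in> Basis" for b
        using that by (intro integrable_conv_kernel[OF h _ B(2)] D)
      then have 3: "integrable lborel (\<lambda>y. \<Sum>b\<in>Basis. (d \<bullet> b) * (h y * D b (x - y)))"
        by (intro Bochner_Integration.integrable_sum integrable_mult_right)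
      have "(LBINT y. (\<Sum>b\<in>Basis. (d \<bullet> b) * (h y * D b (x - y)))) = L d"
        unfolding L_def conv_def using 2 by (subst Bochner_Integration.integral_sum) auto
      then show ?thesis
        using 1 3 by (simp add: conv_def Bochner_Integration.integral_diff)
    qed
    finally show ?thesis .
  qed
  have B0: "B \<ge> 0" using B(1)[of 0] by linarith
  have q_bound: "\<bar>q d y\<bar> \<le> (2 * real DIM('a) * B) * \<bar>h y\<bar>" for d y
  proof (cases "d = 0")
    case False
    have "\<bar>K (x + d - y) - K (x - y)\<bar> \<le> real DIM('a) * B * norm d"
      using has_partials_Lipschitz[OF K B(2), of "x + d - y" "x - y"] by simp
    moreover have "\<bar>\<Sum>b\<in>Basis. (d \<bullet> b) * D b (x - y)\<bar> \<le> (\<Sum>b\<in>(Basis :: 'a set). norm d * B)"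
      by (intro order_trans[OF sum_abs] sum_mono) (auto simp: abs_mult intro!: mult_mono B Basis_le_norm)
    ultimately have "\<bar>K (x + d - y) - K (x - y) - (\<Sum>b\<in>Basis. (d \<bullet> b) * D b (x - y))\<bar>
       \<le> (2 * real DIM('a) * B) * norm d"
      by (simp add: mult_ac)
    then have "\<bar>K (x + d - y) - K (x - y) - (\<Sum>b\<in>Basis. (d \<bullet> b) * D b (x - y))\<bar> / norm d
       \<le> 2 * real DIM('a) * B" using False by (simp add: field_simps)
    then have "\<bar>h y\<bar> * (\<bar>K (x + d - y) - K (x - y) - (\<Sum>b\<in>Basis. (d \<bullet> b) * D b (x - y))\<bar> / norm d)
       \<le> \<bar>h y\<bar> * (2 * real DIM('a) * B)" by (intro mult_left_mono) auto
    then show ?thesis unfolding q_def by (simp add: abs_mult mult_ac)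
  qed (use B0 in \<open>simp add: q_def\<close>)
  have "(\<lambda>d. LBINT y. q d y) \<midarrow>0\<rightarrow> 0"
    unfolding tendsto_at_iff_sequentially comp_def
  proof (intro allI impI)
    fix X :: "nat \<Rightarrow> 'a" assume X: "\<forall>i. X i \<in> UNIV - {0}" "X \<longlonglongrightarrow> 0"
    have "(\<lambda>i. LBINT y. q (X i) y) \<longlonglongrightarrow> (\<integral>y. 0 \<partial>(lborel::'a measure))"
    proof (rule integral_dominated_convergence[where w = "\<lambda>y. (2 * real DIM('a) * B) * \<bar>h y\<bar>"])
      show "integrable lborel (\<lambda>y. (2 * real DIM('a) * B) * \<bar>h y\<bar>)" using h by simp
      show "AE y in lborel. (\<lambda>i. q (X i) y) \<longlonglongrightarrow> 0"
      proof (intro AE_I2)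
        fix y
        have "((\<lambda>d. norm (K (x - y + d) - K (x - y) - (\<Sum>b\<in>Basis. (d \<bullet> b) * D b (x - y))) / norm d) \<longlongrightarrow> 0) (at 0)"
          using K unfolding has_partials_def has_derivative_at by blast
        then have "(\<lambda>i. norm (K (x - y + X i) - K (x - y) - (\<Sum>b\<in>Basis. (X i \<bullet> b) * D b (x - y))) / norm (X i)) \<longlonglongrightarrow> 0"
          using X unfolding tendsto_at_iff_sequentially comp_def by blast
        from tendsto_mult_right_zero[OF this, of "\<bar>h y\<bar>"]
        have "(\<lambda>i. \<bar>q (X i) y\<bar>) \<longlonglongrightarrow> 0"
          unfolding q_def by (simp add: abs_mult diff_add_eq)
        then show "(\<lambda>i. q (X i) y) \<longlonglongrightarrow> 0" by (rule tendsto_rabs_zero_cancel)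
      qed
      show "(\<lambda>y. q (X i) y) \<in> borel_measurable lborel" for i
        unfolding q_def by measurable
    qed (use q_bound in auto)
    then show "(\<lambda>i. LBINT y. q (X i) y) \<longlonglongrightarrow> 0" by simp
  qed
  then have "(\<lambda>d. norm (conv h K (x + d) - conv h K x - L d) / norm d) \<midarrow>0\<rightarrow> 0"
    unfolding q_int using tendsto_rabs_zero by fastforce
  then show "(conv h K has_derivative (\<lambda>d. \<Sum>b\<in>Basis. (d \<bullet> b) * conv h (D b) x)) (at x)"
    unfolding has_derivative_at using Lbl by (simp add: L_def)
qed

lemma poly_gauss_bounded:
  fixes K :: "'a::euclidean_space \<Rightarrow> real"
  assumes "K \<in> poly_gauss a" "a > 0"
  obtains B where "\<And>x. \<bar>K x\<bar> \<le> B"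
proof -
  obtain C where C: "\<And>x. \<bar>K x\<bar> \<le> C * exp (- (a/2) * (norm x)\<^sup>2)" "C \<ge> 0"
    using poly_gauss_decay[OF assms] by metis
  have "C * exp (- (a/2) * (norm x)\<^sup>2) \<le> C * 1" for x :: 'a
    using C(2) assms(2) by (intro mult_left_mono) auto
  then show ?thesis using C(1) that by (metis order_trans)
qed

lemma poly_gauss_continuous: "K \<in> poly_gauss a \<Longrightarrow> continuous_on UNIV K"
  using poly_gauss_partials has_partials_continuous by blast

lemma poly_gauss_borel: "K \<in> poly_gauss a \<Longrightarrow> K \<in> borel_measurable borel"
  by (intro borel_measurable_continuous_onI poly_gauss_continuous)

lemma conv_poly_gauss_partials:
  fixes h K :: "'a::euclidean_space \<Rightarrow> real"
  assumes h: "integrable lborel h" and K: "K \<in> poly_gauss a" "a > 0" "has_partials K D"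
    and D: "\<And>b. b \<in> Basis \<Longrightarrow> D b \<in> poly_gauss a"
  shows "has_partials (conv h K) (\<lambda>b. conv h (D b))"
proof -
  have "\<exists>B. \<forall>z. \<bar>D b z\<bar> \<le> B" if "b \<in> Basis" for b
    using poly_gauss_bounded[OF D[OF that] K(2)] by metis
  then obtain Bd where Bd: "\<And>b z. b \<in> Basis \<Longrightarrow> \<bar>D b z\<bar> \<le> Bd b" by metis
  obtain B0 where B0: "\<And>z. \<bar>K z\<bar> \<le> B0" using poly_gauss_bounded[OF K(1,2)] by metis
  define B where "B = \<bar>B0\<bar> + (\<Sum>b\<in>Basis. \<bar>Bd b\<bar>)"
  have 1: "\<bar>K z\<bar> \<le> B" for z
  proof -
    have "0 \<le> (\<Sum>b\<in>Basis. \<bar>Bd b\<bar>)" by (intro sum_nonneg) auto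
    then show ?thesis using B0[of z] unfolding B_def by linarith
  qed
  have 2: "\<bar>D b z\<bar> \<le> B" if "b \<in> Basis" for b z
  proof -
    have "\<bar>Bd b\<bar> \<le> (\<Sum>b\<in>Basis. \<bar>Bd b\<bar>)" using that by (intro member_le_sum) auto
    then show ?thesis using Bd[OF that, of z] unfolding B_def by linarith
  qed
  show ?thesis using conv_has_partials[OF h K(3) 1 2] D poly_gauss_borel by blast
qed

lemma conv_poly_gauss_smooth:
  fixes h K :: "'a::euclidean_space \<Rightarrow> real"
  assumes "integrable lborel h" "K \<in> poly_gauss a" "a > 0"
  shows "smooth (conv h K)"
proof (rule smooth_closed_class[of _ "conv h ` poly_gauss a"])
  fix f assume "f \<in> conv h ` poly_gauss a"
  then obtain K where K: "K \<in> poly_gauss a" "f = conv h K" by auto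
  then obtain D where "\<forall>b. D b \<in> poly_gauss a" "has_partials K D" using poly_gauss_partials by blast
  then show "\<exists>D. (\<forall>b\<in>Basis. D b \<in> conv h ` poly_gauss a) \<and> has_partials f D"
    using conv_poly_gauss_partials[OF assms(1) K(1) assms(3)] K(2)
    by (intro exI[of _ "\<lambda>b. conv h (D b)"]) auto
qed (use assms in auto)

lemma conv_poly_gauss_continuous:
  assumes "integrable lborel h" "K \<in> poly_gauss a" "a > 0"
  shows "continuous_on UNIV (conv h K)"
  using has_partials_continuous[OF smooth_has_partials[OF conv_poly_gauss_smooth[OF assms]]] .

text \<open>The weights \<open>A\<close> and \<open>B\<close> allow a multiplier \<open>g\<close> of polynomial growth.\<close>
lemma conv_Fubini:
  fixes g h K :: "'a::euclidean_space \<Rightarrow> real"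
  assumes [measurable]: "g \<in> borel_measurable borel" "h \<in> borel_measurable borel" "K \<in> borel_measurable borel"
    and A: "integrable lborel (\<lambda>x. A x * h x)" and B: "integrable lborel (\<lambda>z. B z * K z)"
    and g: "\<And>x z. \<bar>g (x + z)\<bar> \<le> A x * B z"
  shows "integrable lborel (\<lambda>y. g y * conv h K y)"
    and "integrable lborel (\<lambda>x. h x * (LBINT y. g y * K (y - x)))"
    and "(LBINT y. g y * conv h K y) = (LBINT x. h x * (LBINT y. g y * K (y - x)))"
proof -
  have nn: "A x * B z = \<bar>A x\<bar> * \<bar>B z\<bar>" for x z using g[of x z] by (metis abs_ge_zero abs_mult abs_of_nonneg order_trans)
  have z: "integrable lborel (\<lambda>z. g (x + z) * K z)" for x
  proof (rule Bochner_Integration.integrable_bound[where f = "\<lambda>z. A x * (B z * K z)"])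
    have "\<bar>g (x + z)\<bar> * \<bar>K z\<bar> \<le> (\<bar>A x\<bar> * \<bar>B z\<bar>) * \<bar>K z\<bar>" for z
      using g[of x z] nn[of x z] by (intro mult_right_mono) auto
    then show "AE z in lborel. norm (g (x + z) * K z) \<le> norm (A x * (B z * K z))"
      by (simp add: abs_mult mult.assoc)
  qed (use B in auto)
  have z_le: "(LBINT z. \<bar>g (x + z) * K z\<bar>) \<le> \<bar>A x\<bar> * (LBINT z. \<bar>B z * K z\<bar>)" for x
  proof -
    have "(LBINT z. \<bar>g (x + z) * K z\<bar>) \<le> (LBINT z. \<bar>A x\<bar> * \<bar>B z * K z\<bar>)"
    proof (rule integral_mono)
      show "\<bar>g (x + z) * K z\<bar> \<le> \<bar>A x\<bar> * \<bar>B z * K z\<bar>" for z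
        using mult_right_mono[OF order_trans[OF g[of x z] eq_refl[OF nn[of x z]]], of "\<bar>K z\<bar>"]
        by (simp add: abs_mult mult.assoc)
    qed (use z B in auto)
    then show ?thesis by simp
  qed
  have y: "integrable lborel (\<lambda>y. g y * K (y - x))"
     "(LBINT y. \<bar>g y * K (y - x)\<bar>) = (LBINT z. \<bar>g (x + z) * K z\<bar>)" for x
    using z[of x] integrable_lborel_translate[of "\<lambda>y. g y * K (y - x)" x]
      integral_lborel_translate[of "\<lambda>y. \<bar>g y * K (y - x)\<bar>" x] by (simp_all add: add.commute)
  have 3: "integrable (lborel \<Otimes>\<^sub>M lborel) (\<lambda>(x, y). g y * h x * K (y - x))"
  proof (rule lborel_pair.Fubini_integrable)
    show "(\<lambda>(x, y). g y * h x * K (y - x)) \<in> borel_measurable (lborel \<Otimes>\<^sub>M lborel)" by measurable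
    have eq: "(LBINT y. norm (g y * h x * K (y - x))) = \<bar>h x\<bar> * (LBINT z. \<bar>g (x + z) * K z\<bar>)" for x
      unfolding y(2)[symmetric] Bochner_Integration.integral_mult_right_zero[symmetric]
      by (intro Bochner_Integration.integral_cong) (auto simp: abs_mult)
    show "integrable lborel (\<lambda>x. LBINT y. norm (case (x, y) of (x, y) \<Rightarrow> g y * h x * K (y - x)))"
      unfolding split_conv eq
    proof (rule Bochner_Integration.integrable_bound[where f = "\<lambda>x. (LBINT z. \<bar>B z * K z\<bar>) * (A x * h x)"])
      have "\<bar>h x\<bar> * (LBINT z. \<bar>g (x + z) * K z\<bar>) \<le> \<bar>h x\<bar> * (\<bar>A x\<bar> * (LBINT z. \<bar>B z * K z\<bar>))" for x
        using z_le by (intro mult_left_mono) auto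
      then show "AE x in lborel. norm (\<bar>h x\<bar> * (LBINT z. \<bar>g (x + z) * K z\<bar>))
          \<le> norm ((LBINT z. \<bar>B z * K z\<bar>) * (A x * h x))"
        by (simp add: abs_mult mult_ac)
    qed (use A in auto)
    show "AE x in lborel. integrable lborel (\<lambda>y. case (x, y) of (x, y) \<Rightarrow> g y * h x * K (y - x))"
    proof (intro AE_I2)
      fix x show "integrable lborel (\<lambda>y. case (x, y) of (x, y) \<Rightarrow> g y * h x * K (y - x))"
        using integrable_mult_right[OF y(1), of "h x" x] by (simp add: mult_ac)
    qed
  qed
  have e: "(LBINT y. g y * h x * K (y - x)) = h x * (LBINT y. g y * K (y - x))" for x
    unfolding Bochner_Integration.integral_mult_right_zero[symmetric]
    by (intro Bochner_Integration.integral_cong) auto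
  show "integrable lborel (\<lambda>y. g y * conv h K y)"
    using lborel_pair.integrable_snd[OF 3] by (simp add: conv_def mult.assoc)
  show "integrable lborel (\<lambda>x. h x * (LBINT y. g y * K (y - x)))"
    using lborel_pair.integrable_fst[OF 3] by (simp only: e)
  have "(LBINT y. LBINT x. g y * h x * K (y - x)) = (LBINT x. LBINT y. g y * h x * K (y - x))"
    by (rule lborel_pair.Fubini_integral[OF 3])
  then show "(LBINT y. g y * conv h K y) = (LBINT x. h x * (LBINT y. g y * K (y - x)))"
    unfolding e by (simp add: conv_def mult.assoc)
qed


section \<open>The heat kernel\<close>

text \<open>The parameter \<open>s\<close> is the variance per coordinate. In this normalisation the
  kernel solves the heat equation with half the Laplacian, which is the origin of the factor 1/2 in
  \<open>de_Bruijn\<close>.\<close>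

definition gauss :: "real \<Rightarrow> 'a::euclidean_space \<Rightarrow> real" where
  "gauss s z = (2 * pi * s) powr (- real DIM('a) / 2) * exp (- (norm z)\<^sup>2 / (2 * s))"

lemma std_gaussian_eq: "std_gaussian = density lborel (\<lambda>x::'a::euclidean_space. ennreal (gauss 1 x))"
  by (simp add: std_gaussian_def gauss_def)

lemma gauss_pos: "s > 0 \<Longrightarrow> gauss s z > 0"
  by (simp add: gauss_def)

lemma gauss_nonneg: "gauss s z \<ge> 0"
  by (simp add: gauss_def)

lemma gauss_minus_commute: "gauss s (x - y) = gauss s (y - x)"
  by (simp add: gauss_def norm_minus_commute)

lemma gauss_poly_gauss: "gauss s \<in> poly_gauss (1 / (2 * s))"
  unfolding poly_gauss_def
  by (intro CollectI exI[of _ "\<lambda>_. (2 * pi * s) powr (- real DIM('a) / 2)"] conjI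
      real_polynomial_function.intros(2)) (auto simp: gauss_def fun_eq_iff)

lemmas poly_gauss_times_gauss = poly_gauss_poly_mult[OF gauss_poly_gauss]

lemma gauss_borel [measurable]: "gauss s \<in> borel_measurable borel"
  by (rule poly_gauss_borel[OF gauss_poly_gauss])

lemma gauss_partials:
  assumes "s > 0"
  shows "has_partials (gauss s) (\<lambda>b z. - (z \<bullet> b) / s * gauss s z)"
proof -
  have "has_partials (\<lambda>z::'a. (\<lambda>t. (2 * pi * s) powr (- real DIM('a) / 2) * exp (- t / (2 * s))) ((norm z)\<^sup>2))
    (\<lambda>b z. ((2 * pi * s) powr (- real DIM('a) / 2) * (exp (- (norm z)\<^sup>2 / (2 * s)) * (- 1 / (2 * s)))) * (2 * (z \<bullet> b)))"
    by (rule has_partials_compose[OF has_partials_norm_power2]) (use assms in \<open>auto intro!: derivative_eq_intros\<close>)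
  moreover have "(\<lambda>b z::'a. ((2 * pi * s) powr (- real DIM('a) / 2) * (exp (- (norm z)\<^sup>2 / (2 * s)) * (- 1 / (2 * s)))) * (2 * (z \<bullet> b)))
     = (\<lambda>b z. - (z \<bullet> b) / s * gauss s z)"
    using assms by (auto simp: fun_eq_iff gauss_def field_simps)
  moreover have "(\<lambda>z::'a. (\<lambda>t. (2 * pi * s) powr (- real DIM('a) / 2) * exp (- t / (2 * s))) ((norm z)\<^sup>2)) = gauss s"
    by (auto simp: fun_eq_iff gauss_def)
  ultimately show ?thesis by simp
qed

lemma has_partials_inner: "has_partials (\<lambda>z. z \<bullet> v) (\<lambda>b z. b \<bullet> v)"
  unfolding has_partials_def
proof
  fix x :: 'a
  have "(\<lambda>d. \<Sum>b\<in>Basis. (d \<bullet> b) * (b \<bullet> v)) = (\<lambda>d. d \<bullet> v)"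
  proof
    fix d show "(\<Sum>b\<in>Basis. (d \<bullet> b) * (b \<bullet> v)) = d \<bullet> v"
      unfolding euclidean_inner[of d v] by (intro sum.cong) (auto simp: inner_commute)
  qed
  moreover have "((\<lambda>z. z \<bullet> v) has_derivative (\<lambda>d. d \<bullet> v)) (at x)"
    by (auto intro!: derivative_eq_intros)
  ultimately show "((\<lambda>z. z \<bullet> v) has_derivative (\<lambda>d. \<Sum>b\<in>Basis. (d \<bullet> b) * (b \<bullet> v))) (at x)" by simp
qed

lemma inner_gauss_partials:
  assumes "s > 0"
  shows "has_partials (\<lambda>z. (z \<bullet> v) * gauss s z) (\<lambda>b z. ((b \<bullet> v) - (z \<bullet> v) * (z \<bullet> b) / s) * gauss s z)"
  using has_partials_mult[OF has_partials_inner gauss_partials[OF assms], of v]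
  by (simp add: algebra_simps)

lemma inner_gauss_poly_gauss: "(\<lambda>z. (z \<bullet> v) * gauss s z) \<in> poly_gauss (1 / (2 * s))"
  by (rule poly_gauss_times_gauss[OF real_polynomial_function_inner])

lemma inner2_gauss_poly_gauss:
  "(\<lambda>z. (c + d * ((z \<bullet> v) * (z \<bullet> w))) * gauss s z) \<in> poly_gauss (1 / (2 * s))"
  by (rule poly_gauss_times_gauss)
    (intro real_polynomial_function.intros(2-4) real_polynomial_function_inner)

text \<open>The kernel factors over the coordinates into one-dimensional normal densities with
  standard deviation \<open>sqrt s\<close>.\<close>

lemma nn_integral_gauss:
  assumes s: "s > 0"
  shows "(\<integral>\<^sup>+z. ennreal (gauss s z) \<partial>(lborel :: 'a::euclidean_space measure)) = 1"
proof -
  have "gauss s z = (\<Prod>b\<in>Basis. normal_density 0 (sqrt s) (z \<bullet> b))" for z :: 'a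
  proof -
    have "(\<Prod>b\<in>Basis. normal_density 0 (sqrt s) (z \<bullet> b))
       = (\<Prod>b\<in>(Basis::'a set). 1 / sqrt (2 * pi * s)) * (\<Prod>b\<in>(Basis::'a set). exp (- (z \<bullet> b)\<^sup>2 / (2 * s)))"
      using s unfolding normal_density_def prod.distrib[symmetric] by simp
    also have "(\<Prod>b\<in>(Basis::'a set). exp (- (z \<bullet> b)\<^sup>2 / (2 * s))) = exp (- (norm z)\<^sup>2 / (2 * s))"
      unfolding power2_norm_eq_inner euclidean_inner[of z z]
      by (simp add: exp_sum[symmetric] sum_negf sum_divide_distrib[symmetric] power2_eq_square)
    also have "(\<Prod>b\<in>(Basis::'a set). 1 / sqrt (2 * pi * s)) = (2 * pi * s) powr (- real DIM('a) / 2)"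
    proof -
      have "1 / sqrt (2 * pi * s) = (2 * pi * s) powr (- 1 / 2)"
        using s by (simp add: powr_minus powr_half_sqrt field_simps)
      then show ?thesis using s by (simp add: powr_powr flip: powr_realpow)
    qed
    finally show ?thesis by (simp add: gauss_def)
  qed
  then have "(\<integral>\<^sup>+z. ennreal (gauss s z) \<partial>(lborel :: 'a measure))
     = (\<integral>\<^sup>+z. (\<Prod>b\<in>Basis. ennreal (normal_density 0 (sqrt s) (z \<bullet> b))) \<partial>(lborel :: 'a measure))"
    by (simp add: prod_ennreal)
  also have "\<dots> = (\<Prod>b\<in>(Basis::'a set). (\<integral>\<^sup>+x. ennreal (normal_density 0 (sqrt s) x) \<partial>lborel))"
    by (rule nn_integral_lborel_prod) auto
  also have "(\<integral>\<^sup>+x. ennreal (normal_density 0 (sqrt s) x) \<partial>lborel) = 1"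
    using integral_normal_density[of "sqrt s" 0] integrable_normal_density[of "sqrt s" 0] s
    by (subst nn_integral_eq_integral) auto
  finally show ?thesis by simp
qed

lemma integrable_gauss: "s > 0 \<Longrightarrow> integrable lborel (gauss s)"
  by (rule integrableI_bounded) (auto simp: nn_integral_gauss gauss_nonneg)

lemma integral_gauss: "s > 0 \<Longrightarrow> (LBINT z. gauss s z) = 1"
  using nn_integral_gauss[of s] by (subst integral_eq_nn_integral) (auto simp: gauss_nonneg)

text \<open>The exponent \<open>- (a/2)\<close> left by \<open>poly_gauss_decay\<close> is exactly
  that of a Gaussian of variance \<open>1 / a\<close>.\<close>

lemma poly_gauss_le_gauss:
  fixes K :: "'a::euclidean_space \<Rightarrow> real"
  assumes "K \<in> poly_gauss a" "a > 0"
  obtains C where "\<And>x. \<bar>K x\<bar> \<le> C * gauss (1 / a) x" "C \<ge> 0"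
proof -
  obtain C where C: "\<And>x. \<bar>K x\<bar> \<le> C * exp (- (a/2) * (norm x)\<^sup>2)" "C \<ge> 0"
    using poly_gauss_decay[OF assms] by metis
  define c where "c = (2 * pi * (1 / a)) powr (- real DIM('a) / 2)"
  have c: "c > 0" unfolding c_def using assms(2) by simp
  have "exp (- (a/2) * (norm x)\<^sup>2) = gauss (1 / a) x / c" for x :: 'a
    using c unfolding gauss_def c_def[symmetric] by (simp add: field_simps)
  then show ?thesis using C c that[of "C / c"] by simp
qed

lemma poly_gauss_integrable:
  assumes "K \<in> poly_gauss a" "a > 0"
  shows "integrable lborel K"
proof -
  obtain C where C: "\<And>x. \<bar>K x\<bar> \<le> C * gauss (1 / a) x" "C \<ge> 0"
    using poly_gauss_le_gauss[OF assms] by metis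
  show ?thesis
    by (rule Bochner_Integration.integrable_bound[of _ "\<lambda>x. C * gauss (1 / a) x"])
      (use C assms integrable_gauss[of "1 / a"] poly_gauss_borel[OF assms(1)] in \<open>auto simp: gauss_nonneg\<close>)
qed

lemma poly_times_gauss_integrable:
  assumes "real_polynomial_function P" "s > 0"
  shows "integrable lborel (\<lambda>x. P x * gauss s x)"
  using poly_gauss_integrable[OF poly_gauss_times_gauss[OF assms(1)]] assms(2) by simp

lemma integral_inner_gauss:
  assumes s: "s > 0" and e: "e \<in> Basis"
  shows "(LBINT z. (z \<bullet> e) * gauss s z) = 0"
proof -
  have pg: "(\<lambda>z. - (z \<bullet> e) / s * gauss s z) \<in> poly_gauss (1 / (2 * s))"
    using poly_gauss_times_gauss[OF real_polynomial_function.intros(4)[OF real_polynomial_function.intros(2)[of "- 1 / s"] real_polynomial_function_inner]]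
    by simp
  have "(LBINT z. - (z \<bullet> e) / s * gauss s z) = 0"
    using poly_gauss_continuous[OF pg] poly_gauss_integrable[OF pg] s
    by (intro integral_partial_derivative_eq_0[OF gauss_partials e] integrable_gauss) auto
  then have "(LBINT z. (- 1 / s) * ((z \<bullet> e) * gauss s z)) = 0" by simp
  then show ?thesis using s unfolding Bochner_Integration.integral_mult_right_zero by simp
qed

text \<open>Gaussian integration by parts: the derivative of
  \<open>(z \<bullet> v) * gauss s z\<close> in direction \<open>e\<close> has integral zero, and by
  the product rule it contains both the mass and the second moment.\<close>

lemma integral_inner_inner_gauss:
  assumes s: "s > 0" and e: "e \<in> Basis"
  shows "(LBINT z. (z \<bullet> v) * (z \<bullet> e) * gauss s z) = s * (v \<bullet> e)"
proof -
  have eq: "(\<lambda>z. ((e \<bullet> v) - (z \<bullet> v) * (z \<bullet> e) / s) * gauss s z)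
      = (\<lambda>z. ((e \<bullet> v) + (- 1 / s) * ((z \<bullet> v) * (z \<bullet> e))) * gauss s z)" by auto
  have pg: "(\<lambda>z. ((e \<bullet> v) - (z \<bullet> v) * (z \<bullet> e) / s) * gauss s z) \<in> poly_gauss (1 / (2 * s))"
    unfolding eq by (rule inner2_gauss_poly_gauss)
  have i: "integrable lborel (\<lambda>z. (z \<bullet> v) * (z \<bullet> e) * gauss s z)"
    by (intro poly_times_gauss_integrable real_polynomial_function.intros(4) real_polynomial_function_inner s)
  have "0 = (LBINT z. ((e \<bullet> v) - (z \<bullet> v) * (z \<bullet> e) / s) * gauss s z)"
    using poly_gauss_continuous[OF pg] poly_gauss_integrable[OF pg] poly_gauss_integrable[OF inner_gauss_poly_gauss] s
    by (intro integral_partial_derivative_eq_0[OF inner_gauss_partials e, symmetric]) auto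
  also have "\<dots> = (LBINT z. (e \<bullet> v) * gauss s z - (z \<bullet> v) * (z \<bullet> e) * gauss s z / s)"
    by (intro Bochner_Integration.integral_cong) (auto simp: algebra_simps)
  also have "\<dots> = (e \<bullet> v) - (LBINT z. (z \<bullet> v) * (z \<bullet> e) * gauss s z) / s"
      proof (subst Bochner_Integration.integral_diff)
    show "integrable lborel (\<lambda>z. (z \<bullet> v) * (z \<bullet> e) * gauss s z / s)" using i by (rule integrable_divide)
  qed (simp_all add: integral_gauss integrable_gauss s)
  finally show ?thesis using s by (simp add: field_simps inner_commute)
qed

lemma integral_inner_power2_gauss:
  fixes v :: "'a::euclidean_space"
  assumes s: "s > 0"
  shows "(LBINT z. (z \<bullet> v)\<^sup>2 * gauss s z) = s * (norm v)\<^sup>2"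
proof -
  have i: "integrable lborel (\<lambda>z. (z \<bullet> v) * (z \<bullet> e) * gauss s z)" for e
    by (intro poly_times_gauss_integrable real_polynomial_function.intros(4) real_polynomial_function_inner s)
  have "(z \<bullet> v)\<^sup>2 * gauss s z = (\<Sum>e\<in>Basis. (v \<bullet> e) * ((z \<bullet> v) * (z \<bullet> e) * gauss s z))" for z
    unfolding power2_eq_square by (subst (2) euclidean_inner[of z v])
      (auto simp: sum_distrib_left sum_distrib_right mult_ac intro!: sum.cong)
  then have "(LBINT z. (z \<bullet> v)\<^sup>2 * gauss s z) = (\<Sum>e\<in>Basis. (v \<bullet> e) * (s * (v \<bullet> e)))"
    using i by (simp add: Bochner_Integration.integral_sum integral_inner_inner_gauss s)
  also have "\<dots> = s * (norm v)\<^sup>2"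
    unfolding power2_norm_eq_inner euclidean_inner[of v v] sum_distrib_left
    by (intro sum.cong) auto
  finally show ?thesis .
qed

lemma real_polynomial_function_norm_power2: "real_polynomial_function (\<lambda>z::'a::euclidean_space. (norm z)\<^sup>2)"
  unfolding power2_norm_eq_inner
  by (subst euclidean_inner, rule real_polynomial_function_sum[OF finite_Basis], rule real_polynomial_function.intros(4))
    (rule real_polynomial_function_inner)+

lemma integral_norm_power2_gauss:
  assumes s: "s > 0"
  shows "(\<integral>z. (norm z)\<^sup>2 * gauss s z \<partial>(lborel :: 'a::euclidean_space measure)) = s * real DIM('a)"
proof -
  have i: "integrable lborel (\<lambda>z::'a. (z \<bullet> e)\<^sup>2 * gauss s z)" for e
    unfolding power2_eq_square
    by (intro poly_times_gauss_integrable real_polynomial_function.intros(4) real_polynomial_function_inner s)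
  have "(norm z)\<^sup>2 * gauss s z = (\<Sum>e\<in>Basis. (z \<bullet> e)\<^sup>2 * gauss s z)" for z :: 'a
    unfolding power2_norm_eq_inner euclidean_inner[of z z]
    by (simp add: sum_distrib_right power2_eq_square)
  then show ?thesis
    using i by (simp add: Bochner_Integration.integral_sum integral_inner_power2_gauss s)
qed

lemma gauss_time_derivative:
  fixes z :: "'a::euclidean_space"
  assumes "s > 0"
  shows "((\<lambda>s. gauss s z) has_real_derivative
    ((norm z)\<^sup>2 / (2 * s\<^sup>2) - real DIM('a) / (2 * s)) * gauss s z) (at s)"
proof -
  have "((\<lambda>s. gauss s z) has_real_derivative
    (2 * pi * s) powr (- real DIM('a) / 2) * (exp (- (norm z)\<^sup>2 / (2 * s)) * ((norm z)\<^sup>2 * 2 / (2 * s)\<^sup>2))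
     + (- real DIM('a) / 2) * (2 * pi * s) powr (- real DIM('a) / 2 - 1) * (2 * pi) * exp (- (norm z)\<^sup>2 / (2 * s))) (at s)"
    unfolding gauss_def using assms
    by (auto intro!: derivative_eq_intros simp: power2_eq_square)
  moreover have "(2 * pi * s) powr (- real DIM('a) / 2 - 1) = (2 * pi * s) powr (- real DIM('a) / 2) / (2 * pi * s)"
    using assms by (simp add: powr_diff)
  ultimately show ?thesis
    unfolding gauss_def using assms
    by (auto elim!: DERIV_cong simp: power2_eq_square field_simps)
qed

section \<open>Smooth compactly supported cutoffs\<close>

text \<open>The powers of \<open>1 / t\<close> make the family stable under differentiation: the
  derivative of member \<open>k\<close> combines members \<open>k + 1\<close> and
  \<open>k + 2\<close>. Member 0 is the classical smooth function that is flat at the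
  origin.\<close>

definition bump_profile :: "nat \<Rightarrow> real \<Rightarrow> real" where
  "bump_profile k t = (if t > 0 then (1 / t) ^ k * exp (- 1 / t) else 0)"

lemma bump_profile_nonneg: "bump_profile k t \<ge> 0"
  by (simp add: bump_profile_def)

text \<open>One term of the exponential series, of order \<open>k + m\<close>, bounds
  \<open>exp (1 / t)\<close> from below. The case \<open>m = 2\<close> gives differentiability at 0,
  the case \<open>m = 0\<close> a uniform bound.\<close>

lemma bump_profile_le_power: "bump_profile k t \<le> fact (k + m) * \<bar>t\<bar> ^ m"
proof (cases "t > 0")
  case True
  have "(1 / t) ^ (k + m) / fact (k + m) \<le> exp (1 / t)"
  proof -
    have "(\<Sum>n\<in>{k + m}. (1 / t) ^ n /\<^sub>R fact n) \<le> (\<Sum>n. (1 / t) ^ n /\<^sub>R fact n)"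
      using True by (intro sum_le_suminf summable_exp_generic) auto
    then show ?thesis by (simp add: exp_def divide_inverse mult.commute)
  qed
  then have "(1 / t) ^ k * exp (- 1 / t) \<le> fact (k + m) * t ^ m"
    using True by (simp add: exp_minus power_add field_simps)
  then show ?thesis using True by (simp add: bump_profile_def)
qed (simp add: bump_profile_def)

lemma bump_profile_derivative:
  "(bump_profile k has_real_derivative (bump_profile (k + 2) t - real k * bump_profile (k + 1) t)) (at t)"
proof -
  consider "t > 0" | "t = 0" | "t < 0" by linarith
  then show ?thesis
  proof cases
    case 1
    have "((\<lambda>t. (1 / t) ^ k * exp (- 1 / t)) has_real_derivative
      (1 / t) ^ k * (exp (- 1 / t) * (1 / t\<^sup>2)) + real k * (1 / t) ^ (k - 1) * (- 1 / t\<^sup>2) * exp (- 1 / t)) (at t)"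
      using 1 by (auto intro!: derivative_eq_intros simp: power2_eq_square)
    moreover have "(1 / t) ^ k * (exp (- 1 / t) * (1 / t\<^sup>2)) + real k * (1 / t) ^ (k - 1) * (- 1 / t\<^sup>2) * exp (- 1 / t)
      = bump_profile (k + 2) t - real k * bump_profile (k + 1) t"
      using 1 by (cases k) (simp_all add: bump_profile_def power2_eq_square field_simps)
    ultimately have "((\<lambda>t. (1 / t) ^ k * exp (- 1 / t)) has_real_derivative
        (bump_profile (k + 2) t - real k * bump_profile (k + 1) t)) (at t)" by simp
    then show ?thesis
      by (rule has_field_derivative_transform_within_open[where S = "{0<..}"])
        (use 1 in \<open>auto simp: bump_profile_def\<close>)
  next
    case 2
    have "((\<lambda>h. bump_profile k h / h) \<longlongrightarrow> 0) (at 0)"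
    proof (rule Lim_null_comparison)
      \<comment> \<open>The quadratic bound leaves one power of \<open>h\<close> after the division,
        so the difference quotient tends to 0.\<close>
      have "norm (bump_profile k h / h) \<le> fact (k + 2) * \<bar>h\<bar>" for h
      proof (cases "h = 0")
        case False
        then show ?thesis using bump_profile_le_power[of k h 2] bump_profile_nonneg[of k h]
          unfolding real_norm_def abs_divide power2_abs
          by (simp add: divide_le_eq power2_eq_square mult_ac del: power2_abs fact_Suc)
      qed simp
      then show "\<forall>\<^sub>F h in at 0. norm (bump_profile k h / h) \<le> fact (k + 2) * \<bar>h\<bar>" by simp
      show "((\<lambda>h. fact (k + 2) * \<bar>h\<bar>) \<longlongrightarrow> (0::real)) (at 0)"
        by (auto intro!: tendsto_eq_intros)
    qed
    then show ?thesis using 2 by (simp add: has_field_derivative_iff bump_profile_def)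
  next
    case 3
    have "((\<lambda>t. 0) has_real_derivative (bump_profile (k + 2) t - real k * bump_profile (k + 1) t)) (at t)"
      using 3 by (simp add: bump_profile_def)
    then show ?thesis
      by (rule has_field_derivative_transform_within_open[where S = "{..<0}"])
        (use 3 in \<open>auto simp: bump_profile_def\<close>)
  qed
qed

text \<open>The factor \<open>exp 1\<close> normalises the value at the origin to 1. The argument
  uses the squared norm, which is smooth at the origin, and for \<open>R > 0\<close> it is
  nonpositive outside the ball of radius \<open>R\<close>.\<close>

definition bump :: "real \<Rightarrow> 'a::euclidean_space \<Rightarrow> real" where
  "bump R x = exp 1 * bump_profile 0 (1 - (norm x)\<^sup>2 / R\<^sup>2)"

lemma has_partials_bump_arg:
  "has_partials (\<lambda>x. 1 - (norm x)\<^sup>2 / R\<^sup>2) (\<lambda>b x. - (2 / R\<^sup>2) * (x \<bullet> b))"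
proof -
  have "has_partials (\<lambda>x::'a. (\<lambda>t. 1 - t / R\<^sup>2) ((norm x)\<^sup>2)) (\<lambda>b x. (- 1 / R\<^sup>2) * (2 * (x \<bullet> b)))"
    by (rule has_partials_compose[OF has_partials_norm_power2])
      (auto intro!: derivative_eq_intros simp: power2_eq_square divide_inverse)
  then show ?thesis by simp
qed

text \<open>The induction must range over all \<open>P\<close> and \<open>k\<close>: a partial
  derivative is a sum of three products of the same shape, with other polynomials and with profile
  indices \<open>k\<close>, \<open>k + 1\<close> and \<open>k + 2\<close>.\<close>

lemma poly_bump_Ck:
  fixes P :: "'a::euclidean_space \<Rightarrow> real"
  assumes "real_polynomial_function P"
  shows "Ck m (\<lambda>x. P x * bump_profile k (1 - (norm x)\<^sup>2 / R\<^sup>2))"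
  using assms
proof (induction m arbitrary: P k)
  case 0
  obtain D where "has_partials P D"
    using real_polynomial_function_has_derivative[OF 0] unfolding has_partials_def by blast
  from has_partials_continuous[OF has_partials_mult[OF this
      has_partials_compose[OF has_partials_bump_arg bump_profile_derivative]]]
  show ?case by simp
next
  case (Suc m)
  let ?q = "\<lambda>x::'a. 1 - (norm x)\<^sup>2 / R\<^sup>2"
  obtain D where D: "\<And>b. real_polynomial_function (D b)" "has_partials P D"
    using real_polynomial_function_has_derivative[OF Suc.prems] unfolding has_partials_def by auto
  have "has_partials (\<lambda>x. P x * bump_profile k (?q x))
    (\<lambda>b x. P x * ((bump_profile (k + 2) (?q x) - real k * bump_profile (k + 1) (?q x)) * (- (2 / R\<^sup>2) * (x \<bullet> b)))
       + D b x * bump_profile k (?q x))"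
    by (rule has_partials_mult[OF D(2) has_partials_compose[OF has_partials_bump_arg bump_profile_derivative]])
  moreover have "Ck m (\<lambda>x. P x * ((bump_profile (k + 2) (?q x) - real k * bump_profile (k + 1) (?q x)) * (- (2 / R\<^sup>2) * (x \<bullet> b)))
       + D b x * bump_profile k (?q x))" for b
  proof -
    have "real_polynomial_function (\<lambda>x. P x * (c * (x \<bullet> b)))" for c
      by (intro real_polynomial_function.intros(2-4) Suc.prems real_polynomial_function_inner)
    then have "Ck m (\<lambda>x. (P x * (- (2 / R\<^sup>2) * (x \<bullet> b))) * bump_profile (k + 2) (?q x) +
       ((P x * ((real k * 2 / R\<^sup>2) * (x \<bullet> b))) * bump_profile (k + 1) (?q x) + D b x * bump_profile k (?q x)))"
      by (intro Ck_add Suc.IH D(1))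
    moreover have "(P x * (- (2 / R\<^sup>2) * (x \<bullet> b))) * bump_profile (k + 2) (?q x) +
       ((P x * ((real k * 2 / R\<^sup>2) * (x \<bullet> b))) * bump_profile (k + 1) (?q x) + D b x * bump_profile k (?q x))
      = P x * ((bump_profile (k + 2) (?q x) - real k * bump_profile (k + 1) (?q x)) * (- (2 / R\<^sup>2) * (x \<bullet> b)))
       + D b x * bump_profile k (?q x)" for x
      by (simp only: algebra_simps) (simp add: algebra_simps)
    ultimately show ?thesis by (simp only:)
  qed
  ultimately show ?case using Ck_Suc_partials by blast
qed

lemma bump_smooth: "smooth (bump R :: 'a::euclidean_space \<Rightarrow> real)"
  unfolding smooth_def
proof
  fix k show "Ck k (bump R :: 'a \<Rightarrow> real)"
    using poly_bump_Ck[OF real_polynomial_function.intros(2), of k "exp 1" 0 R] by (simp add: bump_def[abs_def])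
qed

lemma bump_partials:
  "has_partials (bump R) (\<lambda>b x. exp 1 * (bump_profile 2 (1 - (norm x)\<^sup>2 / R\<^sup>2) * (- (2 / R\<^sup>2) * (x \<bullet> b))))"
proof -
  have "has_partials (\<lambda>x::'a. exp (1::real)) (\<lambda>b x. 0)" by (simp add: has_partials_def)
  from has_partials_mult[OF this has_partials_compose[OF has_partials_bump_arg[of R] bump_profile_derivative[of 0]]]
  show ?thesis by (simp add: bump_def[abs_def] power2_eq_square numeral_2_eq_2)
qed

lemma bump_profile_eq_0:
  assumes "R > 0" "norm x \<ge> R"
  shows "bump_profile k (1 - (norm x)\<^sup>2 / R\<^sup>2) = 0"
proof -
  have "R\<^sup>2 \<le> (norm x)\<^sup>2" using assms by (intro power_mono) auto
  then have "1 - (norm x)\<^sup>2 / R\<^sup>2 \<le> 0" using assms by (simp add: field_simps)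
  then show ?thesis by (simp add: bump_profile_def)
qed

lemma bump_nonneg: "bump R x \<ge> 0"
  by (simp add: bump_def bump_profile_nonneg)

lemma bump_eq_0: "R > 0 \<Longrightarrow> norm x \<ge> R \<Longrightarrow> bump R x = 0"
  by (simp add: bump_def bump_profile_eq_0)

lemma bump_pos: "norm x < R \<Longrightarrow> bump R x > 0"
proof -
  assume x: "norm x < R"
  then have "(norm x)\<^sup>2 < R\<^sup>2" "R > 0" 
    using power_strict_mono[of "norm x" R 2] norm_ge_zero[of x] by (auto simp del: norm_ge_zero)
  then have "1 - (norm x)\<^sup>2 / R\<^sup>2 > 0" by (simp add: divide_less_eq)
  then show ?thesis by (simp add: bump_def bump_profile_def)
qed

lemma bump_le_1: "bump R x \<le> 1"
proof -
  have "bump_profile 0 t \<le> exp (- 1)" if "t \<le> 1" for t :: real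
    using that by (simp add: bump_profile_def field_simps)
  from this[of "1 - (norm x)\<^sup>2 / R\<^sup>2"] have "exp 1 * bump_profile 0 (1 - (norm x)\<^sup>2 / R\<^sup>2) \<le> exp 1 * exp (- 1)"
    by (intro mult_left_mono) auto
  then show ?thesis by (simp add: bump_def exp_minus)
qed

lemma bump_tendsto_1: "(\<lambda>n. bump (real (Suc n)) x) \<longlonglongrightarrow> 1"
proof -
  have "(\<lambda>n. 1 - (norm x)\<^sup>2 / (real (Suc n))\<^sup>2) \<longlonglongrightarrow> 1 - (norm x)\<^sup>2 * 0"
    unfolding divide_inverse
    by (intro tendsto_intros tendsto_inverse_0_at_top filterlim_pow_at_top filterlim_compose[OF filterlim_real_sequentially filterlim_Suc]) auto
  then have "(\<lambda>n. bump_profile 0 (1 - (norm x)\<^sup>2 / (real (Suc n))\<^sup>2)) \<longlonglongrightarrow> bump_profile 0 1"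
    by (intro isCont_tendsto_compose[OF DERIV_isCont[OF bump_profile_derivative]]) simp
  then have "(\<lambda>n. bump (real (Suc n)) x) \<longlonglongrightarrow> exp 1 * bump_profile 0 1"
    unfolding bump_def by (intro tendsto_intros)
  then show ?thesis by (simp add: bump_profile_def exp_minus)
qed

text \<open>The decay in \<open>R\<close> makes the error terms of a cutoff disappear as the radius
  grows. The profile is at most 2, the inner derivative is \<open>2 / R\<^sup>2\<close> times a
  coordinate of size at most \<open>R\<close>, and \<open>exp 1\<close> is the
  normalisation.\<close>

lemma bump_partial_bound:
  fixes x :: "'a::euclidean_space"
  assumes R: "R > 0" and b: "b \<in> Basis"
  shows "\<bar>frechet_derivative (bump R) (at x) b\<bar> \<le> 4 * exp 1 / R"
proof -
  have eq: "frechet_derivative (bump R) (at x) b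
     = exp 1 * (bump_profile 2 (1 - (norm x)\<^sup>2 / R\<^sup>2) * (- (2 / R\<^sup>2) * (x \<bullet> b)))"
    by (rule has_partials_frechet[OF bump_partials b])
  show ?thesis
  proof (cases "norm x < R")
    case True
    have "\<bar>bump_profile 2 (1 - (norm x)\<^sup>2 / R\<^sup>2)\<bar> \<le> 2"
      using bump_profile_le_power[of 2 "1 - (norm x)\<^sup>2 / R\<^sup>2" 0] bump_profile_nonneg[of 2 "1 - (norm x)\<^sup>2 / R\<^sup>2"]
      by simp
    moreover have "\<bar>x \<bullet> b\<bar> \<le> R" using Basis_le_norm[OF b, of x] True by linarith
    ultimately have "\<bar>bump_profile 2 (1 - (norm x)\<^sup>2 / R\<^sup>2)\<bar> * \<bar>x \<bullet> b\<bar> \<le> 2 * R"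
      by (intro mult_mono) auto
    then have "(2 * exp 1 / R\<^sup>2) * (\<bar>bump_profile 2 (1 - (norm x)\<^sup>2 / R\<^sup>2)\<bar> * \<bar>x \<bullet> b\<bar>) \<le> (2 * exp 1 / R\<^sup>2) * (2 * R)"
      by (intro mult_left_mono) auto
    then show ?thesis unfolding eq using R by (simp add: abs_mult power2_eq_square mult_ac)
  next
    case False
    then have "R\<^sup>2 \<le> (norm x)\<^sup>2" using R by (intro power_mono) auto
    then have "1 - (norm x)\<^sup>2 / R\<^sup>2 \<le> 0" using R by (simp add: field_simps)
    then have "bump_profile 2 (1 - (norm x)\<^sup>2 / R\<^sup>2) = 0" by (simp add: bump_profile_def)
    then show ?thesis unfolding eq using R by simp
  qed
qed

lemma bump_borel [measurable]: "bump R \<in> borel_measurable borel"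
  by (rule has_partials_borel[OF bump_partials])

lemma bump_partial_borel [measurable]:
  "b \<in> Basis \<Longrightarrow> (\<lambda>x::'a::euclidean_space. frechet_derivative (bump R) (at x) b) \<in> borel_measurable borel"
proof -
  assume b: "b \<in> Basis"
  have "Ck (Suc 0) (bump R :: 'a \<Rightarrow> real)" using bump_smooth unfolding smooth_def by blast
  then show ?thesis using b by (intro borel_measurable_continuous_onI) simp
qed

lemma bump_partial_eq_0: "R > 0 \<Longrightarrow> norm x \<ge> R \<Longrightarrow> b \<in> Basis \<Longrightarrow> frechet_derivative (bump R) (at x) b = 0"
  unfolding has_partials_frechet[OF bump_partials] by (simp add: bump_profile_eq_0)

lemma test_function_bump_mult:
  assumes "R > 0" "smooth \<psi>"
  shows "test_function (\<lambda>x. bump R x * \<psi> x)"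
  unfolding test_function_def
proof
  show "smooth (\<lambda>x. bump R x * \<psi> x)" using bump_smooth assms(2) by (rule smooth_mult)
  have "{x. bump R x * \<psi> x \<noteq> 0} \<subseteq> cball 0 R"
  proof
    fix x assume "x \<in> {x. bump R x * \<psi> x \<noteq> 0}"
    then have "\<not> R \<le> norm x" using bump_eq_0[OF assms(1), of x] by auto
    then show "x \<in> cball 0 R" by (simp add: dist_norm)
  qed
  then have "closure {x. bump R x * \<psi> x \<noteq> 0} \<subseteq> cball 0 R" by (intro closure_minimal) auto
  then show "compact (closure {x. bump R x * \<psi> x \<noteq> 0})"
    using bounded_subset[OF bounded_cball] by (auto simp: compact_eq_bounded_closed)
qed


section \<open>Approximation of integrable functions by the heat flow\<close>

text \<open>Two applications of dominated convergence: first \<open>v\<close> is truncated in value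
  and in space, then the truncation is approximated by continuous functions kept within the same
  bound and supported in a slightly larger ball.\<close>

lemma integrable_approx_continuous_compact_support:
  fixes v :: "'a::euclidean_space \<Rightarrow> real"
  assumes v: "integrable lborel v" and "\<epsilon> > 0"
  obtains g R where "continuous_on UNIV g" "\<And>x. norm x \<ge> R \<Longrightarrow> g x = 0" "R > 0"
    "integrable lborel g" "(LBINT x. \<bar>v x - g x\<bar>) < \<epsilon>"
proof -
  have [measurable]: "v \<in> borel_measurable borel" using borel_measurable_integrable[OF v] by simp
  define V where "V = (\<lambda>(n::nat) x. if \<bar>v x\<bar> \<le> real n \<and> norm x \<le> real n then v x else 0)"
  have [measurable]: "V n \<in> borel_measurable borel" for n unfolding V_def by measurable
  have "(\<lambda>n. LBINT x. \<bar>v x - V n x\<bar>) \<longlonglongrightarrow> (\<integral>x. 0 \<partial>(lborel::'a measure))"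
  proof (rule integral_dominated_convergence[where w = "\<lambda>x. \<bar>v x\<bar>"])
    show "AE x in lborel. (\<lambda>n. \<bar>v x - V n x\<bar>) \<longlonglongrightarrow> 0"
    proof (intro AE_I2 tendsto_eventually)
      fix x
      obtain N where N: "real N \<ge> max \<bar>v x\<bar> (norm x)" using real_arch_simple by blast
      show "\<forall>\<^sub>F n in sequentially. \<bar>v x - V n x\<bar> = 0"
        using eventually_ge_at_top[of N]
      proof eventually_elim
        case (elim n)
        then have "real N \<le> real n" by simp
        then show ?case using N by (simp add: V_def)
      qed
    qed
    show "AE x in lborel. norm \<bar>v x - V n x\<bar> \<le> \<bar>v x\<bar>" for n by (auto simp: V_def)
  qed (use v in auto)
  then obtain k where k: "(LBINT x. \<bar>v x - V k x\<bar>) < \<epsilon> / 2"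
    using order_tendstoD(2)[of _ 0 sequentially "\<epsilon> / 2"] assms(2) by (auto simp: eventually_sequentially)
  \<comment> \<open>This notion of measurability yields, outside a negligible set, a pointwise limit
    of continuous functions.\<close>
  have "V k measurable_on UNIV"
    by (rule lebesgue_measurable_imp_measurable_on_real) (auto intro: measurable_completion)
  then obtain N g where N: "negligible N" and gc: "\<And>n. continuous_on UNIV (g n)"
    and gl: "\<And>x. x \<notin> N \<Longrightarrow> (\<lambda>n. g n x) \<longlonglongrightarrow> V k x"
    unfolding measurable_on_def by auto
  define cut where "cut = (\<lambda>x::'a. max 0 (min 1 (real k + 1 - norm x)))"
  \<comment> \<open>Clamping and cutting off provide an integrable majorant; neither changes the
    limit, since \<open>V k\<close> is bounded by \<open>k\<close> and vanishes outside the ball of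
    radius \<open>k\<close>, where \<open>cut\<close> equals 1.\<close>
  define G where "G = (\<lambda>n x. max (- real k) (min (real k) (g n x)) * cut x)"
  have Gc: "continuous_on UNIV (G n)" for n
    unfolding G_def cut_def by (intro continuous_intros gc)
  have [measurable]: "G n \<in> borel_measurable borel" for n
    using Gc by (rule borel_measurable_continuous_onI)
  have cut: "0 \<le> cut x" "cut x \<le> 1" "norm x \<le> real k \<Longrightarrow> cut x = 1" "norm x \<ge> real k + 1 \<Longrightarrow> cut x = 0" for x
    by (auto simp: cut_def)
  have Gb: "\<bar>G n x\<bar> \<le> real k * indicator (cball 0 (real k + 1)) x" for n x
  proof (cases "norm x \<le> real k + 1")
    case True
    have "\<bar>max (- real k) (min (real k) (g n x))\<bar> \<le> real k" by auto
    then have "\<bar>max (- real k) (min (real k) (g n x))\<bar> * \<bar>cut x\<bar> \<le> real k * 1"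
      using cut[of x] by (intro mult_mono) auto
    then show ?thesis using True by (simp add: G_def abs_mult indicator_def dist_norm)
  qed (use cut(4)[of x] in \<open>auto simp: G_def indicator_def dist_norm\<close>)
  have ind: "integrable lborel (indicator (cball (0::'a) (real k + 1)) :: 'a \<Rightarrow> real)"
    by (intro integrable_real_indicator) (use emeasure_bounded_finite[OF bounded_cball] in auto)
  have Gi: "integrable lborel (G n)" for n
    by (rule Bochner_Integration.integrable_bound[of _ "\<lambda>x. real k * indicator (cball 0 (real k + 1)) x"])
      (use ind Gb in \<open>auto intro!: integrable_mult_right AE_I2\<close>)
  have Vi: "integrable lborel (V k)"
    by (rule Bochner_Integration.integrable_bound[OF v]) (auto simp: V_def)
  have "(\<lambda>n. LBINT x. \<bar>V k x - G n x\<bar>) \<longlonglongrightarrow> (\<integral>x. 0 \<partial>(lborel::'a measure))"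
  proof (rule integral_dominated_convergence[where w = "\<lambda>x. \<bar>V k x\<bar> + real k * indicator (cball 0 (real k + 1)) x"])
    have "AE x in lebesgue. x \<notin> N"
      using N by (auto simp: negligible_iff_null_sets AE_not_in)
    then have "AE x in lborel. x \<notin> N" by (simp add: AE_completion_iff)
    then show "AE x in lborel. (\<lambda>n. \<bar>V k x - G n x\<bar>) \<longlonglongrightarrow> 0"
    proof eventually_elim
      case (elim x)
      have "(\<lambda>n. G n x) \<longlonglongrightarrow> max (- real k) (min (real k) (V k x)) * cut x"
        unfolding G_def by (intro tendsto_intros gl elim)
      also have "max (- real k) (min (real k) (V k x)) * cut x = V k x"
        using cut(3)[of x] by (auto simp: V_def)
      finally show ?case by (subst abs_minus_commute) (intro tendsto_rabs_zero LIM_zero)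
    qed
    show "AE x in lborel. norm \<bar>V k x - G n x\<bar> \<le> \<bar>V k x\<bar> + real k * indicator (cball 0 (real k + 1)) x" for n
      using Gb[of n] by (intro AE_I2) (smt (verit) real_norm_def)
  qed (use Vi ind in auto)
  then obtain n where n: "(LBINT x. \<bar>V k x - G n x\<bar>) < \<epsilon> / 2"
    using order_tendstoD(2)[of _ 0 sequentially "\<epsilon> / 2"] assms(2) by (auto simp: eventually_sequentially)
  have "(LBINT x. \<bar>v x - G n x\<bar>) \<le> (LBINT x. \<bar>v x - V k x\<bar> + \<bar>V k x - G n x\<bar>)"
    by (intro integral_mono) (use v Vi Gi in auto)
  also have "\<dots> = (LBINT x. \<bar>v x - V k x\<bar>) + (LBINT x. \<bar>V k x - G n x\<bar>)"
    by (intro Bochner_Integration.integral_add) (use v Vi Gi in auto)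
  also have "\<dots> < \<epsilon>" using k n by simp
  finally have "(LBINT x. \<bar>v x - G n x\<bar>) < \<epsilon>" .
  moreover have "G n x = 0" if "norm x \<ge> real k + 1" for x using cut(4)[OF that] by (simp add: G_def)
  ultimately show ?thesis using Gc Gi by (intro that[of "G n" "real k + 1"]) auto
qed

text \<open>For a continuous compactly supported \<open>g\<close> the claim is uniform continuity on
  a ball. For \<open>v\<close> the approximation error is paid twice, once for \<open>v\<close> and
  once for its translate, which have the same L1 distance from \<open>g\<close> and its
  translate.\<close>

lemma translation_continuous_L1:
  fixes v :: "'a::euclidean_space \<Rightarrow> real"
  assumes v: "integrable lborel v" and "\<epsilon> > 0"
  obtains \<delta> where "\<delta> > 0" "\<And>z. norm z < \<delta> \<Longrightarrow> (LBINT x. \<bar>v (x + z) - v x\<bar>) \<le> \<epsilon>"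
proof -
  obtain g R where g: "continuous_on UNIV g" "\<And>x. norm x \<ge> R \<Longrightarrow> g x = 0" "R > 0"
    "integrable lborel g" "(LBINT x. \<bar>v x - g x\<bar>) < \<epsilon> / 3"
    using integrable_approx_continuous_compact_support[OF v, of "\<epsilon> / 3"] assms(2) by auto
  have [measurable]: "v \<in> borel_measurable borel" "g \<in> borel_measurable borel"
    using borel_measurable_integrable[OF v] borel_measurable_integrable[OF g(4)] by simp_all
  define m where "m = measure lborel (cball (0::'a) (R + 1))"
  \<comment> \<open>For shifts shorter than 1 the difference of \<open>g\<close> lives on the ball
    of volume \<open>m\<close>, so its integral is at most a third of \<epsilon>; the summand 1
    keeps the denominator positive.\<close>
  define \<eta> where "\<eta> = \<epsilon> / (3 * (1 + m))"
  have m: "m \<ge> 0" by (simp add: m_def)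
  have \<eta>: "\<eta> > 0" using m assms(2) by (simp add: \<eta>_def)
  have "uniformly_continuous_on (cball 0 (R + 2)) g"
    by (intro compact_uniformly_continuous continuous_on_subset[OF g(1)]) auto
  then obtain d where d: "d > 0" "\<And>x y. x \<in> cball 0 (R + 2) \<Longrightarrow> y \<in> cball 0 (R + 2) \<Longrightarrow> dist y x < d \<Longrightarrow> dist (g y) (g x) < \<eta>"
    unfolding uniformly_continuous_on_def using \<eta> by metis
  have "(LBINT x. \<bar>v (x + z) - v x\<bar>) \<le> \<epsilon>" if z: "norm z < min d 1" for z
  proof -
    have gb: "\<bar>g (x + z) - g x\<bar> \<le> \<eta> * indicator (cball 0 (R + 1)) x" for x
    proof (cases "norm x \<le> R + 1")
      case True
      have "norm (x + z) \<le> R + 2" using True z norm_triangle_ineq[of x z] by simp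
      moreover have "dist (x + z) x < d" using z by (simp add: dist_norm)
      ultimately have "dist (g (x + z)) (g x) < \<eta>" using d(2)[of x "x + z"] True by (simp add: mem_cball_0)
      then show ?thesis using True by (simp add: dist_norm indicator_def)
    next
      case False
      have "norm x \<le> norm (x + z) + norm z" using norm_triangle_ineq4[of "x + z" z] by simp
      then have "norm (x + z) \<ge> R" using False z by simp
      then show ?thesis using False g(2) \<eta> by (simp add: indicator_def)
    qed
    have ind: "integrable lborel (indicator (cball (0::'a) (R + 1)) :: 'a \<Rightarrow> real)"
      by (intro integrable_real_indicator) (use emeasure_bounded_finite[OF bounded_cball] in auto)
    have vz: "integrable lborel (\<lambda>x. v (x + z))" "integrable lborel (\<lambda>x. g (x + z))"
      using v g(4) by (simp_all add: integrable_lborel_translate)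
    have "(LBINT x. \<bar>v (x + z) - v x\<bar>)
       \<le> (LBINT x. \<bar>v (x + z) - g (x + z)\<bar> + (\<eta> * indicator (cball 0 (R + 1)) x + \<bar>v x - g x\<bar>))"
    proof (rule integral_mono)
      show "\<bar>v (x + z) - v x\<bar> \<le> \<bar>v (x + z) - g (x + z)\<bar> + (\<eta> * indicator (cball 0 (R + 1)) x + \<bar>v x - g x\<bar>)" for x
        using gb[of x] by linarith
    qed (use vz v g(4) ind in auto)
    also have "\<dots> = (LBINT x. \<bar>v (x + z) - g (x + z)\<bar>) + (\<eta> * m + (LBINT x. \<bar>v x - g x\<bar>))"
      using vz v g(4) ind by (simp add: m_def Bochner_Integration.integral_add)
    also have "(LBINT x. \<bar>v (x + z) - g (x + z)\<bar>) = (LBINT x. \<bar>v x - g x\<bar>)"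
      by (rule integral_lborel_translate[of "\<lambda>x. \<bar>v x - g x\<bar>"]) simp
    also have "\<eta> * m \<le> \<epsilon> / 3"
    proof -
      have "\<eta> * m \<le> \<eta> * (1 + m)" using \<eta> by simp
      moreover have "\<eta> * (1 + m) = \<epsilon> / 3" using m unfolding \<eta>_def by (simp add: field_simps)
      ultimately show ?thesis by simp
    qed
    finally show ?thesis using g(5) by linarith
  qed
  then show ?thesis using that[of "min d 1"] d(1) by simp
qed

lemma conv_const_Fubini:
  fixes h K :: "'a::euclidean_space \<Rightarrow> real"
  assumes h: "integrable lborel h" and K: "integrable lborel K"
  shows "integrable lborel (conv h K)"
    and "(LBINT x. conv h K x) = (LBINT x. h x) * (LBINT x. K x)"
proof -
  have [measurable]: "h \<in> borel_measurable borel" "K \<in> borel_measurable borel"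
    using h K borel_measurable_integrable by (simp_all add: borel_measurable_integrable)
  have "(LBINT y. K (y - x)) = (LBINT y. K y)" for x
    using integral_lborel_translate[of K "-x"] by simp
  then show "integrable lborel (conv h K)"
    "(LBINT x. conv h K x) = (LBINT x. h x) * (LBINT x. K x)"
    using conv_Fubini[of "\<lambda>_. 1" h K "\<lambda>_. 1" "\<lambda>_. 1"] h K by (simp_all add: mult.commute)
qed

lemma conv_gauss_nonneg: "(\<And>x. h x \<ge> 0) \<Longrightarrow> conv h (gauss s) x \<ge> 0"
  unfolding conv_def by (intro Bochner_Integration.integral_nonneg) (simp add: gauss_nonneg)

lemma conv_gauss_L1_contraction:
  fixes h :: "'a::euclidean_space \<Rightarrow> real"
  assumes h: "integrable lborel h" and s: "s > 0"
  shows "(LBINT x. \<bar>conv h (gauss s) x\<bar>) \<le> (LBINT x. \<bar>h x\<bar>)"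
proof -
  have g: "integrable lborel (gauss s)" using s by (rule integrable_gauss)
  have "(LBINT x. \<bar>conv h (gauss s) x\<bar>) \<le> (LBINT x. conv (\<lambda>x. \<bar>h x\<bar>) (gauss s) x)"
  proof (rule integral_mono)
    fix x show "\<bar>conv h (gauss s) x\<bar> \<le> conv (\<lambda>x. \<bar>h x\<bar>) (gauss s) x"
      unfolding conv_def by (rule order_trans[OF integral_abs_bound]) (simp add: abs_mult gauss_nonneg)
  qed (use conv_const_Fubini(1)[OF _ g] h in auto)
  also have "\<dots> = (LBINT x. \<bar>h x\<bar>)"
    using conv_const_Fubini(2)[OF _ g, of "\<lambda>x. \<bar>h x\<bar>"] h s by (simp add: integral_gauss)
  finally show ?thesis .
qed

text \<open>The L1 modulus of translation is bounded by a small constant plus a multiple of the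
  squared shift. Averaged against the heat kernel, the quadratic part becomes \<open>s\<close> times
  the dimension and vanishes with \<open>s\<close>.\<close>

lemma conv_gauss_tendsto_L1:
  fixes v :: "'a::euclidean_space \<Rightarrow> real"
  assumes v: "integrable lborel v"
  shows "(\<lambda>n. LBINT x. \<bar>conv v (gauss (1 / real (Suc n))) x - v x\<bar>) \<longlonglongrightarrow> 0"
proof (rule LIMSEQ_I)
  fix r :: real assume r: "r > 0"
  have [measurable]: "v \<in> borel_measurable borel" using borel_measurable_integrable[OF v] by simp
  obtain \<delta> where \<delta>: "\<delta> > 0" "\<And>z. norm z < \<delta> \<Longrightarrow> (LBINT x. \<bar>v (x + z) - v x\<bar>) \<le> r / 2"
    using translation_continuous_L1[OF v, of "r / 2"] r by auto
  define I where "I = (LBINT x. \<bar>v x\<bar>)"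
  \<comment> \<open>A shift of length at least \<delta> changes the L1 norm by at most
    \<open>2 * I\<close>, which \<open>C * (norm z)\<^sup>2\<close> then exceeds.\<close>
  define C where "C = 2 * I / \<delta>\<^sup>2"
  have I: "I \<ge> 0" by (simp add: I_def)
  have C: "C \<ge> 0" using I by (simp add: C_def)
  have i: "integrable lborel (\<lambda>x. \<bar>v (x - z) - v x\<bar>)" for z
    using v integrable_lborel_translate[of v "-z"] by auto
  have \<omega>: "(LBINT x. \<bar>v (x - z) - v x\<bar>) \<le> r / 2 + C * (norm z)\<^sup>2" for z
  proof (cases "norm z < \<delta>")
    case True
    then show ?thesis using \<delta>(2)[of "-z"] C by (simp add: add_increasing2)
  next
    case False
    have "(LBINT x. \<bar>v (x - z) - v x\<bar>) \<le> (LBINT x. \<bar>v (x - z)\<bar> + \<bar>v x\<bar>)"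
      using v integrable_lborel_translate[of v "-z"] by (intro integral_mono) auto
    also have "\<dots> = 2 * I"
      using v integrable_lborel_translate[of v "-z"] integral_lborel_translate[of "\<lambda>x. \<bar>v x\<bar>" "-z"]
      by (simp add: I_def)
    also have "\<dots> \<le> C * (norm z)\<^sup>2"
    proof -
      have "\<delta>\<^sup>2 \<le> (norm z)\<^sup>2" using False \<delta>(1) by (intro power_mono) auto
      then have "(2 * I) * \<delta>\<^sup>2 \<le> (2 * I) * (norm z)\<^sup>2" using I by (intro mult_left_mono) auto
      then show ?thesis using \<delta>(1) by (simp add: C_def field_simps)
    qed
    finally show ?thesis using r by simp
  qed
  have bound: "(LBINT x. \<bar>conv v (gauss s) x - v x\<bar>) \<le> r / 2 + C * (s * real DIM('a))" if s: "s > 0" for s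
  proof -
    have gi: "integrable lborel (\<lambda>z::'a. gauss s z * (r / 2 + C * (norm z)\<^sup>2))"
    proof -
      have "integrable lborel (\<lambda>z::'a. (r / 2) * gauss s z + C * ((norm z)\<^sup>2 * gauss s z))"
        by (intro Bochner_Integration.integrable_add integrable_mult_right integrable_gauss s
            poly_times_gauss_integrable[OF real_polynomial_function_norm_power2])
      then show ?thesis by (simp add: algebra_simps)
    qed
    have ci: "integrable lborel (\<lambda>z. gauss s z * (v (x - z) - v x))" for x
    proof -
      have "integrable lborel (\<lambda>z. v z * gauss s (x - z))"
      proof -
        obtain B where "\<And>z::'a. \<bar>gauss s z\<bar> \<le> B" using poly_gauss_bounded[OF gauss_poly_gauss] s by (metis divide_pos_pos mult_pos_pos zero_less_numeral zero_less_one)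
        then show ?thesis by (intro integrable_conv_kernel[OF v]) auto
      qed
      then have "integrable lborel (\<lambda>z. v (x - z) * gauss s z)"
        using integrable_lborel_reflect[of "\<lambda>z. v z * gauss s (x - z)" x] by simp
      then show ?thesis using integrable_gauss[OF s, where 'a = 'a] by (simp add: right_diff_distrib mult_ac)
    qed
    have ceq: "conv v (gauss s) x - v x = (LBINT z. gauss s z * (v (x - z) - v x))" for x
    proof -
      have "conv v (gauss s) x = (LBINT z. gauss s z * v (x - z))"
        unfolding conv_def using integral_lborel_reflect[of "\<lambda>z. v z * gauss s (x - z)" x] by (simp add: mult.commute)
      moreover have "(LBINT z. gauss s z * v (x - z)) = (LBINT z. gauss s z * (v (x - z) - v x) + v x * gauss s z)"
        by (intro Bochner_Integration.integral_cong) (auto simp: algebra_simps)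
      ultimately show ?thesis using ci integrable_gauss[OF s, where 'a = 'a] by (simp add: integral_gauss s)
    qed
    have "(\<integral>\<^sup>+x. ennreal \<bar>conv v (gauss s) x - v x\<bar> \<partial>lborel)
        \<le> (\<integral>\<^sup>+x. \<integral>\<^sup>+z. ennreal (gauss s z * \<bar>v (x - z) - v x\<bar>) \<partial>lborel \<partial>lborel)"
    proof (rule nn_integral_mono)
      fix x
      show "ennreal \<bar>conv v (gauss s) x - v x\<bar> \<le> (\<integral>\<^sup>+z. ennreal (gauss s z * \<bar>v (x - z) - v x\<bar>) \<partial>lborel)"
        unfolding ceq using integral_norm_bound_ennreal[OF ci[of x]]
        by (simp add: abs_mult gauss_nonneg)
    qed
    also have "\<dots> = (\<integral>\<^sup>+z. \<integral>\<^sup>+x. ennreal (gauss s z * \<bar>v (x - z) - v x\<bar>) \<partial>lborel \<partial>lborel)"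
      by (rule lborel_pair.Fubini') measurable
    also have "\<dots> \<le> (\<integral>\<^sup>+z. ennreal (gauss s z * (r / 2 + C * (norm z)\<^sup>2)) \<partial>(lborel :: 'a measure))"
    proof (rule nn_integral_mono)
      fix z :: 'a
      have "(\<integral>\<^sup>+x. ennreal (gauss s z * \<bar>v (x - z) - v x\<bar>) \<partial>lborel)
         = ennreal (LBINT x. gauss s z * \<bar>v (x - z) - v x\<bar>)"
        using i by (intro nn_integral_eq_integral) (auto simp: gauss_nonneg)
      also have "\<dots> \<le> ennreal (gauss s z * (r / 2 + C * (norm z)\<^sup>2))"
        using \<omega>[of z] by (auto intro!: ennreal_leI mult_left_mono simp: gauss_nonneg)
      finally show "(\<integral>\<^sup>+x. ennreal (gauss s z * \<bar>v (x - z) - v x\<bar>) \<partial>lborel) \<le> ennreal (gauss s z * (r / 2 + C * (norm z)\<^sup>2))" .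
    qed
    also have "\<dots> = ennreal (\<integral>z. gauss s z * (r / 2 + C * (norm z)\<^sup>2) \<partial>(lborel :: 'a measure))"
      using gi C r by (intro nn_integral_eq_integral) (auto simp: gauss_nonneg)
    also have "(\<integral>z. gauss s z * (r / 2 + C * (norm z)\<^sup>2) \<partial>(lborel :: 'a measure)) = r / 2 + C * (s * real DIM('a))"
    proof -
      have "(\<integral>z. gauss s z * (r / 2 + C * (norm z)\<^sup>2) \<partial>(lborel :: 'a measure)) = (\<integral>z. (r / 2) * gauss s z + C * ((norm z)\<^sup>2 * gauss s z) \<partial>(lborel :: 'a measure))"
        by (intro Bochner_Integration.integral_cong) (auto simp: algebra_simps)
      also have "\<dots> = (\<integral>z. (r / 2) * gauss s z \<partial>(lborel :: 'a measure)) + (\<integral>z. C * ((norm z)\<^sup>2 * gauss s z) \<partial>(lborel :: 'a measure))"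
        by (intro Bochner_Integration.integral_add integrable_mult_right integrable_gauss s
            poly_times_gauss_integrable[OF real_polynomial_function_norm_power2])
      also have "\<dots> = r / 2 + C * (s * real DIM('a))"
        unfolding Bochner_Integration.integral_mult_right_zero by (simp add: integral_gauss integral_norm_power2_gauss s)
      finally show ?thesis .
    qed
    finally show ?thesis
      using C r s conv_const_Fubini(1)[OF v integrable_gauss[OF s]] v
      by (subst (asm) nn_integral_eq_integral) (auto simp: ennreal_le_iff simp del: ennreal_plus)
  qed
  obtain N where N: "real N > C * real DIM('a) / (r / 2)" using reals_Archimedean2 by blast
  have "norm ((LBINT x. \<bar>conv v (gauss (1 / real (Suc n))) x - v x\<bar>) - 0) < r" if n: "n \<ge> N" for n
  proof -
    have "C * real DIM('a) / (r / 2) < real (Suc n)" using N n by simp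
    then have "C * real DIM('a) < real (Suc n) * (r / 2)" using r by (simp only: pos_divide_less_eq half_gt_zero)
    then have "C * (1 / real (Suc n) * real DIM('a)) < r / 2"
      by (simp add: field_simps)
    moreover have "(LBINT x. \<bar>conv v (gauss (1 / real (Suc n))) x - v x\<bar>) \<le> r / 2 + C * (1 / real (Suc n) * real DIM('a))"
      by (rule bound) simp
    ultimately have "(LBINT x. \<bar>conv v (gauss (1 / real (Suc n))) x - v x\<bar>) < r" by linarith
    then show ?thesis by (simp del: of_nat_Suc)
  qed
  then show "\<exists>no. \<forall>n\<ge>no. norm ((LBINT x. \<bar>conv v (gauss (1 / real (Suc n))) x - v x\<bar>) - 0) < r" by blast
qed

text \<open>Starting from an arbitrary subsequence allows nested extraction, so that two functions
  converge almost everywhere along a common sequence of times.\<close>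

lemma conv_gauss_AE_subseq:
  fixes v :: "'a::euclidean_space \<Rightarrow> real"
  assumes v: "integrable lborel v" and r: "strict_mono (r :: nat \<Rightarrow> nat)"
  obtains q :: "nat \<Rightarrow> nat" where "strict_mono q" "AE x in lborel. (\<lambda>n. conv v (gauss (1 / real (Suc (r (q n))))) x) \<longlonglongrightarrow> v x"
proof -
  let ?u = "\<lambda>n x. conv v (gauss (1 / real (Suc (r n)))) x - v x"
  have "(\<lambda>n. LBINT x. norm (?u n x)) \<longlonglongrightarrow> 0"
    using LIMSEQ_subseq_LIMSEQ[OF conv_gauss_tendsto_L1[OF v] r] by (simp add: o_def)
  moreover have "integrable lborel (?u n)" for n
    using conv_const_Fubini(1)[OF v integrable_gauss] v by auto
  ultimately obtain q :: "nat \<Rightarrow> nat" where "strict_mono q" "AE x in lborel. (\<lambda>n. ?u (q n) x) \<longlonglongrightarrow> 0"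
    using tendsto_L1_AE_subseq[of lborel ?u] by blast
  then show ?thesis using that[of q] by (simp add: LIM_zero_iff)
qed


section \<open>Weak derivatives on zero sets\<close>

lemma gauss_bounded:
  assumes "s > 0"
  obtains B where "\<And>z::'a::euclidean_space. \<bar>gauss s z\<bar> \<le> B"
  using poly_gauss_bounded[OF gauss_poly_gauss, of s] assms by (metis divide_pos_pos mult_pos_pos zero_less_numeral zero_less_one)

lemma integrable_conv_gauss_kernel:
  fixes h :: "'a::euclidean_space \<Rightarrow> real"
  assumes "integrable lborel h" "s > 0"
  shows "integrable lborel (\<lambda>y. h y * gauss s (x - y))"
  using gauss_bounded[OF assms(2)] integrable_conv_kernel[OF assms(1) gauss_borel] by metis

lemma conv_gauss_partials:
  fixes h :: "'a::euclidean_space \<Rightarrow> real"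
  assumes "integrable lborel h" "s > 0"
  shows "has_partials (conv h (gauss s)) (\<lambda>b. conv h (\<lambda>z. - (z \<bullet> b) / s * gauss s z))"
proof -
  have "(\<lambda>z::'a. - (z \<bullet> b) / s * gauss s z) \<in> poly_gauss (1 / (2 * s))" for b
    using poly_gauss_times_gauss[OF real_polynomial_function.intros(4)[OF real_polynomial_function.intros(2)[of "- 1 / s"] real_polynomial_function_inner]]
    by simp
  then show ?thesis
    by (intro conv_poly_gauss_partials[OF assms(1) gauss_poly_gauss _ gauss_partials]) (use assms in auto)
qed

lemma conv_gauss_translate:
  fixes V :: "'a::euclidean_space \<Rightarrow> real"
  assumes V: "integrable lborel V" and s: "s > 0"
  shows "conv (\<lambda>x. V (x + c) - V x) (gauss s) x = conv V (gauss s) (x + c) - conv V (gauss s) x"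
proof -
  have [measurable]: "V \<in> borel_measurable borel" using borel_measurable_integrable[OF V] by simp
  have "conv V (gauss s) (x + c) = (LBINT y. V (y + c) * gauss s (x - y))"
    unfolding conv_def using integral_lborel_translate[of "\<lambda>y. V y * gauss s (x + c - y)" c]
    by (simp add: algebra_simps)
  then show ?thesis
    using integrable_conv_gauss_kernel[OF V s, of x]
      integrable_conv_gauss_kernel[OF _ s, of "\<lambda>y. V (y + c)" x] V
    by (simp add: conv_def left_diff_distrib integrable_lborel_translate Bochner_Integration.integral_diff)
qed

text \<open>The bound does not depend on \<open>s\<close>, so it survives the limit
  \<open>s \<rightarrow> 0\<close>. The remainder is the integral over \<open>t\<close> of the
  oscillation of the smoothed \<open>V\<close>, and L1 contraction replaces it by the oscillation of
  \<open>V\<close> itself.\<close>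

lemma difference_quotient_L1_bound:
  fixes p V :: "'a::euclidean_space \<Rightarrow> real"
  assumes p: "integrable lborel p" and V: "integrable lborel V" and s: "s > 0" and h: "h > 0"
    and D: "\<And>x t. ((\<lambda>t. conv p (gauss s) (x + t *\<^sub>R e)) has_real_derivative conv V (gauss s) (x + t *\<^sub>R e)) (at t)"
    and \<epsilon>: "\<And>t. 0 \<le> t \<Longrightarrow> t \<le> h \<Longrightarrow> (LBINT x. \<bar>V (x + t *\<^sub>R e) - V x\<bar>) \<le> \<epsilon>"
  shows "(\<integral>\<^sup>+x. ennreal \<bar>conv p (gauss s) (x + h *\<^sub>R e) - conv p (gauss s) x - h * conv V (gauss s) x\<bar> \<partial>lborel)
    \<le> ennreal (h * \<epsilon>)"
proof -
  let ?p = "conv p (gauss s)" let ?V = "conv V (gauss s)"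
  have Vc: "continuous_on UNIV ?V" using conv_poly_gauss_continuous[OF V gauss_poly_gauss] s by simp
  then have [measurable]: "?V \<in> borel_measurable borel" by (rule borel_measurable_continuous_onI)
  have Vi: "integrable lborel ?V" by (rule conv_const_Fubini(1)[OF V integrable_gauss[OF s]])
  have \<epsilon>0: "\<epsilon> \<ge> 0" using \<epsilon>[of 0] h by simp
  have cont: "isCont (\<lambda>t. ?V (x + t *\<^sub>R e) - ?V x) t" for x t
  proof -
    have "isCont ?V (x + t *\<^sub>R e)" using Vc continuous_on_eq_continuous_at[OF open_UNIV] by blast
    then have "isCont (\<lambda>t. ?V (x + t *\<^sub>R e)) t"
      by (intro isCont_o2[of t "\<lambda>t. x + t *\<^sub>R e" ?V] continuous_intros)
    then show ?thesis by (intro continuous_intros)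
  qed
  have ftc: "(LBINT t. (?V (x + t *\<^sub>R e) - ?V x) * indicator {0..h} t) = ?p (x + h *\<^sub>R e) - ?p x - h * ?V x" for x
  proof -
    have "(LBINT t. (?V (x + t *\<^sub>R e) - ?V x) * indicator {0..h} t)
        = (?p (x + h *\<^sub>R e) - h * ?V x) - (?p (x + 0 *\<^sub>R e) - 0 * ?V x)"
      using h by (intro integral_FTC_Icc_real cont) (auto intro!: derivative_eq_intros D)
    then show ?thesis by simp
  qed
  have ind: "integrable lborel (indicator {0..h} :: real \<Rightarrow> real)"
    by (rule integrable_real_indicator) (auto simp: emeasure_lborel_Icc_eq)
  have inti: "integrable lborel (\<lambda>t. (?V (x + t *\<^sub>R e) - ?V x) * indicator {0..h} t)" for x
    using borel_integrable_atLeastAtMost[of 0 h "\<lambda>t. ?V (x + t *\<^sub>R e) - ?V x"] cont by simp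
  have "(\<integral>\<^sup>+x. ennreal \<bar>?p (x + h *\<^sub>R e) - ?p x - h * ?V x\<bar> \<partial>lborel)
     \<le> (\<integral>\<^sup>+x. \<integral>\<^sup>+t. ennreal (\<bar>?V (x + t *\<^sub>R e) - ?V x\<bar> * indicator {0..h} t) \<partial>lborel \<partial>lborel)"
  proof (rule nn_integral_mono)
    fix x
    show "ennreal \<bar>?p (x + h *\<^sub>R e) - ?p x - h * ?V x\<bar>
        \<le> (\<integral>\<^sup>+t. ennreal (\<bar>?V (x + t *\<^sub>R e) - ?V x\<bar> * indicator {0..h} t) \<partial>lborel)"
      unfolding ftc[symmetric] using integral_norm_bound_ennreal[OF inti[of x]] by (simp add: abs_mult)
  qed
  also have "\<dots> = (\<integral>\<^sup>+t. \<integral>\<^sup>+x. ennreal (\<bar>?V (x + t *\<^sub>R e) - ?V x\<bar> * indicator {0..h} t) \<partial>lborel \<partial>lborel)"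
    by (rule lborel_pair.Fubini') measurable
  also have "\<dots> \<le> (\<integral>\<^sup>+t. ennreal (\<epsilon> * indicator {0..h} t) \<partial>lborel)"
  proof (rule nn_integral_mono)
    fix t :: real
    show "(\<integral>\<^sup>+x. ennreal (\<bar>?V (x + t *\<^sub>R e) - ?V x\<bar> * indicator {0..h} t) \<partial>lborel) \<le> ennreal (\<epsilon> * indicator {0..h} t)"
    proof (cases "t \<in> {0..h}")
      case True
      have i: "integrable lborel (\<lambda>x. V (x + t *\<^sub>R e) - V x)"
        using V by (simp add: integrable_lborel_translate borel_measurable_integrable)
      have "(LBINT x. \<bar>?V (x + t *\<^sub>R e) - ?V x\<bar>) \<le> (LBINT x. \<bar>V (x + t *\<^sub>R e) - V x\<bar>)"
        using conv_gauss_L1_contraction[OF i s] unfolding conv_gauss_translate[OF V s] .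
      also have "\<dots> \<le> \<epsilon>" using True \<epsilon> by simp
      finally have "(LBINT x. \<bar>?V (x + t *\<^sub>R e) - ?V x\<bar>) \<le> \<epsilon>" .
      moreover have "integrable lborel (\<lambda>x. \<bar>?V (x + t *\<^sub>R e) - ?V x\<bar>)"
        using Vi by (intro integrable_abs Bochner_Integration.integrable_diff) (simp_all add: integrable_lborel_translate)
      ultimately show ?thesis using True by (simp add: nn_integral_eq_integral ennreal_leI)
    qed simp
  qed
  also have "\<dots> = ennreal (h * \<epsilon>)"
  proof -
    have "(\<integral>\<^sup>+t. ennreal (\<epsilon> * indicator {0..h} t) \<partial>lborel) = ennreal (LBINT t. \<epsilon> * indicator {0..h} t)"
      using \<epsilon>0 ind by (intro nn_integral_eq_integral) auto
    then show ?thesis using h by (simp add: mult.commute)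
  qed
  finally show ?thesis .
qed

text \<open>A nonnegative function is at its minimum on its zero set, so difference quotients there
  are nonnegative in every direction.\<close>
lemma weak_derivative_ge_0_on_zero_set:
  fixes p V :: "'a::euclidean_space \<Rightarrow> real"
  assumes p: "integrable lborel p" "\<And>x. p x \<ge> 0" and V: "integrable lborel V"
    and D: "\<And>s x t. s > 0 \<Longrightarrow> ((\<lambda>t. conv p (gauss s) (x + t *\<^sub>R e)) has_real_derivative conv V (gauss s) (x + t *\<^sub>R e)) (at t)"
  shows "AE x in lborel. p x = 0 \<longrightarrow> V x \<ge> 0"
proof -
  have [measurable]: "p \<in> borel_measurable borel" "V \<in> borel_measurable borel"
    using borel_measurable_integrable[OF p(1)] borel_measurable_integrable[OF V] by simp_all
  obtain q1 where q1: "strict_mono q1" "AE x in lborel. (\<lambda>n. conv p (gauss (1 / real (Suc (q1 n)))) x) \<longlonglongrightarrow> p x"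
    using conv_gauss_AE_subseq[OF p(1) strict_mono_id] by auto
  obtain q2 where q2: "strict_mono q2" "AE x in lborel. (\<lambda>n. conv V (gauss (1 / real (Suc (q1 (q2 n))))) x) \<longlonglongrightarrow> V x"
    using conv_gauss_AE_subseq[OF V q1(1)] by auto
  define s where "s = (\<lambda>n. 1 / real (Suc (q1 (q2 n))))"
  have s: "s n > 0" for n by (simp add: s_def)
  have pl: "AE x in lborel. (\<lambda>n. conv p (gauss (s n)) x) \<longlonglongrightarrow> p x"
    using q1(2) by eventually_elim (use LIMSEQ_subseq_LIMSEQ[OF _ q2(1)] in \<open>auto simp: s_def o_def\<close>)
  have pl': "AE x in lborel. (\<lambda>n. conv p (gauss (s n)) (x + c)) \<longlonglongrightarrow> p (x + c)" for c
  proof -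
    have "AE x in distr lborel borel ((+) c). (\<lambda>n. conv p (gauss (s n)) x) \<longlonglongrightarrow> p x"
      unfolding lborel_distr_plus by (rule pl)
    from AE_distrD[OF _ this] show ?thesis by (simp add: add.commute)
  qed
  have Vl: "AE x in lborel. (\<lambda>n. conv V (gauss (s n)) x) \<longlonglongrightarrow> V x" using q2(2) by (simp add: s_def)
  have [measurable]: "conv p (gauss (s n)) \<in> borel_measurable borel" "conv V (gauss (s n)) \<in> borel_measurable borel" for n
    using conv_poly_gauss_continuous[OF p(1) gauss_poly_gauss] conv_poly_gauss_continuous[OF V gauss_poly_gauss] s
    by (intro borel_measurable_continuous_onI; simp)+
  \<comment> \<open>The negative part of \<open>V\<close> on the zero set of \<open>p\<close>. There
    \<open>p (x + h *\<^sub>R e) \<ge> 0 = p x\<close>, so \<open>h * W x\<close> is at most the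
    first-order remainder, whose L1 norm is at most \<open>h * \<epsilon>\<close>.\<close>
  define W where "W = (\<lambda>x. if p x = 0 then max 0 (- V x) else 0)"
  have [measurable]: "W \<in> borel_measurable borel" unfolding W_def by measurable
  have small: "(\<integral>\<^sup>+x. ennreal (W x) \<partial>lborel) \<le> ennreal \<epsilon>" if \<epsilon>: "\<epsilon> > 0" for \<epsilon>
  proof -
    obtain \<delta> where \<delta>: "\<delta> > 0" "\<And>z. norm z < \<delta> \<Longrightarrow> (LBINT x. \<bar>V (x + z) - V x\<bar>) \<le> \<epsilon>"
      using translation_continuous_L1[OF V \<epsilon>] by metis
    define h where "h = \<delta> / (2 * (1 + norm e))"
    have h: "h > 0" using \<delta>(1) by (simp add: h_def add_pos_nonneg)
    have hd: "norm (t *\<^sub>R e) < \<delta>" if "0 \<le> t" "t \<le> h" for t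
    proof -
      have "norm (t *\<^sub>R e) \<le> h * (1 + norm e)" using that by (auto intro!: mult_mono)
      also have "\<dots> < \<delta>" using \<delta>(1) by (simp add: h_def add_pos_nonneg field_simps)
      finally show ?thesis .
    qed
    have "(\<integral>\<^sup>+x. ennreal \<bar>p (x + h *\<^sub>R e) - p x - h * V x\<bar> \<partial>lborel)
        = (\<integral>\<^sup>+x. liminf (\<lambda>n. ennreal \<bar>conv p (gauss (s n)) (x + h *\<^sub>R e) - conv p (gauss (s n)) x - h * conv V (gauss (s n)) x\<bar>) \<partial>lborel)"
    proof (rule nn_integral_cong_AE)
      show "AE x in lborel. ennreal \<bar>p (x + h *\<^sub>R e) - p x - h * V x\<bar>
         = liminf (\<lambda>n. ennreal \<bar>conv p (gauss (s n)) (x + h *\<^sub>R e) - conv p (gauss (s n)) x - h * conv V (gauss (s n)) x\<bar>)"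
        using pl pl'[of "h *\<^sub>R e"] Vl
        by eventually_elim (intro lim_imp_Liminf[symmetric] tendsto_ennrealI tendsto_intros, auto)
    qed
    also have "\<dots> \<le> liminf (\<lambda>n. \<integral>\<^sup>+x. ennreal \<bar>conv p (gauss (s n)) (x + h *\<^sub>R e) - conv p (gauss (s n)) x - h * conv V (gauss (s n)) x\<bar> \<partial>lborel)"
      by (rule nn_integral_liminf) simp
    also have "\<dots> \<le> ennreal (h * \<epsilon>)"
      using difference_quotient_L1_bound[OF p(1) V s h D[OF s] \<delta>(2)[OF hd]]
      by (intro Liminf_le) auto
    finally have 1: "(\<integral>\<^sup>+x. ennreal \<bar>p (x + h *\<^sub>R e) - p x - h * V x\<bar> \<partial>lborel) \<le> ennreal (h * \<epsilon>)" .
    have "ennreal h * (\<integral>\<^sup>+x. ennreal (W x) \<partial>lborel) = (\<integral>\<^sup>+x. ennreal (h * W x) \<partial>lborel)"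
      using h by (subst nn_integral_cmult[symmetric]) (auto simp: ennreal_mult' W_def)
    also have "\<dots> \<le> (\<integral>\<^sup>+x. ennreal \<bar>p (x + h *\<^sub>R e) - p x - h * V x\<bar> \<partial>lborel)"
    proof (intro nn_integral_mono ennreal_leI)
      fix x show "h * W x \<le> \<bar>p (x + h *\<^sub>R e) - p x - h * V x\<bar>"
        using p(2)[of "x + h *\<^sub>R e"] h mult_nonneg_nonneg[of h "V x"] mult_nonneg_nonneg[of h "- V x"] unfolding W_def
        by (auto simp: max_def)
    qed
    also note 1
    finally have "ennreal h * (\<integral>\<^sup>+x. ennreal (W x) \<partial>lborel) \<le> ennreal h * ennreal \<epsilon>"
      using h \<epsilon> by (simp add: ennreal_mult')
    then show ?thesis using h by (subst (asm) ennreal_mult_le_mult_iff) auto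
  qed
  have "(\<integral>\<^sup>+x. ennreal (W x) \<partial>lborel) = 0"
  proof -
    have "(\<integral>\<^sup>+x. ennreal (W x) \<partial>lborel) \<le> 0"
      by (rule ennreal_le_epsilon) (use small in auto)
    then show ?thesis by simp
  qed
  then have "AE x in lborel. ennreal (W x) = 0" by (subst (asm) nn_integral_0_iff_AE) auto
  then show ?thesis by eventually_elim (auto simp: W_def max_def split: if_splits)
qed

text \<open>Assumption \<open>D\<close> states that \<open>V\<close> is the weak derivative of
  \<open>p\<close> along \<open>e\<close>, tested only against translated heat kernels. Along
  \<open>- e\<close> the weak derivative is \<open>- V\<close>, so the one-sided result holds for
  both signs.\<close>

lemma weak_derivative_eq_0_on_zero_set:
  fixes p V :: "'a::euclidean_space \<Rightarrow> real"
  assumes p: "integrable lborel p" "\<And>x. p x \<ge> 0" and V: "integrable lborel V" and e: "e \<in> Basis"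
    and D: "\<And>s x. s > 0 \<Longrightarrow> conv p (\<lambda>z. - (z \<bullet> e) / s * gauss s z) x = conv V (gauss s) x"
  shows "AE x in lborel. p x = 0 \<longrightarrow> V x = 0"
proof -
  have D': "((\<lambda>t. conv p (gauss s) (x + t *\<^sub>R e)) has_real_derivative conv V (gauss s) (x + t *\<^sub>R e)) (at t)"
    if s: "s > 0" for s x t
    using has_partials_along_line[OF conv_gauss_partials[OF p(1) s], of x e t] D[OF s]
      sum_inner_Basis_delta[OF e, of "\<lambda>b. conv p (\<lambda>z. - (z \<bullet> b) / s * gauss s z) (x + t *\<^sub>R e)"] by simp
  have "AE x in lborel. p x = 0 \<longrightarrow> V x \<ge> 0"
    by (rule weak_derivative_ge_0_on_zero_set[OF p V D'])
  moreover have "AE x in lborel. p x = 0 \<longrightarrow> - V x \<ge> 0"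
  proof (rule weak_derivative_ge_0_on_zero_set[OF p, where e = "- e"])
    fix s x t assume s: "(s::real) > 0"
    have "((\<lambda>t. conv p (gauss s) (x + (- t) *\<^sub>R e)) has_real_derivative conv V (gauss s) (x + (- t) *\<^sub>R e) * (- 1)) (at t)"
      by (rule DERIV_chain2[OF D'[OF s]]) (auto intro!: derivative_eq_intros)
    then show "((\<lambda>t. conv p (gauss s) (x + t *\<^sub>R (- e))) has_real_derivative conv (\<lambda>x. - V x) (gauss s) (x + t *\<^sub>R (- e))) (at t)"
      by (simp add: conv_def)
  qed (use V in auto)
  ultimately show ?thesis by eventually_elim auto
qed


section \<open>Entropy along the heat flow\<close>

text \<open>By the mean value inequality a bound on the derivative throughout the interval bounds
  every difference quotient, so dominated convergence applies to the quotients.\<close>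

lemma has_real_derivative_integral_dominated:
  fixes f f' :: "real \<Rightarrow> 'b \<Rightarrow> real"
  assumes f: "\<And>s. s \<in> {a<..<b} \<Longrightarrow> integrable M (f s)"
    and D: "\<And>s x. s \<in> {a<..<b} \<Longrightarrow> ((\<lambda>s. f s x) has_real_derivative f' s x) (at s)"
    and f': "f' t \<in> borel_measurable M"
    and w: "\<And>s x. s \<in> {a<..<b} \<Longrightarrow> \<bar>f' s x\<bar> \<le> w x" "integrable M w"
    and t: "t \<in> {a<..<b}"
  shows "((\<lambda>s. \<integral>x. f s x \<partial>M) has_real_derivative (\<integral>x. f' t x \<partial>M)) (at t)"
proof -
  have "((\<lambda>s. ((\<integral>x. f s x \<partial>M) - (\<integral>x. f t x \<partial>M)) / (s - t)) \<longlongrightarrow> (\<integral>x. f' t x \<partial>M)) (at t within {a<..<b})"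
    unfolding tendsto_at_iff_sequentially comp_def
  proof (intro allI impI)
    fix X :: "nat \<Rightarrow> real" assume X: "\<forall>i. X i \<in> {a<..<b} - {t}" "X \<longlonglongrightarrow> t"
    have Xi: "X i \<in> {a<..<b}" "X i \<noteq> t" for i using X(1) by auto
    have "(\<lambda>i. \<integral>x. (f (X i) x - f t x) / (X i - t) \<partial>M) \<longlonglongrightarrow> (\<integral>x. f' t x \<partial>M)"
    proof (rule integral_dominated_convergence[where w = w])
      show "AE x in M. (\<lambda>i. (f (X i) x - f t x) / (X i - t)) \<longlonglongrightarrow> f' t x"
      proof (intro AE_I2)
        fix x
        have "((\<lambda>s. (f s x - f t x) / (s - t)) \<longlongrightarrow> f' t x) (at t)"
          using D[OF t, of x] by (simp add: has_field_derivative_iff)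
        then show "(\<lambda>i. (f (X i) x - f t x) / (X i - t)) \<longlonglongrightarrow> f' t x"
          using X Xi(2) unfolding tendsto_at_iff_sequentially comp_def by auto
      qed
      show "AE x in M. norm ((f (X i) x - f t x) / (X i - t)) \<le> w x" for i
      proof (intro AE_I2)
        fix x
        have "norm (f (X i) x - f t x) \<le> w x * norm (X i - t)"
        proof (rule field_differentiable_bound[of "{a<..<b}" "\<lambda>s. f s x" "\<lambda>s. f' s x"])
          fix z assume z: "z \<in> {a<..<b}"
          show "((\<lambda>s. f s x) has_real_derivative f' z x) (at z within {a<..<b})"
            by (rule has_field_derivative_at_within[OF D[OF z]])
          show "norm (f' z x) \<le> w x" using w(1)[OF z] by simp
        qed (use t Xi in auto)
        then show "norm ((f (X i) x - f t x) / (X i - t)) \<le> w x"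
          using Xi(2)[of i] by (simp add: abs_divide divide_le_eq)
      qed
      show "(\<lambda>x. (f (X i) x - f t x) / (X i - t)) \<in> borel_measurable M" for i
        using borel_measurable_integrable[OF f[OF Xi(1)[of i]]] borel_measurable_integrable[OF f[OF t]] by measurable
    qed (use f' w in auto)
    moreover have "(\<integral>x. (f (X i) x - f t x) / (X i - t) \<partial>M) = ((\<integral>x. f (X i) x \<partial>M) - (\<integral>x. f t x \<partial>M)) / (X i - t)" for i
      unfolding integral_divide_zero using f[OF Xi(1)[of i]] f[OF t] by (simp add: Bochner_Integration.integral_diff)
    ultimately show "(\<lambda>i. ((\<integral>x. f (X i) x \<partial>M) - (\<integral>x. f t x \<partial>M)) / (X i - t)) \<longlonglongrightarrow> (\<integral>x. f' t x \<partial>M)" by (simp only:)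
  qed
  then have "((\<lambda>s. \<integral>x. f s x \<partial>M) has_real_derivative (\<integral>x. f' t x \<partial>M)) (at t within {a<..<b})"
    by (simp add: has_field_derivative_iff)
  then show ?thesis using t at_within_open[OF t open_greaterThanLessThan] by simp
qed

lemma has_partials_ln:
  assumes "has_partials f F" "\<And>x. f x > 0"
  shows "has_partials (\<lambda>x. ln (f x)) (\<lambda>b x. F b x / f x)"
  unfolding has_partials_def
proof
  fix x
  have D: "(f has_derivative (\<lambda>d. \<Sum>b\<in>Basis. (d \<bullet> b) * F b x)) (at x)"
    using assms by (auto simp: has_partials_def)
  show "((\<lambda>x. ln (f x)) has_derivative (\<lambda>d. \<Sum>b\<in>Basis. (d \<bullet> b) * (F b x / f x))) (at x)"
    by (rule has_derivative_eq_rhs[OF has_derivative_ln[OF assms(2) D]])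
      (auto simp: fun_eq_iff sum_distrib_left sum_divide_distrib divide_inverse mult_ac)
qed

lemma poly_gauss_cmult: "K \<in> poly_gauss a \<Longrightarrow> (\<lambda>z. c * K z) \<in> poly_gauss a"
  by (rule poly_gauss_poly_mult[OF _ real_polynomial_function.intros(2)])

lemma norm_power2_gauss_poly_gauss:
  "(\<lambda>z. (c * (norm z)\<^sup>2 + d) * gauss s z) \<in> poly_gauss (1 / (2 * s))"
  by (intro poly_gauss_times_gauss real_polynomial_function.intros(2-4) real_polynomial_function_norm_power2)

lemma gauss_gradient_poly_gauss: "(\<lambda>z. - (z \<bullet> b) / s * gauss s z) \<in> poly_gauss (1 / (2 * s))"
  using poly_gauss_cmult[OF inner_gauss_poly_gauss, where c = "- 1 / s"] by (simp add: mult.assoc)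

lemma norm_power2_add_le: "(norm (x + y))\<^sup>2 \<le> 2 * (norm x)\<^sup>2 + 2 * (norm y)\<^sup>2"
proof -
  have "(norm (x + y))\<^sup>2 \<le> (norm x + norm y)\<^sup>2" by (intro power_mono norm_triangle_ineq) auto
  also have "\<dots> \<le> 2 * (norm x)\<^sup>2 + 2 * (norm y)\<^sup>2"
    using sum_squares_bound[of "norm x" "norm y"] by (simp add: power2_sum)
  finally show ?thesis .
qed

lemma gauss_le_height: "s > 0 \<Longrightarrow> gauss s (z::'a::euclidean_space) \<le> (2 * pi * s) powr (- real DIM('a) / 2)"
  unfolding gauss_def by (intro mult_left_le) auto

lemma ln_gauss:
  "s > 0 \<Longrightarrow> ln (gauss s (z::'a::euclidean_space)) = - (real DIM('a) / 2) * ln (2 * pi * s) - (norm z)\<^sup>2 / (2 * s)"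
  unfolding gauss_def by (subst ln_mult) (auto simp: ln_powr)

section \<open>Positivity, logarithmic bounds and moments of a density evolved by the heat
  flow\<close>

locale heat_flow =
  fixes u :: "'a::euclidean_space \<Rightarrow> real"
  assumes u_borel [measurable]: "u \<in> borel_measurable borel"
    and u_nonneg: "u x \<ge> 0"
    and u_integrable: "integrable lborel u"
    and u_mass: "(LBINT x. u x) = 1"
    and u_second_moment: "integrable lborel (\<lambda>x. (norm x)\<^sup>2 * u x)"
begin

abbreviation heat :: "real \<Rightarrow> 'a \<Rightarrow> real" where
  "heat s \<equiv> conv u (gauss s)"

abbreviation heat_grad :: "real \<Rightarrow> 'a \<Rightarrow> 'a \<Rightarrow> real" where
  "heat_grad s b \<equiv> conv u (\<lambda>z. - (z \<bullet> b) / s * gauss s z)"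

definition second_moment :: real where
  "second_moment = (LBINT x. (norm x)\<^sup>2 * u x)"

lemma second_moment_nonneg: "second_moment \<ge> 0"
  unfolding second_moment_def by (intro Bochner_Integration.integral_nonneg) (simp add: u_nonneg)

lemma integrable_u_poly_gauss:
  assumes "K \<in> poly_gauss a" "a > 0"
  shows "integrable lborel (\<lambda>x. u x * K (y - x))"
  using poly_gauss_bounded[OF assms] integrable_conv_kernel[OF u_integrable poly_gauss_borel[OF assms(1)]] by metis

lemma integrable_u_gauss: "s > 0 \<Longrightarrow> integrable lborel (\<lambda>x. u x * gauss s (y - x))"
  by (rule integrable_u_poly_gauss[OF gauss_poly_gauss]) simp

text \<open>The weight \<open>1 + (norm (x + z))\<^sup>2\<close> is at most twice the product of the
  weights in \<open>x\<close> and \<open>z\<close>. The first is integrable against \<open>u\<close>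
  by the second moment, the second is absorbed by the kernel.\<close>

lemma conv_growth:
  assumes g [measurable]: "g \<in> borel_measurable borel" and C: "\<And>y. \<bar>g y\<bar> \<le> C * (1 + (norm y)\<^sup>2)"
    and K: "K \<in> poly_gauss a" "a > 0"
  shows "integrable lborel (\<lambda>y. g y * conv u K y)"
    and "(LBINT y. g y * conv u K y) = (LBINT x. u x * (LBINT z. g (z + x) * K z))"
proof -
  have C0: "C \<ge> 0" using C[of 0] by simp
  have 1: "integrable lborel (\<lambda>x. 2 * C * (1 + (norm x)\<^sup>2) * u x)"
  proof -
    have "integrable lborel (\<lambda>x. 2 * C * (u x + (norm x)\<^sup>2 * u x))"
      using u_integrable u_second_moment by (intro integrable_mult_right Bochner_Integration.integrable_add)
    then show ?thesis by (simp add: algebra_simps)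
  qed
  have 2: "integrable lborel (\<lambda>z. (1 + (norm z)\<^sup>2) * K z)"
    by (intro poly_gauss_integrable[OF poly_gauss_poly_mult[OF K(1)] K(2)] real_polynomial_function.intros(2,3)
        real_polynomial_function_norm_power2)
  have 3: "\<bar>g (x + z)\<bar> \<le> 2 * C * (1 + (norm x)\<^sup>2) * (1 + (norm z)\<^sup>2)" for x z
  proof -
    have "\<bar>g (x + z)\<bar> \<le> C * (1 + (norm (x + z))\<^sup>2)" by (rule C)
    also have "\<dots> \<le> C * (2 * (1 + (norm x)\<^sup>2) * (1 + (norm z)\<^sup>2))"
    proof (intro mult_left_mono C0)
      have "0 \<le> (norm x)\<^sup>2 * (norm z)\<^sup>2" by simp
      moreover have "2 * (1 + (norm x)\<^sup>2) * (1 + (norm z)\<^sup>2)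
          = 2 + 2 * (norm x)\<^sup>2 + 2 * (norm z)\<^sup>2 + 2 * ((norm x)\<^sup>2 * (norm z)\<^sup>2)" by (simp add: algebra_simps)
      ultimately show "1 + (norm (x + z))\<^sup>2 \<le> 2 * (1 + (norm x)\<^sup>2) * (1 + (norm z)\<^sup>2)"
        using norm_power2_add_le[of x z] by linarith
    qed
    finally show ?thesis by (simp add: mult_ac)
  qed
  note F = conv_Fubini[OF g u_borel poly_gauss_borel[OF K(1)] 1 2 3]
  show "integrable lborel (\<lambda>y. g y * conv u K y)" by (rule F(1))
  have [measurable]: "K \<in> borel_measurable borel" by (rule poly_gauss_borel[OF K(1)])
  have "(LBINT y. g y * K (y - x)) = (LBINT z. g (z + x) * K z)" for x
    using integral_lborel_translate[of "\<lambda>y. g y * K (y - x)" x] by simp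
  then show "(LBINT y. g y * conv u K y) = (LBINT x. u x * (LBINT z. g (z + x) * K z))"
    using F(3) by simp
qed

lemma heat_pos: assumes s: "s > 0" shows "heat s y > 0"
proof (rule ccontr)
  assume "\<not> heat s y > 0"
  then have "heat s y = 0" using conv_gauss_nonneg[of u s y] u_nonneg by simp
  then have "AE x in lborel. u x * gauss s (y - x) = 0"
    unfolding conv_def using integrable_u_gauss[OF s] u_nonneg
    by (subst (asm) integral_nonneg_eq_0_iff_AE) (auto simp: gauss_nonneg)
  then have "AE x in lborel. u x = 0"
    by eventually_elim (use gauss_pos[OF s] in \<open>auto simp: less_le\<close>)
  then have "(LBINT x. u x) = 0" by (simp add: integral_eq_zero_AE)
  then show False using u_mass by simp
qed

lemma heat_le: assumes s: "s > 0" shows "heat s y \<le> (2 * pi * s) powr (- real DIM('a) / 2)"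
proof -
  have "heat s y \<le> (LBINT x. u x * (2 * pi * s) powr (- real DIM('a) / 2))"
    unfolding conv_def using integrable_u_gauss[OF s] u_integrable
    by (intro integral_mono mult_left_mono gauss_le_height s u_nonneg) auto
  then show ?thesis by (simp add: u_mass)
qed

lemma ln_heat_le: assumes s: "s > 0" shows "ln (heat s y) \<le> - (real DIM('a) / 2) * ln (2 * pi * s)"
proof -
  have "ln (heat s y) \<le> ln ((2 * pi * s) powr (- real DIM('a) / 2))"
    using heat_le[OF s] heat_pos[OF s] s by (subst ln_le_cancel_iff) auto
  then show ?thesis by (simp add: ln_powr)
qed

text \<open>Jensen's inequality for the logarithm, in the form \<open>ln t \<le> t - 1\<close> at
  \<open>t = gauss s (y - x) / heat s y\<close>, a ratio whose average under \<open>u\<close> is 1.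
  Only the second moment of \<open>u\<close> enters, so the lower bound is quadratic in
  \<open>y\<close>.\<close>

lemma ln_heat_ge:
  assumes s: "s > 0"
  shows "ln (heat s y) \<ge> - (real DIM('a) / 2) * ln (2 * pi * s) - ((norm y)\<^sup>2 + second_moment) / s"
proof -
  let ?c = "- (real DIM('a) / 2) * ln (2 * pi * s)" let ?L = "ln (heat s y)"
  have p: "heat s y > 0" using s by (rule heat_pos)
  have "(LBINT x. (?c - (norm y)\<^sup>2 / s) * u x - ((norm x)\<^sup>2 * u x) / s)
     \<le> (LBINT x. (?L - 1) * u x + (u x * gauss s (y - x)) / heat s y)"
  proof (rule integral_mono)
    show "integrable lborel (\<lambda>x. (?c - (norm y)\<^sup>2 / s) * u x - ((norm x)\<^sup>2 * u x) / s)"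
      by (intro Bochner_Integration.integrable_diff integrable_mult_right integrable_divide u_integrable u_second_moment)
    show "integrable lborel (\<lambda>x. (?L - 1) * u x + (u x * gauss s (y - x)) / heat s y)"
      by (intro Bochner_Integration.integrable_add integrable_mult_right integrable_divide u_integrable integrable_u_gauss s)
    fix x
    have "ln (gauss s (y - x) / heat s y) \<le> gauss s (y - x) / heat s y - 1"
      using p s by (intro ln_le_minus_one divide_pos_pos gauss_pos)
    then have "?c - (norm (y - x))\<^sup>2 / (2 * s) - ?L \<le> gauss s (y - x) / heat s y - 1"
      using p s by (simp add: ln_div gauss_pos less_imp_neq[OF gauss_pos, symmetric] ln_gauss)
    moreover have "(norm (y - x))\<^sup>2 / (2 * s) \<le> ((norm y)\<^sup>2 + (norm x)\<^sup>2) / s"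
      using norm_power2_add_le[of y "- x"] s by (simp add: field_simps)
    ultimately have "?c - (norm y)\<^sup>2 / s - (norm x)\<^sup>2 / s \<le> ?L - 1 + gauss s (y - x) / heat s y"
      by (simp add: add_divide_distrib)
    then have "u x * (?c - (norm y)\<^sup>2 / s - (norm x)\<^sup>2 / s) \<le> u x * (?L - 1 + gauss s (y - x) / heat s y)"
      by (intro mult_left_mono u_nonneg)
    then show "(?c - (norm y)\<^sup>2 / s) * u x - ((norm x)\<^sup>2 * u x) / s \<le> (?L - 1) * u x + (u x * gauss s (y - x)) / heat s y"
      by (simp add: algebra_simps)
  qed
  moreover have "(LBINT x. (?c - (norm y)\<^sup>2 / s) * u x - ((norm x)\<^sup>2 * u x) / s) = (?c - (norm y)\<^sup>2 / s) - second_moment / s"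
    by (subst Bochner_Integration.integral_diff)
      (simp_all only: integral_mult_right_zero integral_divide_zero u_mass second_moment_def mult_1_right
        integrable_mult_right integrable_divide u_integrable u_second_moment)
  moreover have "(LBINT x. (?L - 1) * u x + (u x * gauss s (y - x)) / heat s y) = (?L - 1) + heat s y / heat s y"
    by (subst Bochner_Integration.integral_add)
      (simp_all only: integral_mult_right_zero integral_divide_zero u_mass conv_def[of u] mult_1_right
        integrable_mult_right integrable_divide u_integrable integrable_u_gauss s)
  ultimately show ?thesis using p by (simp add: add_divide_distrib)
qed

text \<open>\<open>1 + ln\<close> is the derivative of \<open>t * ln t\<close>. One constant for a
  whole interval of times is needed to dominate the time derivative of the entropy
  integrand.\<close>

lemma ln_heat_growth:
  assumes a: "0 < a"
  obtains C where "\<And>s y. a \<le> s \<Longrightarrow> s \<le> b \<Longrightarrow> \<bar>1 + ln (heat s y)\<bar> \<le> C * (1 + (norm y)\<^sup>2)"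
proof -
  define L where "L = \<bar>ln (2 * pi * a)\<bar> + \<bar>ln (2 * pi * b)\<bar>"
  define C where "C = 1 + real DIM('a) / 2 * L + (1 + second_moment) / a"
  have "\<bar>1 + ln (heat s y)\<bar> \<le> C * (1 + (norm y)\<^sup>2)" if s: "a \<le> s" "s \<le> b" for s y
  proof -
    have s0: "s > 0" using a s by simp
    have "ln (2 * pi * a) \<le> ln (2 * pi * s)" "ln (2 * pi * s) \<le> ln (2 * pi * b)"
      using a s s0 by simp_all
    then have "\<bar>ln (2 * pi * s)\<bar> \<le> L" unfolding L_def by linarith
    then have "real DIM('a) / 2 * \<bar>ln (2 * pi * s)\<bar> \<le> real DIM('a) / 2 * L" by (intro mult_left_mono) auto
    then have c: "\<bar>real DIM('a) / 2 * ln (2 * pi * s)\<bar> \<le> real DIM('a) / 2 * L" by (simp add: abs_mult)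
    have "((norm y)\<^sup>2 + second_moment) / s \<le> ((norm y)\<^sup>2 + second_moment) / a"
      using a s second_moment_nonneg by (intro divide_left_mono) auto
    also have "\<dots> \<le> (1 + second_moment) * (1 + (norm y)\<^sup>2) / a"
      using a second_moment_nonneg by (intro divide_right_mono) (auto simp: algebra_simps)
    finally have m: "((norm y)\<^sup>2 + second_moment) / s \<le> (1 + second_moment) / a * (1 + (norm y)\<^sup>2)" by simp
    have p: "((norm y)\<^sup>2 + second_moment) / s \<ge> 0" using s0 second_moment_nonneg by simp
    have "\<bar>1 + ln (heat s y)\<bar> \<le> 1 + real DIM('a) / 2 * L + ((norm y)\<^sup>2 + second_moment) / s"
      using ln_heat_le[OF s0, of y] ln_heat_ge[OF s0, of y] c p by (simp only: minus_mult_left[symmetric])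
    also have "\<dots> \<le> (1 + real DIM('a) / 2 * L) * (1 + (norm y)\<^sup>2) + (1 + second_moment) / a * (1 + (norm y)\<^sup>2)"
    proof (intro add_mono m)
      have "L \<ge> 0" by (simp add: L_def)
      then have "(1 + real DIM('a) / 2 * L) * 1 \<le> (1 + real DIM('a) / 2 * L) * (1 + (norm y)\<^sup>2)"
        by (intro mult_left_mono) auto
      then show "1 + real DIM('a) / 2 * L \<le> (1 + real DIM('a) / 2 * L) * (1 + (norm y)\<^sup>2)" by simp
    qed
    finally show ?thesis by (simp add: C_def algebra_simps)
  qed
  then show ?thesis using that by blast
qed

lemma heat_partials: "s > 0 \<Longrightarrow> has_partials (heat s) (heat_grad s)"
  by (rule conv_gauss_partials[OF u_integrable])

lemma heat_borel: "s > 0 \<Longrightarrow> heat s \<in> borel_measurable borel"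
  by (rule has_partials_borel[OF heat_partials])

lemma heat_grad_borel: "s > 0 \<Longrightarrow> heat_grad s b \<in> borel_measurable borel"
  using conv_poly_gauss_continuous[OF u_integrable gauss_gradient_poly_gauss] by (intro borel_measurable_continuous_onI) auto

lemma heat_integrable: "s > 0 \<Longrightarrow> integrable lborel (heat s)"
  and heat_mass: "s > 0 \<Longrightarrow> (LBINT y. heat s y) = 1"
  using conv_const_Fubini[OF u_integrable integrable_gauss] by (auto simp: u_mass integral_gauss)

lemma heat_grad_integrable: "s > 0 \<Longrightarrow> integrable lborel (heat_grad s b)"
  using conv_const_Fubini(1)[OF u_integrable poly_gauss_integrable[OF gauss_gradient_poly_gauss]] by auto

lemma inner_growth: "\<bar>y \<bullet> b\<bar> \<le> norm b * (1 + (norm y)\<^sup>2)"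
proof -
  have "norm y \<le> 1 + (norm y)\<^sup>2" by (rule le_one_plus_power2)
  then have "norm y * norm b \<le> (1 + (norm y)\<^sup>2) * norm b" by (intro mult_right_mono) auto
  then show ?thesis using Cauchy_Schwarz_ineq2[of y b] by (simp add: mult.commute)
qed

lemma heat_second_moment:
  assumes s: "s > 0"
  shows "integrable lborel (\<lambda>y. (norm y)\<^sup>2 * heat s y)"
    and "(LBINT y. (norm y)\<^sup>2 * heat s y) = second_moment + s * real DIM('a)"
proof -
  note F = conv_growth[of "\<lambda>y. (norm y)\<^sup>2" 1 "gauss s" "1 / (2 * s)", OF _ _ gauss_poly_gauss]
  show "integrable lborel (\<lambda>y. (norm y)\<^sup>2 * heat s y)" using s by (intro F(1)) auto
  have "(LBINT z. (norm (z + x))\<^sup>2 * gauss s z) = (norm x)\<^sup>2 + s * real DIM('a)" for x :: 'a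
  proof -
    have i1: "integrable (lborel :: 'a measure) (\<lambda>z. (norm z)\<^sup>2 * gauss s z)"
      by (intro poly_times_gauss_integrable real_polynomial_function_norm_power2 s)
    have i2: "integrable lborel (\<lambda>z. (z \<bullet> e) * gauss s z)" for e
      by (intro poly_times_gauss_integrable real_polynomial_function_inner s)
    have i3: "integrable lborel (\<lambda>z. \<Sum>e\<in>Basis. (2 * (x \<bullet> e)) * ((z \<bullet> e) * gauss s z))"
      by (intro Bochner_Integration.integrable_sum integrable_mult_right i2)
    have "(norm (z + x))\<^sup>2 * gauss s z = (norm z)\<^sup>2 * gauss s z + ((norm x)\<^sup>2 * gauss s z
        + (\<Sum>e\<in>Basis. (2 * (x \<bullet> e)) * ((z \<bullet> e) * gauss s z)))" for z
    proof -
      have "(\<Sum>e\<in>Basis. (2 * (x \<bullet> e)) * ((z \<bullet> e) * gauss s z)) = 2 * (x \<bullet> z) * gauss s z"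
        by (subst euclidean_inner[of x z]) (simp add: sum_distrib_left sum_distrib_right mult_ac)
      then show ?thesis
        by (simp add: power2_norm_eq_inner inner_add_left inner_add_right inner_commute algebra_simps)
    qed
    then have "(LBINT z. (norm (z + x))\<^sup>2 * gauss s z)
       = (\<integral>z. (norm z)\<^sup>2 * gauss s z \<partial>(lborel :: 'a measure)) + ((\<integral>z. (norm x)\<^sup>2 * gauss s z \<partial>(lborel :: 'a measure))
        + (LBINT z. (\<Sum>e\<in>Basis. (2 * (x \<bullet> e)) * ((z \<bullet> e) * gauss s z))))"
      using i1 i3
      by (simp only: Bochner_Integration.integral_add Bochner_Integration.integrable_add
          integrable_mult_right integrable_gauss s)
    also have "(LBINT z. (\<Sum>e\<in>Basis. (2 * (x \<bullet> e)) * ((z \<bullet> e) * gauss s z))) = 0"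
    proof (subst Bochner_Integration.integral_sum)
      show "(\<Sum>e\<in>Basis. LBINT z. (2 * (x \<bullet> e)) * ((z \<bullet> e) * gauss s z)) = 0"
        by (intro sum.neutral ballI) (simp only: integral_mult_right_zero integral_inner_gauss[OF s] mult_zero_right)
    qed (intro integrable_mult_right i2)
    finally show ?thesis by (simp add: integral_norm_power2_gauss integral_gauss s)
  qed
  then have "(LBINT y. (norm y)\<^sup>2 * heat s y) = (LBINT x. u x * ((norm x)\<^sup>2 + s * real DIM('a)))"
    using s by (subst F(2)) auto
  also have "\<dots> = (LBINT x. (norm x)\<^sup>2 * u x + (s * real DIM('a)) * u x)"
    by (intro Bochner_Integration.integral_cong) (auto simp: algebra_simps)
  also have "\<dots> = second_moment + s * real DIM('a)"
    using u_second_moment integrable_mult_right[OF u_integrable]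
    by (subst Bochner_Integration.integral_add) (simp_all add: second_moment_def u_mass)
  finally show "(LBINT y. (norm y)\<^sup>2 * heat s y) = second_moment + s * real DIM('a)" .
qed

lemma heat_inner_power2_integrable:
  assumes s: "s > 0" and b: "b \<in> Basis"
  shows "integrable lborel (\<lambda>y. (y \<bullet> b)\<^sup>2 * heat s y)"
proof (rule Bochner_Integration.integrable_bound[OF heat_second_moment(1)[OF s]])
  have [measurable]: "heat s \<in> borel_measurable borel" by (rule heat_borel[OF s])
  show "(\<lambda>y. (y \<bullet> b)\<^sup>2 * heat s y) \<in> borel_measurable lborel" by measurable
  have "(y \<bullet> b)\<^sup>2 * heat s y \<le> (norm y)\<^sup>2 * heat s y" for y
    using Basis_le_norm[OF b, of y] heat_pos[OF s, of y] by (intro mult_right_mono) (auto simp: abs_le_square_iff[symmetric])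
  then show "AE y in lborel. norm ((y \<bullet> b)\<^sup>2 * heat s y) \<le> norm ((norm y)\<^sup>2 * heat s y)"
    using heat_pos[OF s] by (intro AE_I2) (simp add: abs_mult less_imp_le)
qed

lemma heat_first_moment:
  assumes s: "s > 0" and b: "b \<in> Basis"
  shows "integrable lborel (\<lambda>y. (y \<bullet> b) * heat s y)"
    and "(LBINT y. (y \<bullet> b) * heat s y) = (LBINT x. (x \<bullet> b) * u x)"
proof -
  note F = conv_growth[of "\<lambda>y. y \<bullet> b" "norm b" "gauss s" "1 / (2 * s)", OF _ inner_growth gauss_poly_gauss]
  show "integrable lborel (\<lambda>y. (y \<bullet> b) * heat s y)" using s by (intro F(1)) auto
  have "(LBINT z. ((z + x) \<bullet> b) * gauss s z) = x \<bullet> b" for x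
  proof -
    have "(LBINT z. ((z + x) \<bullet> b) * gauss s z) = (LBINT z. (z \<bullet> b) * gauss s z + (x \<bullet> b) * gauss s z)"
      by (intro Bochner_Integration.integral_cong) (auto simp: inner_add_left distrib_right)
    also have "\<dots> = (LBINT z. (z \<bullet> b) * gauss s z) + (\<integral>z. (x \<bullet> b) * gauss s z \<partial>(lborel :: 'a measure))"
      by (intro Bochner_Integration.integral_add integrable_mult_right integrable_gauss s
          poly_times_gauss_integrable real_polynomial_function_inner)
    finally show ?thesis by (simp add: integral_inner_gauss s b integral_gauss)
  qed
  then show "(LBINT y. (y \<bullet> b) * heat s y) = (LBINT x. (x \<bullet> b) * u x)"
    using s by (subst F(2)) (auto simp: mult.commute)
qed

lemma heat_grad_mean_0:
  assumes s: "s > 0" and b: "b \<in> Basis"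
  shows "(LBINT y. heat_grad s b y) = 0"
proof -
  have "(LBINT y. heat_grad s b y) = (LBINT z. - (z \<bullet> b) / s * gauss s z)"
    using conv_const_Fubini(2)[OF u_integrable poly_gauss_integrable[OF gauss_gradient_poly_gauss]] s by (simp add: u_mass)
  also have "\<dots> = (LBINT z. (- 1 / s) * ((z \<bullet> b) * gauss s z))"
    by (intro Bochner_Integration.integral_cong) auto
  also have "\<dots> = 0" unfolding Bochner_Integration.integral_mult_right_zero using s b by (simp add: integral_inner_gauss)
  finally show ?thesis .
qed

text \<open>Integration by parts in disguise: on the kernel side the shift contributes a vanishing
  first Gaussian moment, and the second moment \<open>s\<close> cancels the factor
  \<open>1 / s\<close>. The value \<open>- 1\<close> is minus the mass and becomes the cross term in
  \<open>heat_score_contraction\<close>.\<close>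

lemma heat_grad_first_moment:
  assumes s: "s > 0" and b: "b \<in> Basis"
  shows "integrable lborel (\<lambda>y. (y \<bullet> b) * heat_grad s b y)"
    and "(LBINT y. (y \<bullet> b) * heat_grad s b y) = - 1"
proof -
  note F = conv_growth[of "\<lambda>y. y \<bullet> b" "norm b" "\<lambda>z. - (z \<bullet> b) / s * gauss s z" "1 / (2 * s)", OF _ inner_growth gauss_gradient_poly_gauss]
  show "integrable lborel (\<lambda>y. (y \<bullet> b) * heat_grad s b y)" using s by (intro F(1)) auto
  have "(LBINT z. ((z + x) \<bullet> b) * (- (z \<bullet> b) / s * gauss s z)) = - 1" for x
  proof -
    have "(LBINT z. ((z + x) \<bullet> b) * (- (z \<bullet> b) / s * gauss s z))
       = (LBINT z. (- 1 / s) * ((z \<bullet> b) * (z \<bullet> b) * gauss s z) + (- (x \<bullet> b) / s) * ((z \<bullet> b) * gauss s z))"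
      using s by (intro Bochner_Integration.integral_cong) (auto simp: inner_add_left field_simps)
    also have "\<dots> = (LBINT z. (- 1 / s) * ((z \<bullet> b) * (z \<bullet> b) * gauss s z)) + (LBINT z. (- (x \<bullet> b) / s) * ((z \<bullet> b) * gauss s z))"
      by (intro Bochner_Integration.integral_add integrable_mult_right s
          poly_times_gauss_integrable real_polynomial_function_inner real_polynomial_function.intros(4))
    also have "\<dots> = - 1"
      unfolding Bochner_Integration.integral_mult_right_zero
      using s b by (simp add: integral_inner_gauss integral_inner_inner_gauss)
    finally show ?thesis .
  qed
  then show "(LBINT y. (y \<bullet> b) * heat_grad s b y) = - 1"
    using s by (subst F(2)) (auto simp: u_mass)
qed

end


definition gauss_dt :: "real \<Rightarrow> 'a::euclidean_space \<Rightarrow> real" where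
  "gauss_dt s z = ((norm z)\<^sup>2 / (2 * s\<^sup>2) - real DIM('a) / (2 * s)) * gauss s z"

lemma gauss_dt_poly_gauss: "gauss_dt s \<in> poly_gauss (1 / (2 * s))"
  using norm_power2_gauss_poly_gauss[of "1 / (2 * s\<^sup>2)" "- real DIM('a) / (2 * s)" s, where 'a = 'a]
  by (simp add: gauss_dt_def[abs_def])

text \<open>Over times between \<open>a\<close> and \<open>b\<close> the normalising factor is
  largest at \<open>a\<close> and the exponential at \<open>b\<close>; the constant \<open>c\<close>
  exchanges one normalisation for the other.\<close>

lemma gauss_dt_bound:
  assumes a: "0 < a" "a \<le> b"
  obtains Q :: "'a::euclidean_space \<Rightarrow> real" where "Q \<in> poly_gauss (1 / (2 * b))"
    "\<And>s z. a \<le> s \<Longrightarrow> s \<le> b \<Longrightarrow> \<bar>gauss_dt s z\<bar> \<le> Q z"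
proof -
  define c where "c = (2 * pi * a) powr (- real DIM('a) / 2) * (2 * pi * b) powr (real DIM('a) / 2)"
  define Q where "Q = (\<lambda>z::'a. c * ((1 / (2 * a\<^sup>2) * (norm z)\<^sup>2 + real DIM('a) / (2 * a)) * gauss b z))"
  have "\<bar>gauss_dt s z\<bar> \<le> Q z" if s: "a \<le> s" "s \<le> b" for s z
  proof -
    have s0: "s > 0" using a s by simp
    have 1: "gauss s z \<le> c * gauss b z"
    proof -
      have "(2 * pi * s) powr (- real DIM('a) / 2) \<le> (2 * pi * a) powr (- real DIM('a) / 2)"
        using a s by (intro powr_mono2') auto
      moreover have "exp (- (norm z)\<^sup>2 / (2 * s)) \<le> exp (- (norm z)\<^sup>2 / (2 * b))"
        using a s s0 by (auto intro!: divide_left_mono)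
      ultimately have "gauss s z \<le> (2 * pi * a) powr (- real DIM('a) / 2) * exp (- (norm z)\<^sup>2 / (2 * b))"
        unfolding gauss_def by (intro mult_mono) auto
      also have "\<dots> = c * gauss b z"
        using a unfolding c_def gauss_def by (simp add: powr_minus field_simps)
      finally show ?thesis .
    qed
    have "(norm z)\<^sup>2 / (2 * s\<^sup>2) \<le> (norm z)\<^sup>2 / (2 * a\<^sup>2)"
      using a s s0 by (intro divide_left_mono mult_left_mono power_mono mult_pos_pos zero_less_power) auto
    moreover have "real DIM('a) / (2 * s) \<le> real DIM('a) / (2 * a)"
      using a s s0 by (intro divide_left_mono mult_pos_pos) auto
    moreover have "(norm z)\<^sup>2 / (2 * s\<^sup>2) \<ge> 0" "real DIM('a) / (2 * s) \<ge> 0" using s0 by simp_all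
    ultimately have 2: "\<bar>(norm z)\<^sup>2 / (2 * s\<^sup>2) - real DIM('a) / (2 * s)\<bar> \<le> (norm z)\<^sup>2 / (2 * a\<^sup>2) + real DIM('a) / (2 * a)"
      by linarith
    have "\<bar>gauss_dt s z\<bar> \<le> ((norm z)\<^sup>2 / (2 * a\<^sup>2) + real DIM('a) / (2 * a)) * (c * gauss b z)"
      unfolding gauss_dt_def abs_mult using 1 2 gauss_nonneg[of s z] a by (intro mult_mono) auto
    then show ?thesis by (simp add: Q_def mult_ac)
  qed
  moreover have "Q \<in> poly_gauss (1 / (2 * b))"
    unfolding Q_def by (intro poly_gauss_cmult norm_power2_gauss_poly_gauss)
  ultimately show ?thesis using that by blast
qed

section \<open>Entropy dissipation and comparison with the Gaussian entropy\<close>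

context heat_flow
begin

text \<open>The reference measure is Lebesgue measure, so this is minus the differential entropy and
  it decreases in \<open>s\<close>.\<close>

definition entropy :: "real \<Rightarrow> real" where
  "entropy s = (LBINT y. heat s y * ln (heat s y))"

text \<open>Fisher information relative to Lebesgue measure, split by coordinates because the score
  is contracted one coordinate at a time.\<close>

definition information :: "real \<Rightarrow> real" where
  "information s = (\<Sum>b\<in>Basis. LBINT y. (heat_grad s b y)\<^sup>2 / heat s y)"

abbreviation heat_hess :: "real \<Rightarrow> 'a \<Rightarrow> 'a \<Rightarrow> 'a \<Rightarrow> real" where
  "heat_hess s b c \<equiv> conv u (\<lambda>z. ((z \<bullet> b) * (z \<bullet> c) / s\<^sup>2 - (c \<bullet> b) / s) * gauss s z)"

lemma gauss_hess_poly_gauss: "(\<lambda>z. ((z \<bullet> b) * (z \<bullet> c) / s\<^sup>2 - (c \<bullet> b) / s) * gauss s z) \<in> poly_gauss (1 / (2 * s))"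
  using inner2_gauss_poly_gauss[of "- (c \<bullet> b) / s" "1 / s\<^sup>2" b c s] by (simp add: add.commute)

lemma heat_grad_partials:
  assumes s: "s > 0"
  shows "has_partials (heat_grad s b) (heat_hess s b)"
proof (rule conv_poly_gauss_partials[OF u_integrable gauss_gradient_poly_gauss])
  have "has_partials (\<lambda>z::'a. - 1 / s) (\<lambda>c z. 0)" by (simp add: has_partials_def)
  from has_partials_mult[OF this inner_gauss_partials[OF s, of b]]
  have "has_partials (\<lambda>z. (- 1 / s) * ((z \<bullet> b) * gauss s z))
     (\<lambda>c z. (- 1 / s) * (((c \<bullet> b) - (z \<bullet> b) * (z \<bullet> c) / s) * gauss s z))" by simp
  moreover have "(\<lambda>c z. (- 1 / s) * (((c \<bullet> b) - (z \<bullet> b) * (z \<bullet> c) / s) * gauss s z))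
     = (\<lambda>c z. ((z \<bullet> b) * (z \<bullet> c) / s\<^sup>2 - (c \<bullet> b) / s) * gauss s z)"
    using s by (auto simp: fun_eq_iff field_simps power2_eq_square)
  ultimately show "has_partials (\<lambda>z. - (z \<bullet> b) / s * gauss s z) (\<lambda>c z. ((z \<bullet> b) * (z \<bullet> c) / s\<^sup>2 - (c \<bullet> b) / s) * gauss s z)"
    by simp
qed (use s gauss_hess_poly_gauss in auto)

lemma heat_time_derivative:
  assumes s: "s > 0"
  shows "((\<lambda>s. heat s y) has_real_derivative conv u (gauss_dt s) y) (at s)"
proof -
  obtain Q :: "'a \<Rightarrow> real" where Q: "Q \<in> poly_gauss (1 / (2 * (2 * s)))"
    "\<And>t z. s / 2 \<le> t \<Longrightarrow> t \<le> 2 * s \<Longrightarrow> \<bar>gauss_dt t z\<bar> \<le> Q z"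
    using gauss_dt_bound[of "s / 2" "2 * s"] s by auto
  show ?thesis
    unfolding conv_def
  proof (rule has_real_derivative_integral_dominated[where a = "s / 2" and b = "2 * s" and w = "\<lambda>x. u x * Q (y - x)"])
    fix t x assume t: "t \<in> {s / 2<..<2 * s}"
    then have t0: "t > 0" using s by simp
    then show "integrable lborel (\<lambda>x. u x * gauss t (y - x))" by (rule integrable_u_gauss)
    show "((\<lambda>t. u x * gauss t (y - x)) has_real_derivative u x * gauss_dt t (y - x)) (at t)"
      unfolding gauss_dt_def by (intro DERIV_cmult gauss_time_derivative t0)
    show "\<bar>u x * gauss_dt t (y - x)\<bar> \<le> u x * Q (y - x)"
      using t Q(2)[of t] by (auto simp: abs_mult u_nonneg intro!: mult_left_mono)
  next
    show "(\<lambda>x. u x * gauss_dt s (y - x)) \<in> borel_measurable lborel"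
      using poly_gauss_borel[OF gauss_dt_poly_gauss[of s]] by measurable
    show "integrable lborel (\<lambda>x. u x * Q (y - x))" using s by (intro integrable_u_poly_gauss[OF Q(1)]) auto
  qed (use s in auto)
qed

lemma entropy_derivative:
  assumes s: "s > 0"
  shows "(entropy has_real_derivative (LBINT y. (1 + ln (heat s y)) * conv u (gauss_dt s) y)) (at s)"
proof -
  obtain Q :: "'a \<Rightarrow> real" where Q: "Q \<in> poly_gauss (1 / (2 * (2 * s)))"
    "\<And>t z. s / 2 \<le> t \<Longrightarrow> t \<le> 2 * s \<Longrightarrow> \<bar>gauss_dt t z\<bar> \<le> Q z"
    using gauss_dt_bound[of "s / 2" "2 * s"] s by auto
  obtain C where C: "\<And>t y. s / 2 \<le> t \<Longrightarrow> t \<le> 2 * s \<Longrightarrow> \<bar>1 + ln (heat t y)\<bar> \<le> C * (1 + (norm y)\<^sup>2)"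
    using ln_heat_growth[of "s / 2" "2 * s"] s by auto
  have C0: "C \<ge> 0" using C[of s 0] s by auto
  have "((\<lambda>s. LBINT y. heat s y * ln (heat s y)) has_real_derivative
      (LBINT y. (1 + ln (heat s y)) * conv u (gauss_dt s) y)) (at s)"
  proof (rule has_real_derivative_integral_dominated[where a = "s / 2" and b = "2 * s" and w = "\<lambda>y. (C * (1 + (norm y)\<^sup>2)) * conv u Q y"])
    fix t y assume t: "t \<in> {s / 2<..<2 * s}"
    then have t0: "t > 0" using s by simp
    have [measurable]: "heat t \<in> borel_measurable borel" using t0 by (rule heat_borel)
    have "\<bar>ln (heat t y)\<bar> \<le> (C + 1) * (1 + (norm y)\<^sup>2)" for y
    proof -
      have "\<bar>ln (heat t y)\<bar> \<le> C * (1 + (norm y)\<^sup>2) + 1" using C[of t y] t by simp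
      then show ?thesis by (simp add: algebra_simps) (smt (verit) zero_le_power2)
    qed
    from conv_growth(1)[OF _ this gauss_poly_gauss, of t] t0
    show "integrable lborel (\<lambda>y. heat t y * ln (heat t y))" by (simp add: mult.commute)
    show "((\<lambda>t. heat t y * ln (heat t y)) has_real_derivative (1 + ln (heat t y)) * conv u (gauss_dt t) y) (at t)"
      using heat_pos[OF t0, of y] by (auto intro!: derivative_eq_intros heat_time_derivative t0 simp: algebra_simps)
    have "\<bar>conv u (gauss_dt t) y\<bar> \<le> conv u Q y"
      unfolding conv_def
    proof (rule integral_abs_bound_integral)
      show "integrable lborel (\<lambda>x. u x * gauss_dt t (y - x))" using t0 by (intro integrable_u_poly_gauss[OF gauss_dt_poly_gauss]) auto
      show "integrable lborel (\<lambda>x. u x * Q (y - x))" using s by (intro integrable_u_poly_gauss[OF Q(1)]) auto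
      show "\<bar>u x * gauss_dt t (y - x)\<bar> \<le> u x * Q (y - x)" for x
        using t Q(2)[of t] by (auto simp: abs_mult u_nonneg intro!: mult_left_mono)
    qed
    then show "\<bar>(1 + ln (heat t y)) * conv u (gauss_dt t) y\<bar> \<le> (C * (1 + (norm y)\<^sup>2)) * conv u Q y"
      unfolding abs_mult using C[of t y] t C0 by (intro mult_mono) auto
  next
    have [measurable]: "heat s \<in> borel_measurable borel" using s by (rule heat_borel)
    have "conv u (gauss_dt s) \<in> borel_measurable borel"
      using conv_poly_gauss_continuous[OF u_integrable gauss_dt_poly_gauss[of s]] s by (intro borel_measurable_continuous_onI) auto
    then show "(\<lambda>y. (1 + ln (heat s y)) * conv u (gauss_dt s) y) \<in> borel_measurable lborel" by measurable
    show "integrable lborel (\<lambda>y. (C * (1 + (norm y)\<^sup>2)) * conv u Q y)"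
      using s C0 by (intro conv_growth(1)[OF _ _ Q(1), where C = C]) auto
  qed (use s in auto)
  then show ?thesis by (simp add: entropy_def[abs_def])
qed

text \<open>Cauchy-Schwarz under the weights \<open>u x * gauss s (y - x)\<close>, obtained by
  completing the square at the optimal constant \<open>c\<close>. It makes the Fisher information
  finite at every positive time.\<close>

lemma heat_grad_power2_le:
  assumes s: "s > 0"
  shows "(heat_grad s b y)\<^sup>2 / heat s y \<le> conv u (\<lambda>z. (z \<bullet> b)\<^sup>2 / s\<^sup>2 * gauss s z) y"
proof -
  have p: "heat s y > 0" using s by (rule heat_pos)
  define c where "c = heat_grad s b y / heat s y"
  have pg: "(\<lambda>z. (z \<bullet> b)\<^sup>2 / s\<^sup>2 * gauss s z) \<in> poly_gauss (1 / (2 * s))"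
    using inner2_gauss_poly_gauss[of 0 "1 / s\<^sup>2" b b s] by (simp add: power2_eq_square)
  have i1: "integrable lborel (\<lambda>x. (2 * c) * (u x * (- ((y - x) \<bullet> b) / s * gauss s (y - x))))"
    using s by (intro integrable_mult_right integrable_u_poly_gauss[OF gauss_gradient_poly_gauss]) auto
  have i2: "integrable lborel (\<lambda>x. c\<^sup>2 * (u x * gauss s (y - x)))"
    by (intro integrable_mult_right integrable_u_gauss s)
  have "(heat_grad s b y)\<^sup>2 / heat s y = 2 * c * heat_grad s b y - c\<^sup>2 * heat s y"
    using p by (simp add: c_def power2_eq_square)
  also have "\<dots> = (LBINT x. (2 * c) * (u x * (- ((y - x) \<bullet> b) / s * gauss s (y - x))) - c\<^sup>2 * (u x * gauss s (y - x)))"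
    using i1 i2 by (simp add: conv_def Bochner_Integration.integral_diff)
  also have "\<dots> \<le> conv u (\<lambda>z. (z \<bullet> b)\<^sup>2 / s\<^sup>2 * gauss s z) y"
    unfolding conv_def
  proof (rule integral_mono)
    show "integrable lborel (\<lambda>x. u x * (((y - x) \<bullet> b)\<^sup>2 / s\<^sup>2 * gauss s (y - x)))"
      using s by (intro integrable_u_poly_gauss[OF pg]) auto
    fix x
    have "0 \<le> (c + ((y - x) \<bullet> b) / s)\<^sup>2" by simp
    then have "2 * c * (- ((y - x) \<bullet> b) / s) - c\<^sup>2 \<le> ((y - x) \<bullet> b)\<^sup>2 / s\<^sup>2"
      by (simp add: power2_sum power_divide)
    then have "(u x * gauss s (y - x)) * (2 * c * (- ((y - x) \<bullet> b) / s) - c\<^sup>2) \<le> (u x * gauss s (y - x)) * (((y - x) \<bullet> b)\<^sup>2 / s\<^sup>2)"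
      by (intro mult_left_mono mult_nonneg_nonneg u_nonneg gauss_nonneg)
    then show "(2 * c) * (u x * (- ((y - x) \<bullet> b) / s * gauss s (y - x))) - c\<^sup>2 * (u x * gauss s (y - x))
        \<le> u x * (((y - x) \<bullet> b)\<^sup>2 / s\<^sup>2 * gauss s (y - x))"
      by (simp add: algebra_simps)
  qed (use i1 i2 in auto)
  finally show ?thesis .
qed

lemma heat_grad_power2_integrable:
  assumes s: "s > 0"
  shows "integrable lborel (\<lambda>y. (heat_grad s b y)\<^sup>2 / heat s y)"
proof (rule Bochner_Integration.integrable_bound)
  have pg: "(\<lambda>z. (z \<bullet> b)\<^sup>2 / s\<^sup>2 * gauss s z) \<in> poly_gauss (1 / (2 * s))"
    using inner2_gauss_poly_gauss[of 0 "1 / s\<^sup>2" b b s] by (simp add: power2_eq_square)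
  show "integrable lborel (conv u (\<lambda>z. (z \<bullet> b)\<^sup>2 / s\<^sup>2 * gauss s z))"
    using s by (intro conv_const_Fubini(1) u_integrable poly_gauss_integrable[OF pg]) auto
  have [measurable]: "heat s \<in> borel_measurable borel" "heat_grad s b \<in> borel_measurable borel"
    using s heat_borel heat_grad_borel by blast+
  show "(\<lambda>y. (heat_grad s b y)\<^sup>2 / heat s y) \<in> borel_measurable lborel" by measurable
  show "AE y in lborel. norm ((heat_grad s b y)\<^sup>2 / heat s y) \<le> norm (conv u (\<lambda>z. (z \<bullet> b)\<^sup>2 / s\<^sup>2 * gauss s z) y)"
  proof (intro AE_I2)
    fix y
    have "0 \<le> (heat_grad s b y)\<^sup>2 / heat s y" using heat_pos[OF s, of y] by simp
    then show "norm ((heat_grad s b y)\<^sup>2 / heat s y) \<le> norm (conv u (\<lambda>z. (z \<bullet> b)\<^sup>2 / s\<^sup>2 * gauss s z) y)"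
      using heat_grad_power2_le[OF s, of b y] by simp
  qed
qed

text \<open>The partial derivative of \<open>(1 + ln (heat s y)) * heat_grad s b y\<close> has
  integral zero, and the product rule splits it into the two integrands. Quadratic growth of the
  logarithm gives the integrability.\<close>

lemma heat_hess_by_parts:
  assumes s: "s > 0" and b: "b \<in> Basis"
  shows "integrable lborel (\<lambda>y. (1 + ln (heat s y)) * heat_hess s b b y)"
    and "(LBINT y. (1 + ln (heat s y)) * heat_hess s b b y) = - (LBINT y. (heat_grad s b y)\<^sup>2 / heat s y)"
proof -
  obtain C where C: "\<And>t y. s \<le> t \<Longrightarrow> t \<le> s \<Longrightarrow> \<bar>1 + ln (heat t y)\<bar> \<le> C * (1 + (norm y)\<^sup>2)"
    using ln_heat_growth[OF s, of s] by auto
  have [measurable]: "heat s \<in> borel_measurable borel" using s by (rule heat_borel)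
  have g: "integrable lborel (\<lambda>y. (1 + ln (heat s y)) * conv u K y)" if "K \<in> poly_gauss (1 / (2 * s))" for K
    using C s by (intro conv_growth(1)[OF _ _ that]) auto
  show i: "integrable lborel (\<lambda>y. (1 + ln (heat s y)) * heat_hess s b b y)"
    by (rule g[OF gauss_hess_poly_gauss])
  have i2: "integrable lborel (\<lambda>y. (heat_grad s b y)\<^sup>2 / heat s y)" by (rule heat_grad_power2_integrable[OF s])
  have "has_partials (\<lambda>y::'a. 1) (\<lambda>b y. 0::real)" by (simp add: has_partials_def)
  note P = has_partials_mult[OF has_partials_add[OF this has_partials_ln[OF heat_partials[OF s] heat_pos[OF s]]] heat_grad_partials[OF s, of b]]
  have eq: "(\<lambda>y. (1 + ln (heat s y)) * heat_hess s b b y + (0 + heat_grad s b y / heat s y) * heat_grad s b y)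
     = (\<lambda>y. (1 + ln (heat s y)) * heat_hess s b b y + (heat_grad s b y)\<^sup>2 / heat s y)"
    by (simp add: power2_eq_square)
  have cont: "continuous_on UNIV (\<lambda>y. (1 + ln (heat s y)) * heat_hess s b b y + (heat_grad s b y)\<^sup>2 / heat s y)"
  proof -
    have "continuous_on UNIV (heat s)" by (rule has_partials_continuous[OF heat_partials[OF s]])
    moreover have "continuous_on UNIV (heat_grad s b)" by (rule has_partials_continuous[OF heat_grad_partials[OF s]])
    moreover have "continuous_on UNIV (heat_hess s b b)"
      using s by (intro conv_poly_gauss_continuous[OF u_integrable gauss_hess_poly_gauss]) auto
    moreover have "heat s y \<noteq> 0" for y using heat_pos[OF s, of y] by simp
    ultimately show ?thesis by (intro continuous_intros) auto
  qed
  have "0 = (LBINT y. (1 + ln (heat s y)) * heat_hess s b b y + (heat_grad s b y)\<^sup>2 / heat s y)"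
    using integral_partial_derivative_eq_0[OF P b] cont i i2 g[OF gauss_gradient_poly_gauss] unfolding eq by simp
  then show "(LBINT y. (1 + ln (heat s y)) * heat_hess s b b y) = - (LBINT y. (heat_grad s b y)\<^sup>2 / heat s y)"
    using i i2 by (simp add: Bochner_Integration.integral_add)
qed

text \<open>The time derivative of the kernel is half the trace of its Hessian, so the derivative of
  the entropy becomes a sum of integrals to which integration by parts applies.\<close>

theorem de_Bruijn:
  assumes s: "s > 0"
  shows "(entropy has_real_derivative - information s / 2) (at s)"
proof -
  have dt: "conv u (gauss_dt s) y = (\<Sum>b\<in>Basis. heat_hess s b b y / 2)" for y
  proof -
    have k: "gauss_dt s z = (\<Sum>b\<in>Basis. ((z \<bullet> b) * (z \<bullet> b) / s\<^sup>2 - (b \<bullet> b) / s) * gauss s z / 2)" for z :: 'a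
    proof -
      have "(\<Sum>b\<in>Basis. ((z \<bullet> b) * (z \<bullet> b) / s\<^sup>2 - (b \<bullet> b) / s) * gauss s z / 2)
        = ((\<Sum>b\<in>Basis. (z \<bullet> b) * (z \<bullet> b)) / s\<^sup>2 - real DIM('a) / s) * gauss s z / 2"
        by (simp add: sum_divide_distrib[symmetric] sum_distrib_right[symmetric] sum_subtractf)
      also have "(\<Sum>b\<in>Basis. (z \<bullet> b) * (z \<bullet> b)) = (norm z)\<^sup>2"
        unfolding power2_norm_eq_inner euclidean_inner[of z z] ..
      also have "((norm z)\<^sup>2 / s\<^sup>2 - real DIM('a) / s) * gauss s z / 2 = gauss_dt s z"
        by (simp add: gauss_dt_def field_simps)
      finally show ?thesis by (rule sym)
    qed
    have "conv u (gauss_dt s) y = (LBINT x. (\<Sum>b\<in>Basis. u x * (((y - x) \<bullet> b) * ((y - x) \<bullet> b) / s\<^sup>2 - (b \<bullet> b) / s) * gauss s (y - x) / 2))"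
      unfolding conv_def k by (simp add: sum_distrib_left mult_ac)
    also have "\<dots> = (\<Sum>b\<in>Basis. heat_hess s b b y / 2)"
    proof (subst Bochner_Integration.integral_sum)
      fix b :: 'a
      have "integrable lborel (\<lambda>x. u x * ((((y - x) \<bullet> b) * ((y - x) \<bullet> b) / s\<^sup>2 - (b \<bullet> b) / s) * gauss s (y - x)) / 2)"
        using s by (intro integrable_divide integrable_u_poly_gauss[OF gauss_hess_poly_gauss]) auto
      then show "integrable lborel (\<lambda>x. u x * (((y - x) \<bullet> b) * ((y - x) \<bullet> b) / s\<^sup>2 - (b \<bullet> b) / s) * gauss s (y - x) / 2)"
        by (simp add: mult.assoc)
    qed (simp add: conv_def mult.assoc)
    finally show ?thesis .
  qed
  have "(LBINT y. (1 + ln (heat s y)) * conv u (gauss_dt s) y)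
     = (LBINT y. (\<Sum>b\<in>Basis. (1 + ln (heat s y)) * heat_hess s b b y / 2))"
    unfolding dt by (simp add: sum_distrib_left)
  also have "\<dots> = (\<Sum>b\<in>Basis. LBINT y. (1 + ln (heat s y)) * heat_hess s b b y / 2)"
    by (intro Bochner_Integration.integral_sum integrable_divide heat_hess_by_parts(1) s)
  also have "\<dots> = (\<Sum>b\<in>Basis. - (LBINT y. (heat_grad s b y)\<^sup>2 / heat s y) / 2)"
    unfolding integral_divide_zero by (intro sum.cong refl) (simp only: heat_hess_by_parts(2)[OF s])
  also have "\<dots> = - information s / 2"
    by (simp add: information_def sum_divide_distrib sum_negf)
  finally show ?thesis using entropy_derivative[OF s] by simp
qed

lemma entropy_integrable:
  assumes s: "s > 0"
  shows "integrable lborel (\<lambda>y. heat s y * ln (heat s y))"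
proof -
  obtain C where C: "\<And>t y. s \<le> t \<Longrightarrow> t \<le> s \<Longrightarrow> \<bar>1 + ln (heat t y)\<bar> \<le> C * (1 + (norm y)\<^sup>2)"
    using ln_heat_growth[OF s, of s] by auto
  have [measurable]: "heat s \<in> borel_measurable borel" using s by (rule heat_borel)
  have "integrable lborel (\<lambda>y. (1 + ln (heat s y)) * heat s y)"
    using C s by (intro conv_growth(1)[OF _ _ gauss_poly_gauss]) auto
  from Bochner_Integration.integrable_diff[OF this heat_integrable[OF s]]
  show ?thesis by (simp add: algebra_simps)
qed

text \<open>Jensen's inequality for \<open>t * ln t\<close> holds pointwise in \<open>y\<close>;
  since \<open>u\<close> has mass 1, integrating over \<open>y\<close> leaves the entropy of the
  kernel alone.\<close>

lemma entropy_le_gauss: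
  assumes s: "s > 0"
  shows "entropy s \<le> - (real DIM('a) / 2) * ln (2 * pi * s) - real DIM('a) / 2"
proof -
  let ?c = "- (real DIM('a) / 2) * ln (2 * pi * s)"
  define \<Phi> where "\<Phi> = (\<lambda>z::'a. (- (1 / (2 * s)) * (norm z)\<^sup>2 + ?c) * gauss s z)"
  have \<Phi>pg: "\<Phi> \<in> poly_gauss (1 / (2 * s))" unfolding \<Phi>_def by (rule norm_power2_gauss_poly_gauss)
  have \<Phi>: "\<Phi> z = gauss s z * ln (gauss s z)" for z
    unfolding \<Phi>_def by (simp add: ln_gauss s algebra_simps)
  have le: "heat s y * ln (heat s y) \<le> conv u \<Phi> y" for y
  proof -
    have p: "heat s y > 0" using s by (rule heat_pos)
    have i1: "integrable lborel (\<lambda>x. (1 + ln (heat s y)) * (u x * gauss s (y - x)))"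
      by (intro integrable_mult_right integrable_u_gauss s)
    \<comment> \<open>This is the tangent line of \<open>t * ln t\<close> at
      \<open>t = heat s y\<close>, averaged over \<open>u\<close>; the trailing 1 stands for the
      mass of \<open>u\<close>.\<close>
    have "heat s y * ln (heat s y) = (1 + ln (heat s y)) * heat s y - heat s y * 1" by (simp add: algebra_simps)
    also have "\<dots> = (LBINT x. (1 + ln (heat s y)) * (u x * gauss s (y - x)) - heat s y * u x)"
      using i1 u_integrable by (simp add: conv_def Bochner_Integration.integral_diff u_mass)
    also have "\<dots> \<le> conv u \<Phi> y"
      unfolding conv_def[of u \<Phi>]
    proof (rule integral_mono)
      fix x
      let ?g = "gauss s (y - x)"
      have g: "?g > 0" using s by (rule gauss_pos)
      have "ln (heat s y / ?g) \<le> heat s y / ?g - 1" using p g by (intro ln_le_minus_one) simp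
      then have "?g * (ln (heat s y) - ln ?g) \<le> ?g * (heat s y / ?g - 1)"
        using p g by (intro mult_left_mono) (auto simp: ln_div)
      then have "?g * ln (heat s y) + ?g - heat s y \<le> \<Phi> (y - x)"
        using g unfolding \<Phi> by (simp add: right_diff_distrib)
      then have "u x * (?g * ln (heat s y) + ?g - heat s y) \<le> u x * \<Phi> (y - x)"
        by (intro mult_left_mono u_nonneg)
      then show "(1 + ln (heat s y)) * (u x * ?g) - heat s y * u x \<le> u x * \<Phi> (y - x)"
        by (simp add: algebra_simps)
    qed (use i1 u_integrable s in \<open>auto intro!: integrable_u_poly_gauss[OF \<Phi>pg]\<close>)
    finally show ?thesis .
  qed
  have \<Phi>i: "integrable lborel \<Phi>" using s by (intro poly_gauss_integrable[OF \<Phi>pg]) auto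
  have "entropy s \<le> (LBINT y. conv u \<Phi> y)"
    unfolding entropy_def by (intro integral_mono entropy_integrable s le conv_const_Fubini(1) u_integrable \<Phi>i)
  also have "\<dots> = (LBINT z. \<Phi> z)"
    using conv_const_Fubini(2)[OF u_integrable \<Phi>i] by (simp add: u_mass)
  also have "\<dots> = (\<integral>z. (- (1 / (2 * s))) * ((norm z)\<^sup>2 * gauss s z) + ?c * gauss s z \<partial>(lborel :: 'a measure))"
    unfolding \<Phi>_def by (intro Bochner_Integration.integral_cong) (auto simp: algebra_simps)
  also have "\<dots> = (\<integral>z. (- (1 / (2 * s))) * ((norm z)\<^sup>2 * gauss s z) \<partial>(lborel :: 'a measure)) + (\<integral>z. ?c * gauss s z \<partial>(lborel :: 'a measure))"
    by (intro Bochner_Integration.integral_add integrable_mult_right integrable_gauss s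
            poly_times_gauss_integrable[OF real_polynomial_function_norm_power2])
  also have "\<dots> = ?c - real DIM('a) / 2"
    unfolding Bochner_Integration.integral_mult_right_zero using s by (simp add: integral_gauss integral_norm_power2_gauss)
  finally show ?thesis .
qed

end


section \<open>The score of a density with a weak gradient\<close>

lemma test_function_bounds:
  fixes \<phi> :: "'a::euclidean_space \<Rightarrow> real"
  assumes t: "test_function \<phi>"
  obtains K B where "compact K" "\<And>x. \<bar>\<phi> x\<bar> \<le> B * indicator K x"
    "\<And>b x. b \<in> Basis \<Longrightarrow> \<bar>frechet_derivative \<phi> (at x) b\<bar> \<le> B * indicator K x"
proof -
  define K where "K = closure {x. \<phi> x \<noteq> 0}"
  have K: "compact K" and sm: "smooth \<phi>" using t by (simp_all add: test_function_def K_def)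
  have c0: "continuous_on UNIV \<phi>" using has_partials_continuous[OF smooth_has_partials[OF sm]] .
  have c1: "continuous_on UNIV (\<lambda>x. frechet_derivative \<phi> (at x) b)" if "b \<in> Basis" for b
  proof -
    have "Ck (Suc 0) \<phi>" using sm unfolding smooth_def by blast
    then show ?thesis using that by simp
  qed
  have bnd: "\<exists>B. \<forall>x\<in>K. \<bar>g x\<bar> \<le> B" if "continuous_on UNIV g" for g :: "'a \<Rightarrow> real"
    using compact_imp_bounded[OF compact_continuous_image[OF continuous_on_subset[OF that] K]]
    by (auto simp: bounded_iff)
  obtain B0 where B0: "\<And>x. x \<in> K \<Longrightarrow> \<bar>\<phi> x\<bar> \<le> B0" using bnd[OF c0] by blast
  obtain Bd where Bd: "\<And>b x. b \<in> Basis \<Longrightarrow> x \<in> K \<Longrightarrow> \<bar>frechet_derivative \<phi> (at x) b\<bar> \<le> Bd b"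
    using bnd[OF c1] by metis
  define B where "B = \<bar>B0\<bar> + (\<Sum>b\<in>(Basis :: 'a set). \<bar>Bd b\<bar>)"
  have nn: "(\<Sum>b\<in>(Basis :: 'a set). \<bar>Bd b\<bar>) \<ge> 0" by (intro sum_nonneg) auto
  have "\<bar>\<phi> x\<bar> \<le> B * indicator K x" for x
  proof (cases "x \<in> K")
    case True
    have "\<bar>\<phi> x\<bar> \<le> B" using B0[OF True] nn unfolding B_def by linarith
    then show ?thesis using True by simp
  next
    case False
    then have "\<phi> x = 0" using closure_subset[of "{x. \<phi> x \<noteq> 0}"] by (auto simp: K_def)
    then show ?thesis using False by simp
  qed
  moreover have "\<bar>frechet_derivative \<phi> (at x) b\<bar> \<le> B * indicator K x" if b: "b \<in> Basis" for b x
  proof (cases "x \<in> K")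
    case True
    have "\<bar>Bd b\<bar> \<le> (\<Sum>b\<in>(Basis :: 'a set). \<bar>Bd b\<bar>)" using b by (intro member_le_sum) auto
    then have "\<bar>frechet_derivative \<phi> (at x) b\<bar> \<le> B" using Bd[OF b True] unfolding B_def by linarith
    then show ?thesis using True by simp
  next
    case False
    have "(\<phi> has_derivative (\<lambda>_. 0)) (at x)"
    proof (rule has_derivative_transform_within_open[where f = "\<lambda>_. 0" and s = "- K"])
      show "open (- K)" unfolding K_def by (rule open_Compl[OF closed_closure])
      fix y assume "y \<in> - K"
      then show "0 = \<phi> y" using closure_subset[of "{x. \<phi> x \<noteq> 0}"] by (auto simp: K_def)
    qed (use False in auto)
    then have "frechet_derivative \<phi> (at x) = (\<lambda>_. 0)" by (rule frechet_derivative_at[symmetric])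
    then show ?thesis using False by simp
  qed
  ultimately show ?thesis using that K by blast
qed

lemma locally_integrableD:
  "locally_integrable h \<Longrightarrow> compact K \<Longrightarrow> integrable lborel (\<lambda>x. indicator K x *\<^sub>R h x)"
  by (simp add: locally_integrable_def set_integrable_def)

text \<open>Restrictions to balls are integrable and hence measurable, and they converge pointwise
  as the radius grows.\<close>

lemma locally_integrable_borel:
  fixes G :: "'a::euclidean_space \<Rightarrow> 'a"
  assumes "locally_integrable G"
  shows "G \<in> borel_measurable borel"
proof (rule borel_measurable_LIMSEQ_metric)
  fix n :: nat
  have "integrable lborel (\<lambda>x. indicator (cball 0 (real n)) x *\<^sub>R G x)"
    by (rule locally_integrableD[OF assms compact_cball])
  then show "(\<lambda>x. indicator (cball 0 (real n)) x *\<^sub>R G x) \<in> borel_measurable borel"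
    using borel_measurable_integrable[of lborel] by simp
next
  fix x :: 'a
  obtain N where N: "real N \<ge> norm x" using real_arch_simple by blast
  have "\<forall>\<^sub>F n in sequentially. indicator (cball 0 (real n)) x *\<^sub>R G x = G x"
    using eventually_ge_at_top[of N]
  proof eventually_elim
    case (elim n)
    then have "real N \<le> real n" by simp
    then have "norm x \<le> real n" using N by linarith
    then show ?case by (simp add: mem_cball_0)
  qed
  then show "(\<lambda>n. indicator (cball 0 (real n)) x *\<^sub>R G x) \<longlonglongrightarrow> G x" by (rule tendsto_eventually)
qed

text \<open>Taking an inner product inside a Bochner integral requires integrability of the vector
  integrand. Compact support of the test function together with local integrability of
  \<open>f\<close> and \<open>G\<close> provides it.\<close>

lemma has_weak_gradient_component:
  fixes f :: "'a::euclidean_space \<Rightarrow> real"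
  assumes w: "has_weak_gradient f G" and f: "locally_integrable f" "f \<in> borel_measurable borel"
    and t: "test_function \<phi>" and b: "b \<in> Basis"
  shows "integrable lborel (\<lambda>x. f x * frechet_derivative \<phi> (at x) b)"
    and "integrable lborel (\<lambda>x. \<phi> x * (G x \<bullet> b))"
    and "(LBINT x. f x * frechet_derivative \<phi> (at x) b) = - (LBINT x. \<phi> x * (G x \<bullet> b))"
proof -
  obtain K B where K: "compact K" and B: "\<And>x. \<bar>\<phi> x\<bar> \<le> B * indicator K x"
    "\<And>b x. b \<in> Basis \<Longrightarrow> \<bar>frechet_derivative \<phi> (at x) b\<bar> \<le> B * indicator K x"
    using test_function_bounds[OF t] by metis
  have G: "locally_integrable G" using w by (simp add: has_weak_gradient_def)
  have sm: "smooth \<phi>" using t by (simp add: test_function_def)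
  have c1: "(\<lambda>x. frechet_derivative \<phi> (at x) b) \<in> borel_measurable borel" if "b \<in> Basis" for b
  proof -
    have "Ck (Suc 0) \<phi>" using sm unfolding smooth_def by blast
    then show ?thesis using that by (intro borel_measurable_continuous_onI) simp
  qed
  have [measurable]: "f \<in> borel_measurable borel" "\<phi> \<in> borel_measurable borel" "G \<in> borel_measurable borel"
    using f(2) has_partials_borel[OF smooth_has_partials[OF sm]] locally_integrable_borel[OF G] by simp_all
  have gi: "grad \<phi> x \<bullet> b = frechet_derivative \<phi> (at x) b" if "b \<in> Basis" for b x
    using that by (simp add: grad_def inner_sum_left inner_Basis if_distrib[of "(*) _"] cong: if_cong)
  have i1: "integrable lborel (\<lambda>x. f x * frechet_derivative \<phi> (at x) b)" if b: "b \<in> Basis" for b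
  proof (rule Bochner_Integration.integrable_bound)
    show "integrable lborel (\<lambda>x. B * (indicator K x *\<^sub>R f x))"
      by (intro integrable_mult_right locally_integrableD f(1) K)
    show "(\<lambda>x. f x * frechet_derivative \<phi> (at x) b) \<in> borel_measurable lborel"
      using c1[OF b] by measurable
    show "AE x in lborel. norm (f x * frechet_derivative \<phi> (at x) b) \<le> norm (B * (indicator K x *\<^sub>R f x))"
    proof (intro AE_I2)
      fix x
      have "\<bar>frechet_derivative \<phi> (at x) b\<bar> \<le> \<bar>B * indicator K x\<bar>" using B(2)[OF b, of x] by linarith
      then have "\<bar>f x\<bar> * \<bar>frechet_derivative \<phi> (at x) b\<bar> \<le> \<bar>f x\<bar> * \<bar>B * indicator K x\<bar>" by (intro mult_left_mono) auto
      then show "norm (f x * frechet_derivative \<phi> (at x) b) \<le> norm (B * (indicator K x *\<^sub>R f x))"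
        by (simp add: abs_mult mult_ac)
    qed
  qed
  have i2: "integrable lborel (\<lambda>x. \<phi> x *\<^sub>R G x)"
  proof (rule Bochner_Integration.integrable_bound)
    show "integrable lborel (\<lambda>x. B *\<^sub>R (indicator K x *\<^sub>R G x))"
      by (intro integrable_scaleR_right locally_integrableD G K)
    show "(\<lambda>x. \<phi> x *\<^sub>R G x) \<in> borel_measurable lborel" by measurable
    show "AE x in lborel. norm (\<phi> x *\<^sub>R G x) \<le> norm (B *\<^sub>R (indicator K x *\<^sub>R G x))"
    proof (intro AE_I2)
      fix x
      have "\<bar>\<phi> x\<bar> \<le> \<bar>B * indicator K x\<bar>" using B(1)[of x] by linarith
      then have "\<bar>\<phi> x\<bar> * norm (G x) \<le> \<bar>B * indicator K x\<bar> * norm (G x)" by (intro mult_right_mono) auto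
      then show "norm (\<phi> x *\<^sub>R G x) \<le> norm (B *\<^sub>R (indicator K x *\<^sub>R G x))"
        by (simp add: abs_mult mult_ac)
    qed
  qed
  have i3: "integrable lborel (\<lambda>x. f x *\<^sub>R grad \<phi> x)"
  proof -
    have "integrable lborel (\<lambda>x. \<Sum>b\<in>Basis. (f x * frechet_derivative \<phi> (at x) b) *\<^sub>R b)"
      by (intro Bochner_Integration.integrable_sum integrable_scaleR_left i1)
    then show ?thesis by (simp add: grad_def scaleR_sum_right)
  qed
  show "integrable lborel (\<lambda>x. f x * frechet_derivative \<phi> (at x) b)" by (rule i1[OF b])
  show "integrable lborel (\<lambda>x. \<phi> x * (G x \<bullet> b))" using integrable_inner_left[OF i2, of b] by simp
  have "(LBINT x. f x *\<^sub>R grad \<phi> x) \<bullet> b = (- (LBINT x. \<phi> x *\<^sub>R G x)) \<bullet> b"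
    using w t unfolding has_weak_gradient_def by simp
  then show "(LBINT x. f x * frechet_derivative \<phi> (at x) b) = - (LBINT x. \<phi> x * (G x \<bullet> b))"
    unfolding inner_minus_left integral_inner_left[OF i3, symmetric] integral_inner_left[OF i2, symmetric]
    by (simp add: gi[OF b])
qed

lemma gauss_translate_smooth: "smooth (\<lambda>x. gauss s (x - y))"
  by (rule poly_gauss_translate_smooth[OF gauss_poly_gauss])

lemma gauss_translate_partials:
  "s > 0 \<Longrightarrow> has_partials (\<lambda>x. gauss s (x - y)) (\<lambda>b x. - ((x - y) \<bullet> b) / s * gauss s (x - y))"
  by (rule has_partials_translate[OF gauss_partials])

text \<open>A cutoff makes \<open>f\<close> and its gradient integrable, so the global result
  applies. Inside the ball the cutoff is strictly positive and can be divided out; the radii then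
  exhaust the space.\<close>

lemma weak_gradient_zero_on_zero_set:
  fixes f :: "'a::euclidean_space \<Rightarrow> real"
  assumes w: "has_weak_gradient f G" and f: "locally_integrable f" "f \<in> borel_measurable borel"
    and nonneg: "\<And>x. f x \<ge> 0" and b: "b \<in> Basis"
  shows "AE x in lborel. f x = 0 \<longrightarrow> G x \<bullet> b = 0"
proof -
  have G: "locally_integrable G" using w by (simp add: has_weak_gradient_def)
  have [measurable]: "f \<in> borel_measurable borel" "G \<in> borel_measurable borel"
    using f(2) locally_integrable_borel[OF G] by simp_all
  have *: "AE x in lborel. norm x < R \<longrightarrow> f x = 0 \<longrightarrow> G x \<bullet> b = 0" if R1: "R \<ge> 1" for R :: real
  proof -
    let ?db = "\<lambda>x. frechet_derivative (bump R) (at x) b"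
    have R: "R > 0" using R1 by simp
    have [measurable]: "?db \<in> borel_measurable borel" by (rule bump_partial_borel[OF b])
    define p where "p = (\<lambda>x. bump R x * f x)"
    \<comment> \<open>The weak derivative of \<open>p\<close> given by the product rule.\<close>
    define V where "V = (\<lambda>x. bump R x * (G x \<bullet> b) + ?db x * f x)"
    have [measurable]: "p \<in> borel_measurable borel" "V \<in> borel_measurable borel" unfolding p_def V_def by measurable
    have fi: "integrable lborel (\<lambda>x. indicator (cball 0 R) x * f x)"
      using locally_integrableD[OF f(1) compact_cball[of 0 R]] by simp
    have Gi: "integrable lborel (\<lambda>x. indicator (cball 0 R) x * (G x \<bullet> b))"
    proof -
      have "integrable lborel (\<lambda>x. indicator (cball 0 R) x *\<^sub>R G x)"
        by (rule locally_integrableD[OF G compact_cball])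
      from integrable_inner_left[OF this, of b] show ?thesis by simp
    qed
    have bi: "\<bar>bump R x\<bar> \<le> indicator (cball 0 R) x" for x :: 'a
      using bump_nonneg[of R x] bump_le_1[of R x] bump_eq_0[OF R, of x]
      by (cases "norm x \<le> R") (auto simp: indicator_def mem_cball_0)
    have dbi: "\<bar>?db x\<bar> \<le> 4 * exp 1 * indicator (cball 0 R) x" for x :: 'a
    proof (cases "norm x \<le> R")
      case True
      have "4 * exp 1 / R \<le> 4 * exp (1::real) / 1" using R1 by (intro divide_left_mono) auto
      then show ?thesis using bump_partial_bound[OF R b, of x] True by (simp add: mem_cball_0)
    next
      case False
      then show ?thesis using bump_partial_eq_0[OF R _ b, of x] by (simp add: mem_cball_0)
    qed
    have pi: "integrable lborel p"
    proof (rule Bochner_Integration.integrable_bound[OF fi])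
      have "\<bar>bump R x\<bar> * \<bar>f x\<bar> \<le> indicator (cball 0 R) x * \<bar>f x\<bar>" for x by (intro mult_right_mono bi) auto
      then show "AE x in lborel. norm (p x) \<le> norm (indicator (cball 0 R) x * f x)"
        by (simp add: p_def abs_mult)
    qed simp
    have dfi: "integrable lborel (\<lambda>x. ?db x * f x)"
    proof (rule Bochner_Integration.integrable_bound[OF integrable_mult_right[OF fi, of "4 * exp 1"]])
        have "\<bar>?db x\<bar> * \<bar>f x\<bar> \<le> 4 * exp 1 * indicator (cball 0 R) x * \<bar>f x\<bar>" for x by (intro mult_right_mono dbi) auto
        then show "AE x in lborel. norm (?db x * f x) \<le> norm (4 * exp 1 * (indicator (cball 0 R) x * f x))"
          by (simp add: abs_mult mult.assoc)
    qed simp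
    have Vi: "integrable lborel V"
      unfolding V_def
    proof (rule Bochner_Integration.integrable_add)
      show "integrable lborel (\<lambda>x. bump R x * (G x \<bullet> b))"
      proof (rule Bochner_Integration.integrable_bound[OF Gi])
        have "\<bar>bump R x\<bar> * \<bar>G x \<bullet> b\<bar> \<le> indicator (cball 0 R) x * \<bar>G x \<bullet> b\<bar>" for x by (intro mult_right_mono bi) auto
        then show "AE x in lborel. norm (bump R x * (G x \<bullet> b)) \<le> norm (indicator (cball 0 R) x * (G x \<bullet> b))"
          by (simp add: abs_mult)
      qed simp
    qed (rule dfi)
    have "AE x in lborel. p x = 0 \<longrightarrow> V x = 0"
    proof (rule weak_derivative_eq_0_on_zero_set[OF pi _ Vi b])
      show "p x \<ge> 0" for x by (simp add: p_def bump_nonneg nonneg)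
      fix s :: real and y :: 'a assume s: "s > 0"
      \<comment> \<open>A heat kernel alone lacks compact support. With the cutoff as a factor it
        becomes a test function, and the derivative of the cutoff is the extra term in
        \<open>V\<close>.\<close>
      let ?\<phi> = "\<lambda>x. bump R x * gauss s (x - y)"
      have t: "test_function ?\<phi>" by (rule test_function_bump_mult[OF R gauss_translate_smooth])
      have dphi: "frechet_derivative ?\<phi> (at x) b
         = bump R x * (- ((x - y) \<bullet> b) / s * gauss s (x - y)) + ?db x * gauss s (x - y)" for x
        using has_partials_frechet[OF has_partials_mult[OF smooth_has_partials[OF bump_smooth] gauss_translate_partials[OF s]] b] .
      note W = has_weak_gradient_component[OF w f t b]
      have i: "integrable lborel (\<lambda>x. ?db x * f x * gauss s (y - x))"
        by (rule integrable_conv_gauss_kernel[OF dfi s])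
      have i2: "integrable lborel (\<lambda>x. ?\<phi> x * (G x \<bullet> b))" by (rule W(2))
      have "conv p (\<lambda>z. - (z \<bullet> b) / s * gauss s z) y
         = (LBINT x. ?db x * f x * gauss s (y - x) - f x * frechet_derivative ?\<phi> (at x) b)"
        unfolding conv_def dphi
        by (intro Bochner_Integration.integral_cong)
          (auto simp: p_def gauss_minus_commute[of s _ y] inner_diff_left diff_divide_distrib algebra_simps)
      also have "\<dots> = (LBINT x. ?db x * f x * gauss s (y - x)) + (LBINT x. ?\<phi> x * (G x \<bullet> b))"
        using i W(1,3) by (simp add: Bochner_Integration.integral_diff)
      also have "\<dots> = (LBINT x. ?db x * f x * gauss s (y - x) + ?\<phi> x * (G x \<bullet> b))"
        using i i2 by (simp add: Bochner_Integration.integral_add)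
      also have "\<dots> = conv V (gauss s) y"
        unfolding conv_def V_def
        by (intro Bochner_Integration.integral_cong) (auto simp: gauss_minus_commute[of s _ y] algebra_simps)
      finally show "conv p (\<lambda>z. - (z \<bullet> b) / s * gauss s z) y = conv V (gauss s) y" .
    qed
    then show ?thesis
    proof eventually_elim
      case (elim x)
      show ?case
      proof (intro impI)
        assume x: "norm x < R" "f x = 0"
        then have "V x = 0" using elim by (simp add: p_def)
        then show "G x \<bullet> b = 0" using x bump_pos[of x R] by (simp add: V_def)
      qed
    qed
  qed
  have "AE x in lborel. \<forall>n. norm x < real (Suc n) \<longrightarrow> f x = 0 \<longrightarrow> G x \<bullet> b = 0"
    unfolding AE_all_countable by (intro allI *) simp
  then show ?thesis
  proof eventually_elim
    case (elim x)
    obtain n where "norm x < real n" using reals_Archimedean2 by blast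
    then have "norm x < real (Suc n)" by simp
    then show ?case using elim by blast
  qed
qed

section \<open>The score of a Gaussian-relative density with finite entropy and Fisher
  information\<close>

locale gaussian_density =
  fixes f :: "'a::euclidean_space \<Rightarrow> real" and G :: "'a \<Rightarrow> 'a"
  assumes f_borel [measurable]: "f \<in> borel_measurable borel"
    and f_nonneg: "f x \<ge> 0"
    and f_integrable: "integrable lborel (\<lambda>x. f x * gauss 1 x)"
    and f_mass: "(LBINT x. f x * gauss 1 x) = 1"
    and f_local: "locally_integrable f"
    and f_weak: "has_weak_gradient f G"
    and f_entropy: "integrable lborel (\<lambda>x. gauss 1 x * (f x * ln (f x)))"
    and f_fisher: "integrable lborel (\<lambda>x. gauss 1 x * ((norm (G x))\<^sup>2 / f x))"
begin

lemma G_borel [measurable]: "G \<in> borel_measurable borel"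
  using f_weak by (intro locally_integrable_borel) (simp add: has_weak_gradient_def)

text \<open>Young's inequality for the pair \<open>t ln t - t\<close>, \<open>exp\<close> turns finite entropy into a Gaussian moment bound.\<close>
lemma second_moment_integrable: "integrable lborel (\<lambda>x. (norm x)\<^sup>2 * (f x * gauss 1 x))"
proof (rule Bochner_Integration.integrable_bound)
  \<comment> \<open>The rate 1/4 lies below the Gaussian rate 1/2, so the product still decays; it
    is also the origin of the factor 4 in the majorant.\<close>
  have "integrable lborel (\<lambda>x::'a. gauss 1 x * exp ((norm x)\<^sup>2 / 4))"
  proof -
    have "(\<lambda>x::'a. gauss 1 x * exp ((norm x)\<^sup>2 / 4)) = (\<lambda>x. (2 * pi) powr (- real DIM('a) / 2) * exp (- (1 / 4) * (norm x)\<^sup>2))"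
      by (simp add: gauss_def fun_eq_iff exp_add[symmetric] mult.assoc)
    moreover have "(\<lambda>x::'a. (2 * pi) powr (- real DIM('a) / 2) * exp (- (1 / 4) * (norm x)\<^sup>2)) \<in> poly_gauss (1 / 4)"
      unfolding poly_gauss_def by (intro CollectI exI[of _ "\<lambda>_. (2 * pi) powr (- real DIM('a) / 2)"] conjI refl real_polynomial_function.intros(2))
    ultimately have "(\<lambda>x::'a. gauss 1 x * exp ((norm x)\<^sup>2 / 4)) \<in> poly_gauss (1 / 4)" by (simp only:)
    then show ?thesis by (rule poly_gauss_integrable) simp
  qed
  then show "integrable lborel (\<lambda>x. 4 * (gauss 1 x * (f x * ln (f x)) - f x * gauss 1 x + gauss 1 x * exp ((norm x)\<^sup>2 / 4)))"
    by (intro integrable_mult_right Bochner_Integration.integrable_add Bochner_Integration.integrable_diff f_entropy f_integrable)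
  show "AE x in lborel. norm ((norm x)\<^sup>2 * (f x * gauss 1 x)) \<le> norm (4 * (gauss 1 x * (f x * ln (f x)) - f x * gauss 1 x + gauss 1 x * exp ((norm x)\<^sup>2 / 4)))"
  proof (intro AE_I2)
    fix x :: 'a
    have young: "(norm x)\<^sup>2 / 4 * f x \<le> f x * ln (f x) - f x + exp ((norm x)\<^sup>2 / 4)"
    proof (cases "f x = 0")
      case False
      then have p: "f x > 0" using f_nonneg[of x] by simp
      have "1 + ((norm x)\<^sup>2 / 4 - ln (f x)) \<le> exp ((norm x)\<^sup>2 / 4 - ln (f x))" by (rule exp_ge_add_one_self)
      also have "\<dots> = exp ((norm x)\<^sup>2 / 4) / f x" using p by (simp add: exp_diff)
      finally show ?thesis using p by (simp add: field_simps)
    qed simp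
    have "gauss 1 x * ((norm x)\<^sup>2 / 4 * f x) \<le> gauss 1 x * (f x * ln (f x) - f x + exp ((norm x)\<^sup>2 / 4))"
      by (intro mult_left_mono young gauss_nonneg)
    then have "(norm x)\<^sup>2 * (f x * gauss 1 x) \<le> 4 * (gauss 1 x * (f x * ln (f x)) - f x * gauss 1 x + gauss 1 x * exp ((norm x)\<^sup>2 / 4))"
      by (simp add: algebra_simps)
    moreover have "0 \<le> (norm x)\<^sup>2 * (f x * gauss 1 x)" using f_nonneg gauss_nonneg by (intro mult_nonneg_nonneg) auto
    ultimately show "norm ((norm x)\<^sup>2 * (f x * gauss 1 x)) \<le> norm (4 * (gauss 1 x * (f x * ln (f x)) - f x * gauss 1 x + gauss 1 x * exp ((norm x)\<^sup>2 / 4)))"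
      by simp
  qed
qed simp

definition u :: "'a \<Rightarrow> real" where
  "u x = f x * gauss 1 x"

sublocale heat_flow u
proof
  show "u \<in> borel_measurable borel" unfolding u_def[abs_def] by measurable
  show "u x \<ge> 0" for x by (simp add: u_def f_nonneg gauss_nonneg)
  show "integrable lborel u" using f_integrable by (simp add: u_def[abs_def])
  show "(LBINT x. u x) = 1" using f_mass by (simp add: u_def)
  show "integrable lborel (\<lambda>x. (norm x)\<^sup>2 * u x)" using second_moment_integrable by (simp add: u_def)
qed

lemma G_zero: "AE x in lborel. f x = 0 \<longrightarrow> G x = 0"
proof -
  have "AE x in lborel. \<forall>b\<in>Basis. f x = 0 \<longrightarrow> G x \<bullet> b = 0"
    using weak_gradient_zero_on_zero_set[OF f_weak f_local f_borel f_nonneg]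
    by (intro AE_finite_allI) auto
  then show ?thesis by eventually_elim (auto intro: euclidean_eqI)
qed

text \<open>This is \<open>grad_log f\<close> for a fixed choice of weak gradient. Division by zero
  gives the value 0 off the support of \<open>f\<close>.\<close>

definition score :: "'a \<Rightarrow> 'a" where
  "score x = G x /\<^sub>R f x"

lemma score_borel [measurable]: "score \<in> borel_measurable borel"
  unfolding score_def[abs_def] by measurable

text \<open>Where \<open>f\<close> vanishes the left side is 0 by definition, and the right side is
  0 because \<open>G\<close> vanishes there almost everywhere. This identity carries integrability
  of the score over to \<open>G\<close> and lets convolutions of \<open>G\<close> be read as
  conditional expectations.\<close>

lemma score_times_density: "AE x in lborel. (score x \<bullet> b) * u x = (G x \<bullet> b) * gauss 1 x"
  using G_zero by eventually_elim (auto simp: score_def u_def)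

lemma score_power2_integrable: "integrable lborel (\<lambda>x. (norm (score x))\<^sup>2 * u x)"
proof -
  have "(norm (score x))\<^sup>2 * u x = gauss 1 x * ((norm (G x))\<^sup>2 / f x)" for x
    by (cases "f x = 0") (auto simp: score_def u_def power2_eq_square field_simps)
  then show ?thesis using f_fisher by simp
qed

lemma score_inner_power2_integrable: "integrable lborel (\<lambda>x. (score x \<bullet> b)\<^sup>2 * u x)"
proof (rule Bochner_Integration.integrable_bound)
  show "integrable lborel (\<lambda>x. (norm b)\<^sup>2 * ((norm (score x))\<^sup>2 * u x))"
    by (intro integrable_mult_right score_power2_integrable)
  show "AE x in lborel. norm ((score x \<bullet> b)\<^sup>2 * u x) \<le> norm ((norm b)\<^sup>2 * ((norm (score x))\<^sup>2 * u x))"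
  proof (intro AE_I2)
    fix x
    have "\<bar>score x \<bullet> b\<bar>\<^sup>2 \<le> (norm (score x) * norm b)\<^sup>2"
      by (intro power_mono Cauchy_Schwarz_ineq2) auto
    then have "(score x \<bullet> b)\<^sup>2 * u x \<le> (norm (score x) * norm b)\<^sup>2 * u x"
      using u_nonneg by (intro mult_right_mono) auto
    then show "norm ((score x \<bullet> b)\<^sup>2 * u x) \<le> norm ((norm b)\<^sup>2 * ((norm (score x))\<^sup>2 * u x))"
      using u_nonneg[of x] by (simp add: abs_mult power_mult_distrib mult_ac)
  qed
qed simp

lemma score_inner_integrable: "integrable lborel (\<lambda>x. (score x \<bullet> b) * u x)"
proof (rule Bochner_Integration.integrable_bound)
  show "integrable lborel (\<lambda>x. (score x \<bullet> b)\<^sup>2 * u x + u x)"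
    by (intro Bochner_Integration.integrable_add score_inner_power2_integrable u_integrable)
  show "AE x in lborel. norm ((score x \<bullet> b) * u x) \<le> norm ((score x \<bullet> b)\<^sup>2 * u x + u x)"
  proof (intro AE_I2)
    fix x
    let ?t = "score x \<bullet> b"
    have "\<bar>?t\<bar> \<le> ?t\<^sup>2 + 1"
      using le_one_plus_power2[of "\<bar>?t\<bar>"] by simp
    then have "\<bar>?t\<bar> * u x \<le> (?t\<^sup>2 + 1) * u x" using u_nonneg by (intro mult_right_mono)
    then show "norm ((score x \<bullet> b) * u x) \<le> norm ((score x \<bullet> b)\<^sup>2 * u x + u x)"
      using u_nonneg[of x] by (simp add: abs_mult distrib_right)
  qed
qed simp

lemma G_gauss_integrable: "integrable lborel (\<lambda>x. (G x \<bullet> b) * gauss 1 x)"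
  using score_inner_integrable[of b] score_times_density[of b]
  by (subst integrable_cong_AE[symmetric]) auto

lemma u_inner_integrable: "integrable lborel (\<lambda>x. (x \<bullet> b) * u x)"
proof (rule Bochner_Integration.integrable_bound)
  show "integrable lborel (\<lambda>x. norm b * (u x + (norm x)\<^sup>2 * u x))"
    by (intro integrable_mult_right Bochner_Integration.integrable_add u_integrable u_second_moment)
  show "AE x in lborel. norm ((x \<bullet> b) * u x) \<le> norm (norm b * (u x + (norm x)\<^sup>2 * u x))"
  proof (intro AE_I2)
    fix x
    have "\<bar>x \<bullet> b\<bar> * u x \<le> norm b * (1 + (norm x)\<^sup>2) * u x"
      by (intro mult_right_mono inner_growth u_nonneg)
    then show "norm ((x \<bullet> b) * u x) \<le> norm (norm b * (u x + (norm x)\<^sup>2 * u x))"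
      using u_nonneg[of x] by (simp add: abs_mult distrib_left distrib_right mult_ac)
  qed
qed simp

text \<open>The weak gradient is tested against \<open>gauss 1 x * gauss s (x - y)\<close>, cut off at radius \<open>R \<rightarrow> \<infinity>\<close>.\<close>
lemma conv_G_gauss:
  assumes s: "s > 0" and b: "b \<in> Basis"
  shows "conv (\<lambda>x. (G x \<bullet> b) * gauss 1 x) (gauss s) y = (1 + s) * heat_grad s b y + (y \<bullet> b) * heat s y"
proof -
  let ?g = "\<lambda>x. gauss s (y - x)"
  let ?\<phi> = "\<lambda>n x. bump (real (Suc n)) x * (gauss 1 x * gauss s (x - y))"
  let ?db = "\<lambda>n x. frechet_derivative (bump (real (Suc n))) (at x) b"
  \<comment> \<open>The part of \<open>f\<close> times the derivative of the test function in which
    the derivative hits one of the two Gaussian factors, with the cutoff removed.\<close>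
  define h where "h = (\<lambda>x. (- (x \<bullet> b) + ((y - x) \<bullet> b) / s) * (u x * ?g x))"
  have sm: "smooth (\<lambda>x::'a. gauss 1 x * gauss s (x - y))"
    by (rule smooth_mult[OF poly_gauss_smooth[OF gauss_poly_gauss] gauss_translate_smooth])
  have t: "test_function (?\<phi> n)" for n by (rule test_function_bump_mult[OF _ sm]) simp
  have dphi: "frechet_derivative (?\<phi> n) (at x) b
     = bump (real (Suc n)) x * (gauss 1 x * (- ((x - y) \<bullet> b) / s * gauss s (x - y)) + (- (x \<bullet> b) / 1 * gauss 1 x) * gauss s (x - y))
       + ?db n x * (gauss 1 x * gauss s (x - y))" for n x
    using has_partials_frechet[OF has_partials_mult[OF smooth_has_partials[OF bump_smooth]
        has_partials_mult[OF gauss_partials[of 1] gauss_translate_partials[OF s]]] b] by simp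
  have fd: "f x * frechet_derivative (?\<phi> n) (at x) b = bump (real (Suc n)) x * h x + ?db n x * (u x * ?g x)" for n x
    unfolding dphi h_def u_def gauss_minus_commute[of s x y]
    by (simp add: inner_diff_left diff_divide_distrib algebra_simps)
  obtain B where B: "\<And>z::'a. \<bar>gauss s z\<bar> \<le> B" using gauss_bounded[OF s] by metis
  have ug: "integrable lborel (\<lambda>x. u x * ?g x)" by (rule integrable_u_gauss[OF s])
  have xug: "integrable lborel (\<lambda>x. ((x \<bullet> b) * u x) * ?g x)"
    by (rule integrable_conv_gauss_kernel[OF u_inner_integrable s])
  have hi: "integrable lborel h"
  proof -
    have "integrable lborel (\<lambda>x. (- 1 - 1 / s) * (((x \<bullet> b) * u x) * ?g x) + ((y \<bullet> b) / s) * (u x * ?g x))"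
      by (intro Bochner_Integration.integrable_add integrable_mult_right xug ug)
    moreover have "(\<lambda>x. (- 1 - 1 / s) * (((x \<bullet> b) * u x) * ?g x) + ((y \<bullet> b) / s) * (u x * ?g x)) = h"
      using s by (auto simp: h_def fun_eq_iff inner_diff_left field_simps)
    ultimately show ?thesis by simp
  qed
  have [measurable]: "h \<in> borel_measurable borel" "(\<lambda>x. ?db n x) \<in> borel_measurable borel" for n
    using borel_measurable_integrable[OF hi] bump_partial_borel[OF b] by simp_all
  have dbb: "\<bar>?db n x\<bar> \<le> 4 * exp 1 / real (Suc n)" for n and x :: 'a by (rule bump_partial_bound[OF _ b]) simp
  have db0: "(\<lambda>n. ?db n x) \<longlonglongrightarrow> 0" for x :: 'a
  proof (rule Lim_null_comparison)
    show "\<forall>\<^sub>F n in sequentially. norm (?db n x) \<le> 4 * exp 1 / real (Suc n)" using dbb by simp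
    show "(\<lambda>n. 4 * exp 1 / real (Suc n)) \<longlonglongrightarrow> 0"
      using LIMSEQ_inverse_real_of_nat[THEN tendsto_mult_left, of "4 * exp 1"] by (simp add: divide_inverse)
  qed
  have L1: "(\<lambda>n. LBINT x. f x * frechet_derivative (?\<phi> n) (at x) b) \<longlonglongrightarrow> (LBINT x. h x)"
    unfolding fd
  proof (rule integral_dominated_convergence[where w = "\<lambda>x. \<bar>h x\<bar> + 4 * exp 1 * \<bar>u x * ?g x\<bar>"])
    show "integrable lborel (\<lambda>x. \<bar>h x\<bar> + 4 * exp 1 * \<bar>u x * ?g x\<bar>)"
      by (intro Bochner_Integration.integrable_add integrable_mult_right integrable_abs hi ug)
    show "AE x in lborel. (\<lambda>n. bump (real (Suc n)) x * h x + ?db n x * (u x * ?g x)) \<longlonglongrightarrow> h x"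
    proof (intro AE_I2)
      fix x
      have "(\<lambda>n. bump (real (Suc n)) x * h x + ?db n x * (u x * ?g x)) \<longlonglongrightarrow> 1 * h x + 0 * (u x * ?g x)"
        by (intro tendsto_intros bump_tendsto_1 db0)
      then show "(\<lambda>n. bump (real (Suc n)) x * h x + ?db n x * (u x * ?g x)) \<longlonglongrightarrow> h x" by simp
    qed
    show "AE x in lborel. norm (bump (real (Suc n)) x * h x + ?db n x * (u x * ?g x)) \<le> \<bar>h x\<bar> + 4 * exp 1 * \<bar>u x * ?g x\<bar>" for n
    proof (intro AE_I2)
      fix x
      have "\<bar>bump (real (Suc n)) x\<bar> * \<bar>h x\<bar> \<le> 1 * \<bar>h x\<bar>"
        using bump_nonneg[of "real (Suc n)" x] bump_le_1[of "real (Suc n)" x] by (intro mult_right_mono) auto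
      moreover have "4 * exp 1 / real (Suc n) \<le> 4 * exp (1::real) / 1" by (intro divide_left_mono) auto
      then have "\<bar>?db n x\<bar> * \<bar>u x * ?g x\<bar> \<le> 4 * exp 1 * \<bar>u x * ?g x\<bar>"
        using dbb[of n x] by (intro mult_right_mono) auto
      ultimately show "norm (bump (real (Suc n)) x * h x + ?db n x * (u x * ?g x)) \<le> \<bar>h x\<bar> + 4 * exp 1 * \<bar>u x * ?g x\<bar>"
        using abs_triangle_ineq[of "bump (real (Suc n)) x * h x" "?db n x * (u x * ?g x)"]
          abs_mult[of "bump (real (Suc n)) x" "h x"] abs_mult[of "?db n x" "u x * ?g x"]
        unfolding real_norm_def by linarith
    qed
  qed (simp_all del: of_nat_Suc)
  have Gg: "integrable lborel (\<lambda>x. (G x \<bullet> b) * gauss 1 x * ?g x)"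
    by (rule integrable_conv_gauss_kernel[OF G_gauss_integrable s])
  have L2: "(\<lambda>n. LBINT x. ?\<phi> n x * (G x \<bullet> b)) \<longlonglongrightarrow> (LBINT x. (G x \<bullet> b) * gauss 1 x * ?g x)"
  proof (rule integral_dominated_convergence[where w = "\<lambda>x. \<bar>(G x \<bullet> b) * gauss 1 x * ?g x\<bar>"])
    show "AE x in lborel. (\<lambda>n. ?\<phi> n x * (G x \<bullet> b)) \<longlonglongrightarrow> (G x \<bullet> b) * gauss 1 x * ?g x"
    proof (intro AE_I2)
      fix x
      have "(\<lambda>n. ?\<phi> n x * (G x \<bullet> b)) \<longlonglongrightarrow> 1 * (gauss 1 x * gauss s (x - y)) * (G x \<bullet> b)"
        by (intro tendsto_intros bump_tendsto_1)
      then show "(\<lambda>n. ?\<phi> n x * (G x \<bullet> b)) \<longlonglongrightarrow> (G x \<bullet> b) * gauss 1 x * ?g x"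
        by (simp add: gauss_minus_commute[of s x y] mult_ac)
    qed
    show "AE x in lborel. norm (?\<phi> n x * (G x \<bullet> b)) \<le> \<bar>(G x \<bullet> b) * gauss 1 x * ?g x\<bar>" for n
    proof (intro AE_I2)
      fix x
      have "\<bar>bump (real (Suc n)) x\<bar> * \<bar>(G x \<bullet> b) * gauss 1 x * ?g x\<bar> \<le> 1 * \<bar>(G x \<bullet> b) * gauss 1 x * ?g x\<bar>"
        using bump_nonneg[of "real (Suc n)" x] bump_le_1[of "real (Suc n)" x] by (intro mult_right_mono) auto
      then show "norm (?\<phi> n x * (G x \<bullet> b)) \<le> \<bar>(G x \<bullet> b) * gauss 1 x * ?g x\<bar>"
        by (simp add: abs_mult gauss_minus_commute[of s x y] mult_ac)
    qed
  qed (use Gg in \<open>simp_all del: of_nat_Suc\<close>)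
  have "(\<lambda>n. LBINT x. f x * frechet_derivative (?\<phi> n) (at x) b) \<longlonglongrightarrow> - (LBINT x. (G x \<bullet> b) * gauss 1 x * ?g x)"
    unfolding has_weak_gradient_component(3)[OF f_weak f_local f_borel t b] by (intro tendsto_minus L2)
  from LIMSEQ_unique[OF L1 this]
  have "conv (\<lambda>x. (G x \<bullet> b) * gauss 1 x) (gauss s) y = - (LBINT x. h x)"
    by (simp add: conv_def)
  also have "\<dots> = (1 + s) * heat_grad s b y + (y \<bullet> b) * heat s y"
  proof -
    have i1: "integrable lborel (\<lambda>x. u x * (- ((y - x) \<bullet> b) / s * ?g x))"
      using s by (intro integrable_u_poly_gauss[OF gauss_gradient_poly_gauss]) auto
    \<comment> \<open>Writing \<open>x \<bullet> b\<close> as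
      \<open>y \<bullet> b - (y - x) \<bullet> b\<close> moves the drift of the reference Gaussian
      onto the derivative of the heat kernel; this produces the factor \<open>1 + s\<close>.\<close>
    have "- (LBINT x. h x) = (LBINT x. (1 + s) * (u x * (- ((y - x) \<bullet> b) / s * ?g x)) + (y \<bullet> b) * (u x * ?g x))"
      unfolding Bochner_Integration.integral_minus[symmetric]
      using s by (intro Bochner_Integration.integral_cong) (auto simp: h_def inner_diff_left field_simps)
    also have "\<dots> = (1 + s) * heat_grad s b y + (y \<bullet> b) * heat s y"
      using Bochner_Integration.integral_add[OF integrable_mult_right[OF i1, of "1 + s"] integrable_mult_right[OF ug, of "y \<bullet> b"]]
      unfolding conv_def integral_mult_right_zero .
    finally show ?thesis .
  qed
  finally show ?thesis .
qed

text \<open>Coordinate of the barycenter, as \<open>barycenter_inner\<close> confirms.\<close>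

definition mean :: "'a \<Rightarrow> real" where
  "mean b = (LBINT x. (x \<bullet> b) * u x)"

text \<open>Gaussian integration by parts, read off by integrating \<open>conv_G_gauss\<close> at
  time 1: convolution with a probability kernel preserves integrals and first moments, and the
  gradient term integrates to zero.\<close>

lemma score_mean:
  assumes b: "b \<in> Basis"
  shows "(LBINT x. (score x \<bullet> b) * u x) = mean b"
proof -
  have "(LBINT x. (score x \<bullet> b) * u x) = (LBINT x. (G x \<bullet> b) * gauss 1 x)"
    by (intro integral_cong_AE score_times_density) simp_all
  also have "\<dots> = (LBINT y. conv (\<lambda>x. (G x \<bullet> b) * gauss 1 x) (gauss 1) y)"
    using conv_const_Fubini(2)[OF G_gauss_integrable integrable_gauss[of 1]] by (simp add: integral_gauss)
  also have "\<dots> = (LBINT y. (1 + 1) * heat_grad 1 b y + (y \<bullet> b) * heat 1 y)"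
    by (simp only: conv_G_gauss[OF zero_less_one b])
  also have "\<dots> = (LBINT y. (1 + 1) * heat_grad 1 b y) + (LBINT y. (y \<bullet> b) * heat 1 y)"
    by (intro Bochner_Integration.integral_add integrable_mult_right heat_grad_integrable heat_first_moment(1) zero_less_one b)
  also have "\<dots> = mean b"
    using heat_grad_mean_0[OF zero_less_one b] heat_first_moment(2)[OF zero_less_one b]
    unfolding integral_mult_right_zero mean_def by simp
  finally show ?thesis .
qed

end


section \<open>Contraction of the score under a Poincare inequality\<close>

text \<open>The right side of the reverse Poincare inequality is identified as the variance of
  \<open>g\<close> under the Gaussian law centred at \<open>x\<close>, which is the form the proof
  below needs.\<close>

lemma conv_gauss_power2_variance:
  fixes g :: "'a::euclidean_space \<Rightarrow> real"
  assumes g: "integrable lborel g" "integrable lborel (\<lambda>x. (g x)\<^sup>2)" and s: "s > 0"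
  shows "integrable lborel (\<lambda>y. (g y - conv g (gauss s) x)\<^sup>2 * gauss s (x - y))"
    and "(LBINT y. (g y - conv g (gauss s) x)\<^sup>2 * gauss s (x - y))
      = conv (\<lambda>x. (g x)\<^sup>2) (gauss s) x - (conv g (gauss s) x)\<^sup>2"
proof -
  let ?c = "conv g (gauss s) x"
  have i1: "integrable lborel (\<lambda>y. (g y)\<^sup>2 * gauss s (x - y))" by (rule integrable_conv_gauss_kernel[OF g(2) s])
  have i2: "integrable lborel (\<lambda>y. g y * gauss s (x - y))" by (rule integrable_conv_gauss_kernel[OF g(1) s])
  have i3: "integrable lborel (\<lambda>y. gauss s (x - y))" using integrable_gauss[OF s] by (simp add: integrable_lborel_reflect)
  have m: "(LBINT y. gauss s (x - y)) = 1" by (simp add: integral_lborel_reflect integral_gauss s)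
  have eq: "(g y - ?c)\<^sup>2 * gauss s (x - y)
     = (g y)\<^sup>2 * gauss s (x - y) - ((2 * ?c) * (g y * gauss s (x - y)) - ?c\<^sup>2 * gauss s (x - y))" for y
    by (simp add: power2_diff algebra_simps)
  have i4: "integrable lborel (\<lambda>y. (2 * ?c) * (g y * gauss s (x - y)) - ?c\<^sup>2 * gauss s (x - y))"
    by (intro Bochner_Integration.integrable_diff integrable_mult_right i2 i3)
  show "integrable lborel (\<lambda>y. (g y - ?c)\<^sup>2 * gauss s (x - y))"
    unfolding eq by (intro Bochner_Integration.integrable_diff i1 i4)
  have "(LBINT y. (g y - ?c)\<^sup>2 * gauss s (x - y))
     = (LBINT y. (g y)\<^sup>2 * gauss s (x - y)) - (LBINT y. (2 * ?c) * (g y * gauss s (x - y)) - ?c\<^sup>2 * gauss s (x - y))"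
    unfolding eq by (rule Bochner_Integration.integral_diff[OF i1 i4])
  also have "(LBINT y. (2 * ?c) * (g y * gauss s (x - y)) - ?c\<^sup>2 * gauss s (x - y)) = 2 * ?c * ?c - ?c\<^sup>2 * 1"
    unfolding Bochner_Integration.integral_diff[OF integrable_mult_right[OF i2] integrable_mult_right[OF i3]]
      integral_mult_right_zero m by (simp add: conv_def)
  finally show "(LBINT y. (g y - ?c)\<^sup>2 * gauss s (x - y))
      = conv (\<lambda>x. (g x)\<^sup>2) (gauss s) x - (conv g (gauss s) x)\<^sup>2"
    by (simp add: conv_def power2_eq_square)
qed

text \<open>The gradient \<open>w\<close> of the smoothed function pairs \<open>g\<close> with the
  linear function \<open>y \<mapsto> (x - y) \<bullet> w\<close> under the kernel. That function has
  mean zero, so \<open>g\<close> may be centred, and its second moment is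
  \<open>s * (norm w)\<^sup>2\<close>.\<close>

lemma reverse_Poincare_gauss:
  fixes g :: "'a::euclidean_space \<Rightarrow> real"
  assumes g: "integrable lborel g" "integrable lborel (\<lambda>x. (g x)\<^sup>2)" and s: "s > 0"
  shows "s * (norm (grad (conv g (gauss s)) x))\<^sup>2
    \<le> conv (\<lambda>x. (g x)\<^sup>2) (gauss s) x - (conv g (gauss s) x)\<^sup>2"
proof -
  let ?c = "conv g (gauss s) x"
  let ?k = "\<lambda>b z. - (z \<bullet> b) / s * gauss s z"
  define w where "w = grad (conv g (gauss s)) x"
  have w: "w = (\<Sum>b\<in>Basis. conv g (?k b) x *\<^sub>R b)"
    unfolding w_def by (rule has_partials_grad[OF conv_gauss_partials[OF g(1) s]])
  have wb: "w \<bullet> b = conv g (?k b) x" if "b \<in> Basis" for b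
    using that unfolding w by (simp add: inner_sum_left inner_Basis if_distrib[of "(*) _"] cong: if_cong)
  have ik: "integrable lborel (\<lambda>y. g y * ?k b (x - y))" for b
  proof -
    obtain B where "\<And>z. \<bar>?k b z\<bar> \<le> B" using poly_gauss_bounded[OF gauss_gradient_poly_gauss, of s b] s by auto
    then show ?thesis using poly_gauss_borel[OF gauss_gradient_poly_gauss] by (intro integrable_conv_kernel[OF g(1)]) auto
  qed
  have ig: "integrable lborel (\<lambda>y. ((x - y) \<bullet> w) * gauss s (x - y))"
    using poly_times_gauss_integrable[OF real_polynomial_function_inner s, of w]
    by (simp add: integrable_lborel_reflect[of "\<lambda>z. (z \<bullet> w) * gauss s z"])
  have ig2: "integrable lborel (\<lambda>y. ((x - y) \<bullet> w)\<^sup>2 * gauss s (x - y))"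
    using poly_times_gauss_integrable[OF real_polynomial_function.intros(4)[OF real_polynomial_function_inner[of w] real_polynomial_function_inner[of w]] s]
    by (subst integrable_lborel_reflect[of "\<lambda>z. (z \<bullet> w)\<^sup>2 * gauss s z"]) (simp_all add: power2_eq_square)
  have m1: "(LBINT y. ((x - y) \<bullet> w) * gauss s (x - y)) = 0"
  proof -
    have "(LBINT y. ((x - y) \<bullet> w) * gauss s (x - y)) = (LBINT z. (z \<bullet> w) * gauss s z)"
      by (rule integral_lborel_reflect[of "\<lambda>z. (z \<bullet> w) * gauss s z"]) simp
    also have "\<dots> = (LBINT z. (\<Sum>b\<in>Basis. (w \<bullet> b) * ((z \<bullet> b) * gauss s z)))"
      by (intro Bochner_Integration.integral_cong refl) (subst euclidean_inner, simp add: sum_distrib_right sum_distrib_left mult_ac)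
    also have "\<dots> = (\<Sum>b\<in>Basis. LBINT z. (w \<bullet> b) * ((z \<bullet> b) * gauss s z))"
      by (intro Bochner_Integration.integral_sum integrable_mult_right poly_times_gauss_integrable real_polynomial_function_inner s)
    also have "\<dots> = 0"
      by (intro sum.neutral ballI) (simp only: integral_mult_right_zero integral_inner_gauss[OF s] mult_zero_right)
    finally show ?thesis .
  qed
  have m2: "(LBINT y. ((x - y) \<bullet> w)\<^sup>2 * gauss s (x - y)) = s * (norm w)\<^sup>2"
    using integral_lborel_reflect[of "\<lambda>z. (z \<bullet> w)\<^sup>2 * gauss s z" x] by (simp add: integral_inner_power2_gauss s)
  note V = conv_gauss_power2_variance[OF g s, of x]
  have i5: "integrable lborel (\<lambda>y. (g y) * (- ((x - y) \<bullet> w) / s * gauss s (x - y)))" by (rule ik)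
  have "(norm w)\<^sup>2 = (\<Sum>b\<in>Basis. (w \<bullet> b) * conv g (?k b) x)"
    unfolding power2_norm_eq_inner euclidean_inner[of w w] by (intro sum.cong) (simp_all add: wb)
  also have "\<dots> = (LBINT y. (\<Sum>b\<in>Basis. (w \<bullet> b) * (g y * ?k b (x - y))))"
    unfolding conv_def integral_mult_right_zero[symmetric]
    by (intro Bochner_Integration.integral_sum[symmetric] integrable_mult_right ik)
  also have "\<dots> = (LBINT y. g y * (- ((x - y) \<bullet> w) / s * gauss s (x - y)))"
  proof (intro Bochner_Integration.integral_cong refl)
    fix y
    show "(\<Sum>b\<in>Basis. (w \<bullet> b) * (g y * ?k b (x - y))) = g y * (- ((x - y) \<bullet> w) / s * gauss s (x - y))"
      by (subst euclidean_inner[of "x - y" w]) (simp add: sum_distrib_left sum_distrib_right sum_divide_distrib sum_negf mult_ac)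
  qed
  \<comment> \<open>A multiple of the vanishing first moment is added in order to replace
    \<open>g y\<close> by \<open>g y - ?c\<close>.\<close>
  also have "\<dots> = (LBINT y. g y * (- ((x - y) \<bullet> w) / s * gauss s (x - y))) + (?c / s) * (LBINT y. ((x - y) \<bullet> w) * gauss s (x - y))"
    by (simp only: m1)
  also have "\<dots> = (LBINT y. g y * (- ((x - y) \<bullet> w) / s * gauss s (x - y)) + (?c / s) * (((x - y) \<bullet> w) * gauss s (x - y)))"
    unfolding integral_mult_right_zero[symmetric]
    by (rule Bochner_Integration.integral_add[symmetric, OF i5 integrable_mult_right[OF ig]])
  \<comment> \<open>Young's inequality with both weights \<open>1 / (2 * s)\<close>: the linear term
    contributes exactly half of \<open>(norm w)\<^sup>2\<close>, which is then absorbed on the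
    left.\<close>
  also have "\<dots> \<le> (LBINT y. (1 / (2 * s)) * ((g y - ?c)\<^sup>2 * gauss s (x - y)) + (1 / (2 * s)) * (((x - y) \<bullet> w)\<^sup>2 * gauss s (x - y)))"
  proof (rule integral_mono)
    show "integrable lborel (\<lambda>y. g y * (- ((x - y) \<bullet> w) / s * gauss s (x - y)) + (?c / s) * (((x - y) \<bullet> w) * gauss s (x - y)))"
      by (intro Bochner_Integration.integrable_add i5 integrable_mult_right ig)
    show "integrable lborel (\<lambda>y. (1 / (2 * s)) * ((g y - ?c)\<^sup>2 * gauss s (x - y)) + (1 / (2 * s)) * (((x - y) \<bullet> w)\<^sup>2 * gauss s (x - y)))"
      by (intro Bochner_Integration.integrable_add integrable_mult_right V(1) ig2)
    fix y
    let ?z = "(x - y) \<bullet> w"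
    have "- (2 * (a * b)) \<le> a\<^sup>2 + b\<^sup>2" for a b :: real
      using zero_le_power2[of "a + b"] by (simp add: power2_sum)
    then have "(1 / (2 * s) * gauss s (x - y)) * (- (2 * ((g y - ?c) * ?z))) \<le> (1 / (2 * s) * gauss s (x - y)) * ((g y - ?c)\<^sup>2 + ?z\<^sup>2)"
      using s by (intro mult_left_mono mult_nonneg_nonneg gauss_nonneg) auto
    moreover have "a * (- z / s * r) + (b / s) * (z * r) = (1 / (2 * s) * r) * (- (2 * ((a - b) * z)))" for a b z r
      using s by (simp add: field_simps)
    moreover have "(1 / (2 * s)) * (a * r) + (1 / (2 * s)) * (b * r) = (1 / (2 * s) * r) * (a + b)" for a b r
      using s by (simp add: field_simps)
    ultimately show "g y * (- ?z / s * gauss s (x - y)) + (?c / s) * (?z * gauss s (x - y))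
       \<le> (1 / (2 * s)) * ((g y - ?c)\<^sup>2 * gauss s (x - y)) + (1 / (2 * s)) * (?z\<^sup>2 * gauss s (x - y))"
      by (simp only:)
  qed
  also have "\<dots> = (1 / (2 * s)) * (conv (\<lambda>x. (g x)\<^sup>2) (gauss s) x - ?c\<^sup>2) + (1 / (2 * s)) * (s * (norm w)\<^sup>2)"
    unfolding Bochner_Integration.integral_add[OF integrable_mult_right[OF V(1)] integrable_mult_right[OF ig2]]
      integral_mult_right_zero V(2) m2 ..
  finally have "2 * s * (norm w)\<^sup>2 \<le> (conv (\<lambda>x. (g x)\<^sup>2) (gauss s) x - ?c\<^sup>2) + s * (norm w)\<^sup>2"
    using s by (simp add: field_simps)
  then show ?thesis by (simp add: w_def)
qed

lemma conv_gauss_abs_le: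
  fixes g :: "'a::euclidean_space \<Rightarrow> real"
  assumes g: "integrable lborel g" "\<And>x. \<bar>g x\<bar> \<le> M" and s: "s > 0"
  shows "\<bar>conv g (gauss s) x\<bar> \<le> M"
proof -
  have i3: "integrable lborel (\<lambda>y. gauss s (x - y))" using integrable_gauss[OF s] by (simp add: integrable_lborel_reflect)
  have m: "(LBINT y. gauss s (x - y)) = 1" by (simp add: integral_lborel_reflect integral_gauss s)
  have "\<bar>conv g (gauss s) x\<bar> \<le> (LBINT y. M * gauss s (x - y))"
    unfolding conv_def
    by (intro integral_abs_bound_integral integrable_conv_gauss_kernel g s integrable_mult_right i3)
      (auto simp: abs_mult gauss_nonneg intro!: mult_right_mono g)
  then show ?thesis by (simp add: m)
qed

text \<open>Symmetry of the kernel makes the heat semigroup self-adjoint. The pairing of a bounded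
  with an integrable function suffices for the truncated functions used in the duality
  argument.\<close>

lemma conv_gauss_swap:
  fixes g h :: "'a::euclidean_space \<Rightarrow> real"
  assumes g: "g \<in> borel_measurable borel" "\<And>x. \<bar>g x\<bar> \<le> M" and h: "integrable lborel h" and s: "s > 0"
  shows "integrable lborel (\<lambda>y. g y * conv h (gauss s) y)"
    and "integrable lborel (\<lambda>x. h x * conv g (gauss s) x)"
    and "(LBINT y. g y * conv h (gauss s) y) = (LBINT x. h x * conv g (gauss s) x)"
proof -
  have h': "h \<in> borel_measurable borel" using borel_measurable_integrable[OF h] by simp
  have 1: "integrable lborel (\<lambda>x. M * h x)" using h by simp
  have 2: "integrable lborel (\<lambda>z::'a. 1 * gauss s z)" using integrable_gauss[OF s] by simp
  have 3: "\<bar>g (x + z)\<bar> \<le> M * 1" for x z using g(2) by simp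
  have eq: "(LBINT y. g y * gauss s (y - x)) = conv g (gauss s) x" for x
    unfolding conv_def by (simp add: gauss_minus_commute[of s x])
  note F = conv_Fubini[OF g(1) h' gauss_borel 1 2 3]
  show "integrable lborel (\<lambda>y. g y * conv h (gauss s) y)" by (rule F(1))
  show "integrable lborel (\<lambda>x. h x * conv g (gauss s) x)" using F(2) by (simp only: eq)
  show "(LBINT y. g y * conv h (gauss s) y) = (LBINT x. h x * conv g (gauss s) x)"
    using F(3) by (simp only: eq)
qed

section \<open>Variance contraction and the resulting bound on the Fisher information\<close>

locale poincare_density = gaussian_density +
  fixes l :: real
  assumes l_pos: "l > 0"
    and poincare: "density lborel (\<lambda>x. ennreal (u x)) \<in> poincare_class l"
begin

lemma integral_nu:
  assumes "g \<in> borel_measurable borel"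
  shows "(\<integral>x. g x \<partial>density lborel (\<lambda>x. ennreal (u x))) = (LBINT x. g x * u x)"
  using assms u_nonneg by (subst integral_density) (auto simp: mult.commute)

lemma integrable_nu:
  assumes "g \<in> borel_measurable borel"
  shows "integrable (density lborel (\<lambda>x. ennreal (u x))) g \<longleftrightarrow> integrable lborel (\<lambda>x. g x * u x)"
  using assms u_nonneg by (subst integrable_density) (auto simp: mult.commute)

text \<open>Passes from extended nonnegative integrals to real ones. A majorant \<open>w\<close>
  stands in for the squared gradient, because the reverse Poincare inequality supplies exactly such
  a function with a computable integral.\<close>

lemma poincare_bounded:
  fixes g :: "'a \<Rightarrow> real"
  assumes g: "smooth g" and gi: "integrable lborel (\<lambda>x. g x * u x)" "integrable lborel (\<lambda>x. (g x)\<^sup>2 * u x)"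
    and m: "(LBINT x. g x * u x) = 0"
    and w: "integrable lborel (\<lambda>x. w x * u x)" "w \<in> borel_measurable borel" "\<And>x. (norm (grad g x))\<^sup>2 \<le> w x"
  shows "l * (LBINT x. (g x)\<^sup>2 * u x) \<le> (LBINT x. w x * u x)"
proof -
  let ?\<nu> = "density lborel (\<lambda>x. ennreal (u x))"
  have [measurable]: "g \<in> borel_measurable borel" by (rule has_partials_borel[OF smooth_has_partials[OF g]])
  have w0: "w x \<ge> 0" for x using w(3)[of x] zero_le_power2[of "norm (grad g x)"] by linarith
  have "ennreal l * (\<integral>\<^sup>+x. ennreal ((g x)\<^sup>2) \<partial>?\<nu>) \<le> (\<integral>\<^sup>+x. ennreal ((norm (grad g x))\<^sup>2) \<partial>?\<nu>)"
    using poincare g gi m unfolding poincare_class_def by (simp add: integral_nu integrable_nu)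
  also have "\<dots> \<le> (\<integral>\<^sup>+x. ennreal (w x) \<partial>?\<nu>)" by (intro nn_integral_mono ennreal_leI w)
  also have "\<dots> = ennreal (\<integral>x. w x \<partial>?\<nu>)"
    using w w0 by (intro nn_integral_eq_integral) (auto simp: integrable_nu)
  also have "(\<integral>\<^sup>+x. ennreal ((g x)\<^sup>2) \<partial>?\<nu>) = ennreal (\<integral>x. (g x)\<^sup>2 \<partial>?\<nu>)"
    using gi by (intro nn_integral_eq_integral) (auto simp: integrable_nu)
  finally have "ennreal (l * (LBINT x. (g x)\<^sup>2 * u x)) \<le> ennreal (LBINT x. w x * u x)"
    using l_pos w(2) by (simp add: ennreal_mult' integral_nu)
  moreover have "(LBINT x. w x * u x) \<ge> 0" using w0 u_nonneg by (intro Bochner_Integration.integral_nonneg) auto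
  ultimately show ?thesis by (simp add: ennreal_le_iff)
qed

text \<open>The Poincare inequality bounds \<open>l * s\<close> times the variance of the smoothed
  function by the second moment of \<open>g\<close> under \<open>heat s\<close> minus that of the
  smoothed function under \<open>u\<close>. The latter exceeds the variance, which supplies the
  additional 1. An uncentred right side is enough for the duality.\<close>

lemma variance_contraction:
  fixes g :: "'a \<Rightarrow> real"
  assumes g: "integrable lborel g" "\<And>x. \<bar>g x\<bar> \<le> M" and s: "s > 0"
  defines "c \<equiv> (LBINT x. conv g (gauss s) x * u x)"
  shows "integrable lborel (\<lambda>x. (conv g (gauss s) x - c)\<^sup>2 * u x)"
    and "(1 + l * s) * (LBINT x. (conv g (gauss s) x - c)\<^sup>2 * u x) \<le> (LBINT y. (g y)\<^sup>2 * heat s y)"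
proof -
  let ?Q = "conv g (gauss s)"
  have [measurable]: "g \<in> borel_measurable borel" using borel_measurable_integrable[OF g(1)] by simp
  have Q: "smooth ?Q" using s by (intro conv_poly_gauss_smooth[OF g(1) gauss_poly_gauss]) auto
  have [measurable]: "?Q \<in> borel_measurable borel" by (rule has_partials_borel[OF smooth_has_partials[OF Q]])
  have M0: "M \<ge> 0" using g(2)[of 0] by linarith
  have Qb: "\<bar>?Q x\<bar> \<le> M" for x by (rule conv_gauss_abs_le[OF g s])
  have g2: "(g x)\<^sup>2 \<le> M\<^sup>2" for x using g(2)[of x] by (simp add: abs_le_square_iff[symmetric])
  have g2i: "integrable lborel (\<lambda>x. (g x)\<^sup>2)"
  proof (rule Bochner_Integration.integrable_bound[OF integrable_mult_right[OF g(1), of M]])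
    have "\<bar>g x\<bar> * \<bar>g x\<bar> \<le> M * \<bar>g x\<bar>" for x by (intro mult_right_mono g) auto
    then show "AE x in lborel. norm ((g x)\<^sup>2) \<le> norm (M * g x)" using M0 by (simp add: abs_mult power2_eq_square)
  qed simp
  have bi: "integrable lborel (\<lambda>x. k x * u x)" if [measurable]: "k \<in> borel_measurable borel" and "\<And>x. \<bar>k x\<bar> \<le> B" for k :: "'a \<Rightarrow> real" and B
  proof (rule Bochner_Integration.integrable_bound[OF integrable_mult_right[OF u_integrable, of B]])
    have "B \<ge> 0" using that(2)[of 0] by linarith
    then show "AE x in lborel. norm (k x * u x) \<le> norm (B * u x)" using that(2) u_nonneg
      by (intro AE_I2) (auto simp: abs_mult intro!: mult_right_mono)
  qed simp
  have Qu: "integrable lborel (\<lambda>x. ?Q x * u x)" by (rule bi[OF _ Qb]) simp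
  have Q2: "(?Q x)\<^sup>2 \<le> M\<^sup>2" for x using Qb[of x] M0 by (simp add: abs_le_square_iff[symmetric])
  have Q2u: "integrable lborel (\<lambda>x. (?Q x)\<^sup>2 * u x)" by (rule bi[of _ "M\<^sup>2"]) (use Q2 in auto)
  have eq: "(?Q x - c)\<^sup>2 * u x = (?Q x)\<^sup>2 * u x - ((2 * c) * (?Q x * u x) - c\<^sup>2 * u x)" for x
    by (simp add: power2_diff algebra_simps)
  have i4: "integrable lborel (\<lambda>x. (2 * c) * (?Q x * u x) - c\<^sup>2 * u x)"
    by (intro Bochner_Integration.integrable_diff integrable_mult_right Qu u_integrable)
  show vi: "integrable lborel (\<lambda>x. (?Q x - c)\<^sup>2 * u x)"
    unfolding eq by (intro Bochner_Integration.integrable_diff Q2u i4)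
  have var: "(LBINT x. (?Q x - c)\<^sup>2 * u x) = (LBINT x. (?Q x)\<^sup>2 * u x) - c\<^sup>2"
    unfolding eq Bochner_Integration.integral_diff[OF Q2u i4]
      Bochner_Integration.integral_diff[OF integrable_mult_right[OF Qu] integrable_mult_right[OF u_integrable]]
      integral_mult_right_zero u_mass by (simp add: c_def power2_eq_square)
  have sq: "integrable lborel (\<lambda>y. (g y)\<^sup>2 * heat s y)" "integrable lborel (\<lambda>x. u x * conv (\<lambda>x. (g x)\<^sup>2) (gauss s) x)"
    "(LBINT y. (g y)\<^sup>2 * heat s y) = (LBINT x. u x * conv (\<lambda>x. (g x)\<^sup>2) (gauss s) x)"
    using conv_gauss_swap[of "\<lambda>x. (g x)\<^sup>2" "M\<^sup>2" u s] g2 u_integrable s by auto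
  \<comment> \<open>The majorant of the squared gradient from \<open>reverse_Poincare_gauss\<close>.
    By self-adjointness its mean under \<open>u\<close> is a difference of second moments divided by
    \<open>s\<close>.\<close>
  define w where "w = (\<lambda>x. (conv (\<lambda>x. (g x)\<^sup>2) (gauss s) x - (?Q x)\<^sup>2) / s)"
  have [measurable]: "conv (\<lambda>x. (g x)\<^sup>2) (gauss s) \<in> borel_measurable borel"
    using s by (intro borel_measurable_continuous_onI conv_poly_gauss_continuous[OF g2i gauss_poly_gauss]) auto
  have wb [measurable]: "w \<in> borel_measurable borel" unfolding w_def by measurable
  have weq: "w x * u x = (u x * conv (\<lambda>x. (g x)\<^sup>2) (gauss s) x - (?Q x)\<^sup>2 * u x) / s" for x
    by (simp add: w_def algebra_simps)
  have wi: "integrable lborel (\<lambda>x. w x * u x)"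
    unfolding weq by (intro integrable_divide Bochner_Integration.integrable_diff sq(2) Q2u)
  have wint: "(LBINT x. w x * u x) = ((LBINT y. (g y)\<^sup>2 * heat s y) - (LBINT x. (?Q x)\<^sup>2 * u x)) / s"
    unfolding weq integral_divide_zero Bochner_Integration.integral_diff[OF sq(2) Q2u] sq(3) ..
  have shift: "grad (\<lambda>x. ?Q x - c) x = grad ?Q x" for x
  proof -
    have "has_partials (\<lambda>x. ?Q x + (- c)) (\<lambda>b x. conv g (\<lambda>z. - (z \<bullet> b) / s * gauss s z) x + 0)"
      by (rule has_partials_add[OF conv_gauss_partials[OF g(1) s]]) (simp add: has_partials_def)
    then show ?thesis using has_partials_grad has_partials_grad[OF conv_gauss_partials[OF g(1) s]] by fastforce
  qed
  have "l * (LBINT x. (?Q x - c)\<^sup>2 * u x) \<le> (LBINT x. w x * u x)"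
  proof (rule poincare_bounded)
    show "smooth (\<lambda>x. ?Q x - c)" using smooth_add[OF Q smooth_const[of "- c"]] by simp
    show "integrable lborel (\<lambda>x. (?Q x - c) * u x)"
      using Bochner_Integration.integrable_diff[OF Qu integrable_mult_right[OF u_integrable, of c]] by (simp add: left_diff_distrib)
    have "(LBINT x. (?Q x - c) * u x) = (LBINT x. ?Q x * u x - c * u x)"
      by (simp add: left_diff_distrib)
    also have "\<dots> = 0"
      unfolding Bochner_Integration.integral_diff[OF Qu integrable_mult_right[OF u_integrable]] integral_mult_right_zero u_mass
      by (simp add: c_def)
    finally show "(LBINT x. (?Q x - c) * u x) = 0" .
    show "(norm (grad (\<lambda>x. ?Q x - c) x))\<^sup>2 \<le> w x" for x
      using reverse_Poincare_gauss[OF g(1) g2i s, of x] s unfolding shift w_def by (simp add: field_simps)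
  qed (use vi wi in auto)
  then have "l * (LBINT x. (?Q x - c)\<^sup>2 * u x) * s \<le> (LBINT y. (g y)\<^sup>2 * heat s y) - (LBINT x. (?Q x)\<^sup>2 * u x)"
    unfolding wint using s by (simp add: pos_le_divide_eq)
  moreover have "(LBINT x. (?Q x - c)\<^sup>2 * u x) \<le> (LBINT x. (?Q x)\<^sup>2 * u x)" using var by simp
  ultimately show "(1 + l * s) * (LBINT x. (?Q x - c)\<^sup>2 * u x) \<le> (LBINT y. (g y)\<^sup>2 * heat s y)"
    by (simp add: algebra_simps)
qed

definition score_variance :: "'a \<Rightarrow> real" where
  "score_variance b = (LBINT x. (score x \<bullet> b - mean b)\<^sup>2 * u x)"

text \<open>Conditional expectation of a score coordinate given the position \<open>y\<close> after
  time \<open>s\<close>: the numerator is the convolution of score times density, since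
  \<open>score_times_density\<close> identifies the two almost everywhere.\<close>

definition heat_score :: "real \<Rightarrow> 'a \<Rightarrow> 'a \<Rightarrow> real" where
  "heat_score s b y = conv (\<lambda>x. (G x \<bullet> b) * gauss 1 x) (gauss s) y / heat s y"

lemma heat_score_times_heat:
  "s > 0 \<Longrightarrow> b \<in> Basis \<Longrightarrow> heat_score s b y * heat s y = (1 + s) * heat_grad s b y + (y \<bullet> b) * heat s y"
  using heat_pos[of s y] by (simp add: heat_score_def conv_G_gauss)

lemma score_variance_integrable: "integrable lborel (\<lambda>x. (score x \<bullet> b - mean b)\<^sup>2 * u x)"
proof -
  have "integrable lborel (\<lambda>x. (score x \<bullet> b)\<^sup>2 * u x - ((2 * mean b) * ((score x \<bullet> b) * u x) - (mean b)\<^sup>2 * u x))"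
    by (intro Bochner_Integration.integrable_diff integrable_mult_right score_inner_power2_integrable score_inner_integrable u_integrable)
  then show ?thesis by (simp add: power2_diff algebra_simps)
qed

text \<open>Duality: pairing a truncation \<open>g\<close> of the centred \<open>heat_score\<close> with itself moves the heat kernel
  onto \<open>g\<close>, where \<open>variance_contraction\<close> applies.\<close>
lemma truncated_heat_score_contraction:
  assumes s: "s > 0" and b: "b \<in> Basis"
    and g_def: "g = (\<lambda>y. if \<bar>heat_score s b y - mean b\<bar> \<le> N \<and> norm y \<le> N then heat_score s b y - mean b else 0)"
  shows "(LBINT y. (g y)\<^sup>2 * heat s y) \<le> score_variance b / (1 + l * s)"
proof -
  define k where "k = (\<lambda>x. (G x \<bullet> b) * gauss 1 x - mean b * u x)"
  have Gi: "integrable lborel (\<lambda>x. (G x \<bullet> b) * gauss 1 x)" by (rule G_gauss_integrable)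
  have ki: "integrable lborel k"
    unfolding k_def by (intro Bochner_Integration.integrable_diff integrable_mult_right Gi u_integrable)
  have [measurable]: "heat s \<in> borel_measurable borel" by (rule heat_borel[OF s])
  have [measurable]: "conv (\<lambda>x. (G x \<bullet> b) * gauss 1 x) (gauss s) \<in> borel_measurable borel"
    using s by (intro borel_measurable_continuous_onI conv_poly_gauss_continuous[OF Gi gauss_poly_gauss]) auto
  have [measurable]: "heat_score s b \<in> borel_measurable borel" unfolding heat_score_def[abs_def] by measurable
  have [measurable]: "g \<in> borel_measurable borel" unfolding g_def by measurable
  have ks: "AE x in lborel. k x = (score x \<bullet> b - mean b) * u x"
    using score_times_density[of b] by eventually_elim (simp add: k_def left_diff_distrib)
  have gb: "\<bar>g y\<bar> \<le> \<bar>N\<bar>" for y unfolding g_def by auto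
  have gi: "integrable lborel g"
  proof (rule Bochner_Integration.integrable_bound[of _ "\<lambda>y. \<bar>N\<bar> * indicator (cball 0 N) y"])
    have "emeasure lborel (cball (0::'a) N) < \<infinity>" using emeasure_bounded_finite[OF bounded_cball, of "0::'a" N] by simp
    then show "integrable lborel (\<lambda>y::'a. \<bar>N\<bar> * indicator (cball 0 N) y)"
      by (intro integrable_mult_right integrable_real_indicator) auto
    show "AE y in lborel. norm (g y) \<le> norm (\<bar>N\<bar> * indicator (cball 0 N) y)"
      unfolding g_def by (intro AE_I2) (auto simp: mem_cball_0)
  qed simp
  define Q where "Q = conv g (gauss s)"
  define c where "c = (LBINT x. Q x * u x)"
  define A where "A = (LBINT y. (g y)\<^sup>2 * heat s y)"
  have [measurable]: "Q \<in> borel_measurable borel"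
    unfolding Q_def using s by (intro borel_measurable_continuous_onI conv_poly_gauss_continuous[OF gi gauss_poly_gauss]) auto
  note VC = variance_contraction[OF gi gb s, folded Q_def, folded c_def, folded A_def]
  have ls: "1 + l * s > 0" using l_pos s by (simp add: add_pos_nonneg)
  have ck: "conv k (gauss s) y = (heat_score s b y - mean b) * heat s y" for y
  proof -
    have "conv k (gauss s) y = conv (\<lambda>x. (G x \<bullet> b) * gauss 1 x) (gauss s) y - mean b * heat s y"
      using Bochner_Integration.integral_diff[OF integrable_conv_gauss_kernel[OF Gi s] integrable_mult_right[OF integrable_u_gauss[OF s], of "mean b"], of y y]
      unfolding integral_mult_right_zero by (simp add: conv_def k_def left_diff_distrib mult.assoc)
    then show ?thesis using heat_pos[OF s, of y] by (simp add: heat_score_def left_diff_distrib)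
  qed
  have "A = (LBINT y. g y * conv k (gauss s) y)"
    unfolding A_def ck by (intro Bochner_Integration.integral_cong refl) (simp add: g_def power2_eq_square)
  also have "\<dots> = (LBINT x. k x * Q x)"
    unfolding Q_def by (rule conv_gauss_swap(3)[OF _ gb ki s]) simp
  \<comment> \<open>Since \<open>k\<close> has integral zero, \<open>Q\<close> may be centred; only
    its variance then enters.\<close>
  also have "\<dots> = (LBINT x. k x * (Q x - c))"
  proof -
    have kQ: "integrable lborel (\<lambda>x. k x * Q x)" unfolding Q_def by (rule conv_gauss_swap(2)[OF _ gb ki s]) simp
    have "(LBINT x. k x) = (LBINT x. (score x \<bullet> b) * u x) - mean b * 1"
      unfolding u_mass[symmetric] integral_mult_right_zero[symmetric]
      using Bochner_Integration.integral_diff[OF score_inner_integrable[of b] integrable_mult_right[OF u_integrable, of "mean b"]] ks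
      by (subst integral_cong_AE[OF _ _ ks]) (use ki in \<open>auto simp: left_diff_distrib\<close>)
    then have k0: "(LBINT x. k x) = 0" using score_mean[OF b] by simp
    have "(LBINT x. k x * (Q x - c)) = (LBINT x. k x * Q x - k x * c)" by (simp add: right_diff_distrib)
    also have "\<dots> = (LBINT x. k x * Q x) - (LBINT x. k x * c)"
      by (intro Bochner_Integration.integral_diff kQ integrable_mult_left ki)
    finally show ?thesis using k0 by simp
  qed
  also have "\<dots> = (LBINT x. ((score x \<bullet> b - mean b) * u x) * (Q x - c))"
    by (rule integral_cong_AE) (use ki ks in \<open>auto elim!: eventually_mono simp: k_def\<close>)
  \<comment> \<open>Young's inequality with weight \<open>1 + l * s\<close>: by
    \<open>variance_contraction\<close> the second term is at most \<open>A / 2\<close> and is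
    absorbed into the left side.\<close>
  also have "\<dots> \<le> (LBINT x. (1 / (2 * (1 + l * s))) * ((score x \<bullet> b - mean b)\<^sup>2 * u x) + ((1 + l * s) / 2) * ((Q x - c)\<^sup>2 * u x))"
  proof (rule integral_mono')
    show "integrable lborel (\<lambda>x. (1 / (2 * (1 + l * s))) * ((score x \<bullet> b - mean b)\<^sup>2 * u x) + ((1 + l * s) / 2) * ((Q x - c)\<^sup>2 * u x))"
      by (intro Bochner_Integration.integrable_add integrable_mult_right score_variance_integrable VC(1))
    fix x
    let ?t = "score x \<bullet> b - mean b" and ?q = "Q x - c" and ?r = "1 + l * s"
    have "0 \<le> (?t - ?r * ?q)\<^sup>2 / (2 * ?r)" using ls by simp
    also have "\<dots> = ?t\<^sup>2 / (2 * ?r) + ?r / 2 * ?q\<^sup>2 - ?t * ?q"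
      using ls by (simp add: power2_diff power_mult_distrib field_simps power2_eq_square)
    finally have 1: "?t * ?q \<le> 1 / (2 * ?r) * ?t\<^sup>2 + ?r / 2 * ?q\<^sup>2" by simp
    then have "u x * (?t * ?q) \<le> u x * (1 / (2 * ?r) * ?t\<^sup>2 + ?r / 2 * ?q\<^sup>2)" by (intro mult_left_mono u_nonneg)
    then show "(?t * u x) * ?q \<le> (1 / (2 * ?r)) * (?t\<^sup>2 * u x) + (?r / 2) * (?q\<^sup>2 * u x)" by (simp add: algebra_simps)
    show "0 \<le> (1 / (2 * ?r)) * (?t\<^sup>2 * u x) + (?r / 2) * (?q\<^sup>2 * u x)"
      using ls u_nonneg[of x] by (intro add_nonneg_nonneg mult_nonneg_nonneg) auto
  qed
  also have "\<dots> = (1 / (2 * (1 + l * s))) * score_variance b + ((1 + l * s) / 2) * (LBINT x. (Q x - c)\<^sup>2 * u x)"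
    unfolding Bochner_Integration.integral_add[OF integrable_mult_right[OF score_variance_integrable] integrable_mult_right[OF VC(1)]]
      integral_mult_right_zero score_variance_def ..
  finally have "A \<le> (1 / (2 * (1 + l * s))) * score_variance b + ((1 + l * s) * (LBINT x. (Q x - c)\<^sup>2 * u x)) / 2" by simp
  then have "A \<le> (1 / (2 * (1 + l * s))) * score_variance b + A / 2" using VC(2) by linarith
  moreover have "(1 / (2 * (1 + l * s))) * score_variance b = (score_variance b / (1 + l * s)) * (1 / 2)" by simp
  ultimately have "A \<le> (score_variance b / (1 + l * s)) * (1 / 2) + A / 2" by (simp only:)
  then have "A \<le> score_variance b / (1 + l * s)" by argo
  then show ?thesis by (simp add: A_def)
qed

text \<open>The left side is the variance of \<open>heat_score s b\<close> under
  \<open>heat s\<close>, expanded with \<open>heat_score s b y = (1 + s) * (heat_grad s b y / heat s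
  y) + y \<bullet> b\<close>. Its mean is \<open>mean b\<close>, and the cross term has the explicit
  value \<open>- 2 * (1 + s)\<close>.\<close>

lemma heat_score_contraction:
  assumes s: "s > 0" and b: "b \<in> Basis"
  shows "(1 + s)\<^sup>2 * (LBINT y. (heat_grad s b y)\<^sup>2 / heat s y) - 2 * (1 + s)
      + (LBINT y. (y \<bullet> b)\<^sup>2 * heat s y) - (mean b)\<^sup>2 \<le> score_variance b / (1 + l * s)"
proof -
  let ?w = "heat_score s b"
  have [measurable]: "heat s \<in> borel_measurable borel" by (rule heat_borel[OF s])
  have [measurable]: "heat_grad s b \<in> borel_measurable borel" by (rule heat_grad_borel[OF s])
  have [measurable]: "conv (\<lambda>x. (G x \<bullet> b) * gauss 1 x) (gauss s) \<in> borel_measurable borel"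
    using s by (intro borel_measurable_continuous_onI conv_poly_gauss_continuous[OF G_gauss_integrable gauss_poly_gauss]) auto
  have [measurable]: "?w \<in> borel_measurable borel" unfolding heat_score_def[abs_def] by measurable
  have i1: "integrable lborel (\<lambda>y. (heat_grad s b y)\<^sup>2 / heat s y)" by (rule heat_grad_power2_integrable[OF s])
  have i2: "integrable lborel (\<lambda>y. (y \<bullet> b) * heat_grad s b y)" by (rule heat_grad_first_moment(1)[OF s b])
  have i3: "integrable lborel (\<lambda>y. (y \<bullet> b)\<^sup>2 * heat s y)" by (rule heat_inner_power2_integrable[OF s b])
  have i4: "integrable lborel (\<lambda>y. heat_grad s b y)" by (rule heat_grad_integrable[OF s])
  have i5: "integrable lborel (\<lambda>y. (y \<bullet> b) * heat s y)" by (rule heat_first_moment(1)[OF s b])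
  have i6: "integrable lborel (heat s)" by (rule heat_integrable[OF s])
  have eq: "(?w y - mean b)\<^sup>2 * heat s y
    = ((1 + s)\<^sup>2 * ((heat_grad s b y)\<^sup>2 / heat s y) + (2 * (1 + s)) * ((y \<bullet> b) * heat_grad s b y) + (y \<bullet> b)\<^sup>2 * heat s y)
      - ((2 * mean b * (1 + s)) * heat_grad s b y + (2 * mean b) * ((y \<bullet> b) * heat s y) - (mean b)\<^sup>2 * heat s y)" for y
  proof -
    have p: "heat s y \<noteq> 0" using heat_pos[OF s, of y] by simp
    have w: "?w y = (1 + s) * (heat_grad s b y / heat s y) + y \<bullet> b"
      using heat_score_times_heat[OF s b, of y] p by (simp add: field_simps)
    define r where "r = heat_grad s b y / heat s y"
    have r: "heat_grad s b y = r * heat s y" using p by (simp add: r_def)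
    have r2: "(heat_grad s b y)\<^sup>2 / heat s y = r\<^sup>2 * heat s y" using p by (simp add: r_def power2_eq_square)
    show ?thesis unfolding r2 w r_def[symmetric] unfolding r by (simp add: power2_eq_square algebra_simps)
  qed
  have wi: "integrable lborel (\<lambda>y. (?w y - mean b)\<^sup>2 * heat s y)"
    unfolding eq by (intro Bochner_Integration.integrable_diff Bochner_Integration.integrable_add integrable_mult_right i1 i2 i3 i4 i5 i6)
  have wint: "(LBINT y. (?w y - mean b)\<^sup>2 * heat s y)
    = ((1 + s)\<^sup>2 * (LBINT y. (heat_grad s b y)\<^sup>2 / heat s y) + (2 * (1 + s)) * (- 1) + (LBINT y. (y \<bullet> b)\<^sup>2 * heat s y))
      - ((2 * mean b * (1 + s)) * 0 + (2 * mean b) * mean b - (mean b)\<^sup>2 * 1)"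
    unfolding eq
    unfolding Bochner_Integration.integral_diff[OF Bochner_Integration.integrable_add[OF Bochner_Integration.integrable_add[OF integrable_mult_right[OF i1] integrable_mult_right[OF i2]] i3]
        Bochner_Integration.integrable_diff[OF Bochner_Integration.integrable_add[OF integrable_mult_right[OF i4] integrable_mult_right[OF i5]] integrable_mult_right[OF i6]]]
      Bochner_Integration.integral_add[OF Bochner_Integration.integrable_add[OF integrable_mult_right[OF i1] integrable_mult_right[OF i2]] i3]
      Bochner_Integration.integral_add[OF integrable_mult_right[OF i1] integrable_mult_right[OF i2]]
      Bochner_Integration.integral_diff[OF Bochner_Integration.integrable_add[OF integrable_mult_right[OF i4] integrable_mult_right[OF i5]] integrable_mult_right[OF i6]]
      Bochner_Integration.integral_add[OF integrable_mult_right[OF i4] integrable_mult_right[OF i5]]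
      integral_mult_right_zero heat_grad_first_moment(2)[OF s b] heat_grad_mean_0[OF s b] heat_first_moment(2)[OF s b] heat_mass[OF s] mean_def ..
  \<comment> \<open>Truncation in value and in space makes the function bounded and integrable; the
    untruncated square is integrable and dominates the passage to the limit.\<close>
  define g where "g = (\<lambda>(n::nat) y. if \<bar>?w y - mean b\<bar> \<le> real n \<and> norm y \<le> real n then ?w y - mean b else 0)"
  have "(\<lambda>n. LBINT y. (g n y)\<^sup>2 * heat s y) \<longlonglongrightarrow> (LBINT y. (?w y - mean b)\<^sup>2 * heat s y)"
  proof (rule integral_dominated_convergence[where w = "\<lambda>y. (?w y - mean b)\<^sup>2 * heat s y"])
    show "(\<lambda>y. (g n y)\<^sup>2 * heat s y) \<in> borel_measurable lborel" for n unfolding g_def by measurable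
    show "AE y in lborel. norm ((g n y)\<^sup>2 * heat s y) \<le> (?w y - mean b)\<^sup>2 * heat s y" for n
      using heat_pos[OF s] by (intro AE_I2) (auto simp: g_def abs_mult less_imp_le)
    show "AE y in lborel. (\<lambda>n. (g n y)\<^sup>2 * heat s y) \<longlonglongrightarrow> (?w y - mean b)\<^sup>2 * heat s y"
    proof (intro AE_I2 tendsto_eventually)
      fix y
      obtain N where N: "real N \<ge> max \<bar>?w y - mean b\<bar> (norm y)" using real_arch_simple by blast
      show "\<forall>\<^sub>F n in sequentially. (g n y)\<^sup>2 * heat s y = (?w y - mean b)\<^sup>2 * heat s y"
        using eventually_ge_at_top[of N]
      proof eventually_elim
        case (elim n)
        then have "real N \<le> real n" by simp
        then have "\<bar>?w y - mean b\<bar> \<le> real n" "norm y \<le> real n" using N by linarith+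
        then show ?case by (simp add: g_def)
      qed
    qed
  qed (use wi in auto)
  then have "(LBINT y. (?w y - mean b)\<^sup>2 * heat s y) \<le> score_variance b / (1 + l * s)"
    by (rule LIMSEQ_le_const2) (use truncated_heat_score_contraction[OF s b] g_def in blast)
  then show ?thesis unfolding wint by (simp add: power2_eq_square)
qed

text \<open>Summation of the coordinate estimates and division by \<open>(1 + s)\<^sup>2\<close>.
  The dimension terms combine as 2 d (1 + s) - s d = d (2 + s), the last part coming from the growth
  of the second moment along the flow.\<close>

theorem information_bound:
  assumes s: "s > 0"
  shows "information s \<le> ((\<Sum>b\<in>Basis. score_variance b) / (1 + l * s) + (\<Sum>b\<in>Basis. (mean b)\<^sup>2)
      + real DIM('a) * (2 + s) - second_moment) / (1 + s)\<^sup>2"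
proof -
  have "(\<Sum>b\<in>Basis. LBINT y. (y \<bullet> b)\<^sup>2 * heat s y) = (LBINT y. (\<Sum>b\<in>Basis. (y \<bullet> b)\<^sup>2 * heat s y))"
    by (rule Bochner_Integration.integral_sum[symmetric]) (rule heat_inner_power2_integrable[OF s])
  also have "\<dots> = (LBINT y. (norm y)\<^sup>2 * heat s y)"
    unfolding power2_norm_eq_inner
    by (intro Bochner_Integration.integral_cong refl) (subst euclidean_inner, simp add: sum_distrib_right power2_eq_square)
  finally have m: "(\<Sum>b\<in>Basis. LBINT y. (y \<bullet> b)\<^sup>2 * heat s y) = second_moment + s * real DIM('a)"
    using heat_second_moment(2)[OF s] by simp
  have "(\<Sum>b\<in>Basis. (1 + s)\<^sup>2 * (LBINT y. (heat_grad s b y)\<^sup>2 / heat s y) - 2 * (1 + s)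
      + (LBINT y. (y \<bullet> b)\<^sup>2 * heat s y) - (mean b)\<^sup>2) \<le> (\<Sum>b\<in>Basis. score_variance b / (1 + l * s))"
    by (intro sum_mono heat_score_contraction s)
  then have "(1 + s)\<^sup>2 * information s - real DIM('a) * (2 * (1 + s)) + (second_moment + s * real DIM('a)) - (\<Sum>b\<in>Basis. (mean b)\<^sup>2)
     \<le> (\<Sum>b\<in>Basis. score_variance b) / (1 + l * s)"
    unfolding sum.distrib sum_subtractf m by (simp only: sum_distrib_left[symmetric] information_def sum_divide_distrib[symmetric] sum_constant)
  then have "(1 + s)\<^sup>2 * information s \<le> (\<Sum>b\<in>Basis. score_variance b) / (1 + l * s) + (\<Sum>b\<in>Basis. (mean b)\<^sup>2)
      + real DIM('a) * (2 + s) - second_moment"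
    by (simp add: algebra_simps)
  moreover have "(1 + s)\<^sup>2 > 0" using s by simp
  ultimately show ?thesis by (simp add: pos_le_divide_eq mult.commute)
qed

end


section \<open>Integration along the heat flow\<close>

text \<open>Only the limit 0 needs an argument, where \<open>ln\<close> is not continuous. The
  logarithm inequality applied to \<open>1 / sqrt (v k)\<close> gives a lower bound of order
  \<open>sqrt (v k)\<close>, which closes the sandwich.\<close>

lemma tendsto_mult_ln_self:
  fixes v :: "nat \<Rightarrow> real"
  assumes v: "v \<longlonglongrightarrow> a" "\<And>k. v k > 0" and a: "a \<ge> 0"
  shows "(\<lambda>k. v k * ln (v k)) \<longlonglongrightarrow> a * ln a"
proof (cases "a = 0")
  case False
  then show ?thesis by (intro tendsto_intros v(1)) auto
next
  case True
  have "(\<lambda>k. 2 * v k - 2 * sqrt (v k)) \<longlonglongrightarrow> 2 * 0 - 2 * sqrt 0"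
    using v(1) True by (intro tendsto_intros) auto
  moreover have "(\<lambda>k. v k * (v k - 1)) \<longlonglongrightarrow> 0 * (0 - 1)"
    using v(1) True by (intro tendsto_intros) auto
  moreover have "2 * v k - 2 * sqrt (v k) \<le> v k * ln (v k)" for k
  proof -
    have p: "sqrt (v k) > 0" using v(2) by simp
    have "ln (inverse (sqrt (v k))) \<le> inverse (sqrt (v k)) - 1" using p by (intro ln_le_minus_one) simp
    then have "2 * (1 - inverse (sqrt (v k))) \<le> ln (v k)" using v(2)[of k] by (simp add: ln_inverse ln_sqrt)
    then have "v k * (2 * (1 - inverse (sqrt (v k)))) \<le> v k * ln (v k)" using v(2)[of k] by (intro mult_left_mono) auto
    moreover have "v k * inverse (sqrt (v k)) = sqrt (v k)"
      using v(2)[of k] by (simp add: divide_inverse[symmetric] real_div_sqrt)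
    ultimately show ?thesis by (simp add: algebra_simps)
  qed
  moreover have "v k * ln (v k) \<le> v k * (v k - 1)" for k
    using v(2)[of k] by (intro mult_left_mono ln_le_minus_one) auto
  ultimately have "(\<lambda>k. v k * ln (v k)) \<longlonglongrightarrow> 0"
    by (intro tendsto_sandwich[of "\<lambda>k. 2 * v k - 2 * sqrt (v k)" "\<lambda>k. v k * ln (v k)" sequentially "\<lambda>k. v k * (v k - 1)"]) auto
  then show ?thesis using True by simp
qed

text \<open>Used with \<open>A = 1 + l * s\<close>, \<open>B = 1 + s\<close> and
  \<open>k = 1 - l\<close>; the relation between them is the linear dependence of the two factors on
  the constant 1.\<close>

lemma partial_fraction:
  fixes A B k l :: real
  assumes "A \<noteq> 0" "B \<noteq> 0" "k \<noteq> 0" "A = k + l * B"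
  shows "(l / k\<^sup>2) * (l / A - 1 / B) - (1 / k) * (- 1 / B\<^sup>2) = 1 / (A * B\<^sup>2)"
proof -
  have "l / A - 1 / B = (l * B - A) / (A * B)" using assms(1,2) by (simp add: diff_frac_eq)
  also have "\<dots> = - k / (A * B)" using assms(4) by simp
  finally have "(l / k\<^sup>2) * (l / A - 1 / B) - (1 / k) * (- 1 / B\<^sup>2) = (l / k\<^sup>2) * (- k / (A * B)) - (1 / k) * (- 1 / B\<^sup>2)"
    by simp
  also have "\<dots> = (A - l * B) / (k * (A * B\<^sup>2))"
    using assms(1-3) by (simp add: diff_divide_distrib power2_eq_square)
  also have "\<dots> = 1 / (A * B\<^sup>2)" using assms(3,4) by simp
  finally show ?thesis .
qed

text \<open>The constant \<open>c_const l\<close> is the integral of \<open>1 / ((1 + l s) (1 + s)\<^sup>2)\<close> over \<open>s > 0\<close>.\<close>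
lemma c_const_primitive:
  assumes l: "l > 0"
  obtains P where "\<And>s. s \<ge> 0 \<Longrightarrow> (P has_real_derivative 1 / ((1 + l * s) * (1 + s)\<^sup>2)) (at s)"
    "((\<lambda>s. P s - P 0) \<longlongrightarrow> c_const l) at_top"
proof -
  have inv: "((\<lambda>s::real. 1 / (1 + s)) \<longlongrightarrow> 0) at_top"
    unfolding divide_inverse mult_1
    by (intro tendsto_inverse_0_at_top filterlim_tendsto_add_at_top[OF tendsto_const] filterlim_ident)
  show ?thesis
  proof (cases "l = 1")
    case True
    define P where "P = (\<lambda>s::real. - (1 / 2) * (1 / (1 + s))\<^sup>2)"
    have "(P has_real_derivative 1 / ((1 + l * s) * (1 + s)\<^sup>2)) (at s)" if "s \<ge> 0" for s
    proof -
      have "((\<lambda>s. 1 / (1 + s)) has_real_derivative - 1 / (1 + s)\<^sup>2) (at s)"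
        using that by (auto intro!: derivative_eq_intros simp: power2_eq_square)
      from DERIV_cmult[OF DERIV_power[OF this, of 2], of "- (1 / 2)"]
      show ?thesis unfolding P_def using True by (simp add: power2_eq_square mult_ac)
    qed
    moreover have "((\<lambda>s. P s - P 0) \<longlongrightarrow> - (1 / 2) * 0\<^sup>2 - P 0) at_top"
      unfolding P_def by (intro tendsto_intros inv)
    then have "((\<lambda>s. P s - P 0) \<longlongrightarrow> c_const l) at_top" using True by (simp add: P_def c_const_def)
    ultimately show ?thesis using that by blast
  next
    case False
    define P where "P = (\<lambda>s::real. (l / (1 - l)\<^sup>2) * (ln (1 + l * s) - ln (1 + s)) - (1 / (1 - l)) * (1 / (1 + s)))"
    have "(P has_real_derivative 1 / ((1 + l * s) * (1 + s)\<^sup>2)) (at s)" if s: "s \<ge> 0" for s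
    proof -
      have p: "1 + l * s > 0" "1 + s > 0" using s l by (simp_all add: add_pos_nonneg)
      have "(P has_real_derivative (l / (1 - l)\<^sup>2) * (l / (1 + l * s) - 1 / (1 + s)) - (1 / (1 - l)) * (- 1 / (1 + s)\<^sup>2)) (at s)"
      proof -
        have "((\<lambda>s. 1 / (1 + s)) has_real_derivative - 1 / (1 + s)\<^sup>2) (at s)"
          using p by (auto intro!: derivative_eq_intros simp: power2_eq_square)
        moreover have "((\<lambda>s. ln (1 + s)) has_real_derivative 1 / (1 + s)) (at s)"
          "((\<lambda>s. ln (1 + l * s)) has_real_derivative l / (1 + l * s)) (at s)"
          using p by (auto intro!: derivative_eq_intros)
        ultimately show ?thesis unfolding P_def by (intro DERIV_diff DERIV_cmult)
      qed
      moreover have "(l / (1 - l)\<^sup>2) * (l / (1 + l * s) - 1 / (1 + s)) - (1 / (1 - l)) * (- 1 / (1 + s)\<^sup>2) = 1 / ((1 + l * s) * (1 + s)\<^sup>2)"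
        using p False by (intro partial_fraction) (auto simp: algebra_simps)
      ultimately show ?thesis by simp
    qed
    moreover have "((\<lambda>s. P s - P 0) \<longlongrightarrow> c_const l) at_top"
    proof -
      \<comment> \<open>Both logarithms diverge, so their difference is rewritten as the logarithm
        of the quotient \<open>(1 + l * s) / (1 + s)\<close>, which tends to
        \<open>l\<close>.\<close>
      have "((\<lambda>s. ln (l + (1 - l) * (1 / (1 + s)))) \<longlongrightarrow> ln (l + (1 - l) * 0)) at_top"
        using l by (intro tendsto_intros inv) auto
      moreover have "\<forall>\<^sub>F s in at_top. ln (l + (1 - l) * (1 / (1 + s))) = ln (1 + l * s) - ln (1 + s)"
        using eventually_ge_at_top[of 0]
      proof eventually_elim
        case (elim s)
        then have p: "1 + l * s > 0" "1 + s > 0" using l by (simp_all add: add_pos_nonneg)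
        have "l + (1 - l) * (1 / (1 + s)) = (1 + l * s) / (1 + s)" using p by (simp add: field_simps)
        then show ?case using p by (simp add: ln_div)
      qed
      ultimately have ll: "((\<lambda>s. ln (1 + l * s) - ln (1 + s)) \<longlongrightarrow> ln l) at_top"
        using Lim_transform_eventually by fastforce
      have "((\<lambda>s. P s - P 0) \<longlongrightarrow> (l / (1 - l)\<^sup>2) * ln l - (1 / (1 - l)) * 0 - P 0) at_top"
        unfolding P_def by (intro tendsto_intros ll inv)
      moreover have "(l / (1 - l)\<^sup>2) * ln l - (1 / (1 - l)) * 0 - P 0 = c_const l"
        using False by (simp add: P_def c_const_def power2_eq_square divide_simps) 
      ultimately show ?thesis by simp
    qed
    ultimately show ?thesis using that by blast
  qed
qed

section \<open>Lower semicontinuity of the entropy at time zero\<close>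

context gaussian_density
begin

text \<open>The tangent-line inequality for the logarithm. Subtracting \<open>v\<close> and adding
  the Gaussian leaves the integral unchanged for probability densities but makes the integrand
  nonnegative, as Fatou's lemma demands.\<close>

lemma gauss_entropy_density_nonneg:
  assumes "v \<ge> 0"
  shows "v * ln v - v * ln (gauss 1 x) - v + gauss 1 x \<ge> 0"
proof (cases "v = 0")
  case False
  then have v: "v > 0" using assms by simp
  have g: "gauss 1 x > 0" by (rule gauss_pos) simp
  have "ln (gauss 1 x / v) \<le> gauss 1 x / v - 1" using v g by (intro ln_le_minus_one) simp
  then have "v * (ln (gauss 1 x) - ln v) \<le> v * (gauss 1 x / v - 1)"
    using v g by (intro mult_left_mono) (auto simp: ln_div)
  then show ?thesis using v by (simp add: right_diff_distrib)
qed (simp add: gauss_nonneg)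

text \<open>Fatou's lemma for the nonnegative densities \<open>v ln (v / gauss 1) - v + gauss 1\<close>.\<close>
lemma entropy_lower_semicontinuous:
  assumes B: "\<And>n. entropy (1 / real (Suc n)) \<le> B n" "B \<longlonglongrightarrow> \<beta>"
  shows "(LBINT x. gauss 1 x * (f x * ln (f x))) \<le> \<beta> + real DIM('a) / 2 * ln (2 * pi) + second_moment / 2"
proof -
  define F where "F = (\<lambda>(y::'a) v. v * ln v - v * ln (gauss 1 y) - v + gauss 1 y)"
  obtain q where q: "strict_mono q" "AE x in lborel. (\<lambda>n. heat (1 / real (Suc (q n))) x) \<longlonglongrightarrow> u x"
    using conv_gauss_AE_subseq[OF u_integrable strict_mono_id] by auto
  define s where "s = (\<lambda>n. 1 / real (Suc (q n)))"
  have s: "s n > 0" for n by (simp add: s_def)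
  have [measurable]: "heat (s n) \<in> borel_measurable borel" for n by (rule heat_borel[OF s])
  have lng: "ln (gauss 1 y) = - (real DIM('a) / 2) * ln (2 * pi) - (norm y)\<^sup>2 / 2" for y :: 'a
    using ln_gauss[of 1 y] by simp
  \<comment> \<open>The logarithm of the Gaussian contributes its normalisation and half the squared
    norm; these become the additive constants of the claim once mass and second moment are
    inserted.\<close>
  have Feq: "F y v = v * ln v + (real DIM('a) / 2 * ln (2 * pi) - 1) * v + (1 / 2) * ((norm y)\<^sup>2 * v) + gauss 1 y" for y v
    by (simp add: F_def lng algebra_simps)
  have gi: "integrable lborel (gauss 1 :: 'a \<Rightarrow> real)" by (rule integrable_gauss) simp
  have Fs: "integrable lborel (\<lambda>y. F y (heat (s n) y))"
    and Fsint: "(LBINT y. F y (heat (s n) y))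
      = entropy (s n) + (real DIM('a) / 2 * ln (2 * pi) - 1) * 1 + (1 / 2) * (second_moment + s n * real DIM('a)) + 1" for n
  proof -
    note i1 = entropy_integrable[OF s[of n]] and i2 = integrable_mult_right[OF heat_integrable[OF s[of n]], of "real DIM('a) / 2 * ln (2 * pi) - 1"]
      and i3 = integrable_mult_right[OF heat_second_moment(1)[OF s[of n]], of "1 / 2"]
    show "integrable lborel (\<lambda>y. F y (heat (s n) y))"
      unfolding Feq by (intro Bochner_Integration.integrable_add i1 i2 i3 gi)
    show "(LBINT y. F y (heat (s n) y))
      = entropy (s n) + (real DIM('a) / 2 * ln (2 * pi) - 1) * 1 + (1 / 2) * (second_moment + s n * real DIM('a)) + 1"
      unfolding Feq
        Bochner_Integration.integral_add[OF Bochner_Integration.integrable_add[OF Bochner_Integration.integrable_add[OF i1 i2] i3] gi]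
        Bochner_Integration.integral_add[OF Bochner_Integration.integrable_add[OF i1 i2] i3]
        Bochner_Integration.integral_add[OF i1 i2] integral_mult_right_zero
        heat_mass[OF s[of n]] heat_second_moment(2)[OF s[of n]] entropy_def[symmetric] integral_gauss[OF zero_less_one] ..
  qed
  have Fnn: "F y (heat (s n) y) \<ge> 0" "F y (u y) \<ge> 0" for n y
    unfolding F_def using heat_pos[OF s[of n], of y] u_nonneg[of y] by (auto intro!: gauss_entropy_density_nonneg)
  \<comment> \<open>At time zero \<open>u\<close> contains the Gaussian as a factor, so its
    logarithm cancels and the entropy relative to the Gaussian measure reappears.\<close>
  have Fu: "F y (u y) = gauss 1 y * (f y * ln (f y)) - f y * gauss 1 y + gauss 1 y" for y
  proof (cases "f y = 0")
    case False
    then have "f y > 0" using f_nonneg[of y] by simp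
    moreover have "gauss 1 y > 0" by (rule gauss_pos) simp
    ultimately show ?thesis by (simp add: F_def u_def ln_mult algebra_simps)
  qed (simp add: F_def u_def)
  have Fui: "integrable lborel (\<lambda>y. F y (u y))"
    unfolding Fu by (intro Bochner_Integration.integrable_add Bochner_Integration.integrable_diff f_entropy f_integrable gi)
  have Fuint: "(LBINT y. F y (u y)) = (LBINT x. gauss 1 x * (f x * ln (f x)))"
    unfolding Fu Bochner_Integration.integral_add[OF Bochner_Integration.integrable_diff[OF f_entropy f_integrable] gi]
      Bochner_Integration.integral_diff[OF f_entropy f_integrable] f_mass by (simp add: integral_gauss)
  define L where "L = (\<lambda>n. B (q n) + real DIM('a) / 2 * ln (2 * pi) + (second_moment + s n * real DIM('a)) / 2)"
  define L0 where "L0 = \<beta> + real DIM('a) / 2 * ln (2 * pi) + second_moment / 2"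
  have sl: "s \<longlonglongrightarrow> 0"
    using LIMSEQ_subseq_LIMSEQ[OF LIMSEQ_inverse_real_of_nat q(1)] by (simp add: s_def o_def divide_inverse)
  have L: "L \<longlonglongrightarrow> L0"
  proof -
    have "L \<longlonglongrightarrow> \<beta> + real DIM('a) / 2 * ln (2 * pi) + (second_moment + 0 * real DIM('a)) / 2"
      unfolding L_def using LIMSEQ_subseq_LIMSEQ[OF B(2) q(1)] by (intro tendsto_intros sl) (auto simp: o_def)
    then show ?thesis by (simp add: L0_def)
  qed
  have le: "(LBINT y. F y (heat (s n) y)) \<le> L n" for n
    unfolding Fsint L_def using B(1)[of "q n"] by (simp add: s_def)
  have L_nonneg: "L n \<ge> 0" for n
    using le[of n] Fnn by (meson Bochner_Integration.integral_nonneg order_trans)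
  then have L0: "L0 \<ge> 0" using LIMSEQ_le_const[OF L] by blast
  have "ennreal (LBINT y. F y (u y)) = (\<integral>\<^sup>+y. ennreal (F y (u y)) \<partial>lborel)"
    using Fui Fnn by (intro nn_integral_eq_integral[symmetric]) auto
  also have "\<dots> = (\<integral>\<^sup>+y. liminf (\<lambda>n. ennreal (F y (heat (s n) y))) \<partial>lborel)"
  proof (rule nn_integral_cong_AE)
    show "AE y in lborel. ennreal (F y (u y)) = liminf (\<lambda>n. ennreal (F y (heat (s n) y)))"
      using q(2)
    proof eventually_elim
      case (elim y)
      then have h: "(\<lambda>n. heat (s n) y) \<longlonglongrightarrow> u y" by (simp add: s_def)
      have "(\<lambda>n. heat (s n) y * ln (heat (s n) y)) \<longlonglongrightarrow> u y * ln (u y)"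
        by (rule tendsto_mult_ln_self[OF h heat_pos[OF s] u_nonneg])
      then have "(\<lambda>n. F y (heat (s n) y)) \<longlonglongrightarrow> F y (u y)"
        unfolding F_def
        by (intro tendsto_add[OF tendsto_diff[OF tendsto_diff[OF _ tendsto_mult_right[OF h]] h] tendsto_const])
      then show ?case by (intro lim_imp_Liminf[symmetric] tendsto_ennrealI) auto
    qed
  qed
  also have "\<dots> \<le> liminf (\<lambda>n. \<integral>\<^sup>+y. ennreal (F y (heat (s n) y)) \<partial>lborel)"
    by (rule nn_integral_liminf) (simp add: F_def)
  also have "\<dots> \<le> liminf (\<lambda>n. ennreal (L n))"
  proof (intro Liminf_mono always_eventually allI)
    fix n
    have "(\<integral>\<^sup>+y. ennreal (F y (heat (s n) y)) \<partial>lborel) = ennreal (LBINT y. F y (heat (s n) y))"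
      using Fs Fnn by (intro nn_integral_eq_integral) auto
    then show "(\<integral>\<^sup>+y. ennreal (F y (heat (s n) y)) \<partial>lborel) \<le> ennreal (L n)" using le[of n] by (simp add: ennreal_leI)
  qed
  also have "\<dots> = ennreal L0"
    by (intro lim_imp_Liminf tendsto_ennrealI L) auto
  finally show ?thesis using L0 unfolding Fuint by (simp add: ennreal_le_iff L0_def)
qed

end

section \<open>The integrated entropy bound and the deficit inequality\<close>

context poincare_density
begin

text \<open>Everything that depends on the dimension or on the second moment cancels in the limit of
  large times; the score variance keeps the total integral of its decaying weight, the squared
  barycenter that of \<open>1 / (1 + s)\<^sup>2\<close>, which is 1.\<close>

lemma entropy_bound:
  "(LBINT x. gauss 1 x * (f x * ln (f x)))
    \<le> (c_const l * (\<Sum>b\<in>Basis. score_variance b) + (\<Sum>b\<in>Basis. (mean b)\<^sup>2)) / 2"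
proof -
  define D where "D = (\<Sum>b\<in>(Basis :: 'a set). score_variance b)"
  define M where "M = (\<Sum>b\<in>(Basis :: 'a set). (mean b)\<^sup>2)"
  define d where "d = real DIM('a)"
  define H where "H = (LBINT x. gauss 1 x * (f x * ln (f x)))"
  obtain P where P: "\<And>s. s \<ge> 0 \<Longrightarrow> (P has_real_derivative 1 / ((1 + l * s) * (1 + s)\<^sup>2)) (at s)"
    "((\<lambda>s. P s - P 0) \<longlongrightarrow> c_const l) at_top"
    using c_const_primitive[OF l_pos] by blast
  \<comment> \<open>A primitive of the right side of \<open>information_bound\<close>. Splitting d
    (2 + s) as d + d (1 + s) yields the logarithm and the summand \<open>d\<close> in the
    coefficient of \<open>1 / (1 + s)\<close>.\<close>
  define R where "R = (\<lambda>s. D * P s - (M + d - second_moment) * (1 / (1 + s)) + d * ln (1 + s))"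
  have Rd: "(R has_real_derivative (D / (1 + l * s) + M + d * (2 + s) - second_moment) / (1 + s)\<^sup>2) (at s)" if s: "s \<ge> 0" for s
  proof -
    have p: "1 + l * s > 0" "1 + s > 0" using s l_pos by (simp_all add: add_pos_nonneg)
    have "(R has_real_derivative D * (1 / ((1 + l * s) * (1 + s)\<^sup>2)) - (M + d - second_moment) * (- 1 / (1 + s)\<^sup>2) + d * (1 / (1 + s))) (at s)"
    proof -
      have "((\<lambda>s. 1 / (1 + s)) has_real_derivative - 1 / (1 + s)\<^sup>2) (at s)"
        using p by (auto intro!: derivative_eq_intros simp: power2_eq_square)
      moreover have "((\<lambda>s. ln (1 + s)) has_real_derivative 1 / (1 + s)) (at s)"
        using p by (auto intro!: derivative_eq_intros)
      ultimately show ?thesis unfolding R_def by (intro DERIV_add DERIV_diff DERIV_cmult P s)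
    qed
    moreover have "D * (1 / ((1 + l * s) * (1 + s)\<^sup>2)) - (M + d - second_moment) * (- 1 / (1 + s)\<^sup>2) + d * (1 / (1 + s))
      = (D / (1 + l * s) + M + d * (2 + s) - second_moment) / (1 + s)\<^sup>2"
    proof -
      have "d * (1 / (1 + s)) = d * (1 + s) / (1 + s)\<^sup>2" using p by (simp add: power2_eq_square)
      then show ?thesis by (simp add: add_divide_distrib diff_divide_distrib algebra_simps)
    qed
    ultimately show ?thesis by simp
  qed
  have mono: "entropy a \<le> entropy T + (R T - R a) / 2" if a: "0 < a" "a \<le> T" for a T
  proof -
    have "entropy a + R a / 2 \<le> entropy T + R T / 2"
    proof (rule DERIV_nonneg_imp_nondecreasing[OF a(2)])
      fix s assume "a \<le> s" "s \<le> T"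
      then have s: "s > 0" using a by simp
      have "((\<lambda>s. entropy s + R s / 2) has_real_derivative - information s / 2
         + (D / (1 + l * s) + M + d * (2 + s) - second_moment) / (1 + s)\<^sup>2 / 2) (at s)"
        using s by (intro DERIV_add de_Bruijn DERIV_cdivide Rd) auto
      moreover have "- information s / 2 + (D / (1 + l * s) + M + d * (2 + s) - second_moment) / (1 + s)\<^sup>2 / 2 \<ge> 0"
      proof -
        have "i \<le> x \<Longrightarrow> - i / 2 + x / 2 \<ge> 0" for i x :: real by simp
        from this[OF information_bound[OF s]] show ?thesis unfolding D_def M_def d_def .
      qed
      ultimately show "\<exists>y. ((\<lambda>s. entropy s + R s / 2) has_real_derivative y) (at s) \<and> 0 \<le> y" by blast
    qed
    then show ?thesis by (simp add: diff_divide_distrib)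
  qed
  \<comment> \<open>The lower endpoint tends to 0 along the sequence used for lower semicontinuity,
    and \<open>T \<ge> 1\<close> keeps it below \<open>T\<close>. The normalisation
    \<open>ln (2 * pi)\<close> cancels against the Gaussian bound at time \<open>T\<close>.\<close>
  have HT: "H \<le> - (d / 2) * (ln T - ln (1 + T)) - d / 2
     + (D * (P T - P 0) + (M + d - second_moment) * (1 - 1 / (1 + T))) / 2 + second_moment / 2" if T: "T \<ge> 1" for T
  proof -
    have T0: "T > 0" using T by simp
    have "(\<lambda>n. entropy T + (R T - R (1 / real (Suc n))) / 2) \<longlonglongrightarrow> entropy T + (R T - R 0) / 2"
    proof (intro tendsto_intros)
      have "isCont R 0" using DERIV_isCont[OF Rd[of 0]] by simp
      moreover have "(\<lambda>n. 1 / real (Suc n)) \<longlonglongrightarrow> 0" using LIMSEQ_inverse_real_of_nat by (simp add: divide_inverse)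
      ultimately show "(\<lambda>n. R (1 / real (Suc n))) \<longlonglongrightarrow> R 0" by (rule isCont_tendsto_compose)
    qed simp
    moreover have "entropy (1 / real (Suc n)) \<le> entropy T + (R T - R (1 / real (Suc n))) / 2" for n
    proof (rule mono)
      have "1 / real (Suc n) \<le> 1" by simp
      then show "1 / real (Suc n) \<le> T" using T by linarith
    qed simp
    ultimately have "H \<le> entropy T + (R T - R 0) / 2 + d / 2 * ln (2 * pi) + second_moment / 2"
      unfolding H_def d_def by (intro entropy_lower_semicontinuous)
    moreover have "entropy T \<le> - (d / 2) * ln (2 * pi * T) - d / 2"
      using entropy_le_gauss[OF T0] by (simp add: d_def)
    moreover have "ln (2 * pi * T) = ln (2 * pi) + ln T" using T0 by (subst ln_mult) auto
    moreover have "R T - R 0 = D * (P T - P 0) + (M + d - second_moment) * (1 - 1 / (1 + T)) + d * ln (1 + T)"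
      by (simp add: R_def algebra_simps)
    ultimately show ?thesis by (simp add: algebra_simps add_divide_distrib diff_divide_distrib)
  qed
  have inv: "((\<lambda>s::real. 1 / (1 + s)) \<longlongrightarrow> 0) at_top"
    unfolding divide_inverse mult_1
    by (intro tendsto_inverse_0_at_top filterlim_tendsto_add_at_top[OF tendsto_const] filterlim_ident)
  have lnl: "((\<lambda>T::real. ln T - ln (1 + T)) \<longlongrightarrow> 0) at_top"
  proof -
    have "((\<lambda>T::real. ln (1 - 1 / (1 + T))) \<longlongrightarrow> ln (1 - 0)) at_top" by (intro tendsto_intros inv) auto
    moreover have "\<forall>\<^sub>F T::real in at_top. ln (1 - 1 / (1 + T)) = ln T - ln (1 + T)"
      using eventually_gt_at_top[of 0]
    proof eventually_elim
      case (elim T)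
      have "1 - 1 / (1 + T) = T / (1 + T)" using elim by (simp add: field_simps)
      then show ?case using elim by (simp add: ln_div)
    qed
    ultimately show ?thesis using Lim_transform_eventually by fastforce
  qed
  \<comment> \<open>In the limit \<open>- d / 2\<close> cancels the dimension in the coefficient,
    and the two halves of the second moment cancel each other.\<close>
  have "H \<le> - (d / 2) * 0 - d / 2 + (D * c_const l + (M + d - second_moment) * (1 - 0)) / 2 + second_moment / 2"
  proof (rule tendsto_lowerbound)
    show "((\<lambda>T. - (d / 2) * (ln T - ln (1 + T)) - d / 2 + (D * (P T - P 0) + (M + d - second_moment) * (1 - 1 / (1 + T))) / 2 + second_moment / 2)
       \<longlongrightarrow> - (d / 2) * 0 - d / 2 + (D * c_const l + (M + d - second_moment) * (1 - 0)) / 2 + second_moment / 2) at_top"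
      by (intro tendsto_intros lnl P(2) inv) auto
    show "\<forall>\<^sub>F T in at_top. H \<le> - (d / 2) * (ln T - ln (1 + T)) - d / 2
       + (D * (P T - P 0) + (M + d - second_moment) * (1 - 1 / (1 + T))) / 2 + second_moment / 2"
      using eventually_ge_at_top[of 1] by eventually_elim (rule HT)
  qed simp
  then show ?thesis unfolding H_def[symmetric] D_def[symmetric] M_def[symmetric]
    by (simp add: add_divide_distrib diff_divide_distrib mult.commute)
qed

text \<open>Second moment equals variance plus squared mean in each coordinate; by
  \<open>score_mean\<close> that mean is a coordinate of the barycenter.\<close>

lemma score_power2_decomposition:
  "(LBINT x. (norm (score x))\<^sup>2 * u x) = (\<Sum>b\<in>Basis. score_variance b) + (\<Sum>b\<in>Basis. (mean b)\<^sup>2)"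
proof -
  have "(LBINT x. (score x \<bullet> b)\<^sup>2 * u x) = score_variance b + (mean b)\<^sup>2" if b: "b \<in> Basis" for b
  proof -
    note i = score_variance_integrable[of b] integrable_mult_right[OF score_inner_integrable[of b], of "2 * mean b"]
      integrable_mult_right[OF u_integrable, of "(mean b)\<^sup>2"]
    have eq: "(score x \<bullet> b)\<^sup>2 * u x = (score x \<bullet> b - mean b)\<^sup>2 * u x + ((2 * mean b) * ((score x \<bullet> b) * u x) - (mean b)\<^sup>2 * u x)" for x
      by (simp add: power2_diff algebra_simps)
    show ?thesis
      unfolding eq Bochner_Integration.integral_add[OF i(1) Bochner_Integration.integrable_diff[OF i(2,3)]]
        Bochner_Integration.integral_diff[OF i(2,3)] integral_mult_right_zero score_mean[OF b] u_mass
      by (simp add: score_variance_def power2_eq_square)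
  qed
  then have "(\<Sum>b\<in>Basis. LBINT x. (score x \<bullet> b)\<^sup>2 * u x) = (\<Sum>b\<in>Basis. score_variance b) + (\<Sum>b\<in>Basis. (mean b)\<^sup>2)"
    by (simp add: sum.distrib)
  moreover have "(\<Sum>b\<in>Basis. LBINT x. (score x \<bullet> b)\<^sup>2 * u x) = (LBINT x. (\<Sum>b\<in>Basis. (score x \<bullet> b)\<^sup>2 * u x))"
    by (rule Bochner_Integration.integral_sum[symmetric]) (rule score_inner_power2_integrable)
  moreover have "(\<Sum>b\<in>Basis. (score x \<bullet> b)\<^sup>2 * u x) = (norm (score x))\<^sup>2 * u x" for x
    unfolding power2_norm_eq_inner by (subst euclidean_inner) (simp add: sum_distrib_right power2_eq_square)
  ultimately show ?thesis by simp
qed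

lemma barycenter_inner: "b \<in> Basis \<Longrightarrow> barycenter (density lborel (\<lambda>x. ennreal (u x))) \<bullet> b = mean b"
proof -
  assume b: "b \<in> Basis"
  let ?\<nu> = "density lborel (\<lambda>x. ennreal (u x))"
  have i: "integrable lborel (\<lambda>x. u x *\<^sub>R x)"
  proof (rule Bochner_Integration.integrable_bound[OF Bochner_Integration.integrable_add[OF u_integrable u_second_moment]])
    show "AE x in lborel. norm (u x *\<^sub>R x) \<le> norm (u x + (norm x)\<^sup>2 * u x)"
    proof (intro AE_I2)
      fix x :: 'a
      have "norm x \<le> 1 + (norm x)\<^sup>2" by (rule le_one_plus_power2)
      then have "u x * norm x \<le> u x * (1 + (norm x)\<^sup>2)" by (intro mult_left_mono u_nonneg)
      then show "norm (u x *\<^sub>R x) \<le> norm (u x + (norm x)\<^sup>2 * u x)" using u_nonneg[of x] by (simp add: algebra_simps)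
    qed
  qed simp
  have "barycenter ?\<nu> = (LBINT x. u x *\<^sub>R x)"
    unfolding barycenter_def using u_nonneg by (subst integral_density) auto
  also have "\<dots> \<bullet> b = (LBINT x. (u x *\<^sub>R x) \<bullet> b)" by (rule integral_inner_left[OF i, symmetric])
  finally show ?thesis by (simp add: mean_def mult.commute)
qed

lemma score_variance_total:
  "(\<integral>x. (norm (score x - barycenter (density lborel (\<lambda>x. ennreal (u x)))))\<^sup>2 \<partial>density lborel (\<lambda>x. ennreal (u x)))
    = (\<Sum>b\<in>Basis. score_variance b)"
proof -
  let ?\<nu> = "density lborel (\<lambda>x. ennreal (u x))"
  have eq: "(norm (score x - barycenter ?\<nu>))\<^sup>2 * u x = (\<Sum>b\<in>Basis. (score x \<bullet> b - mean b)\<^sup>2 * u x)" for x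
    unfolding power2_norm_eq_inner
    by (subst euclidean_inner) (simp add: sum_distrib_right power2_eq_square inner_diff_left barycenter_inner)
  show ?thesis
    by (simp add: integral_nu eq Bochner_Integration.integral_sum score_variance_integrable score_variance_def)
qed

end

text \<open>Half the Fisher information is half the total score variance plus half the squared
  barycenter. Subtracting the upper bound of \<open>entropy_bound\<close> removes the barycenter and
  leaves the variance with coefficient \<open>c1_const l\<close>.\<close>

theorem corollary2:
  fixes f :: "real ^ 'n \<Rightarrow> real" and \<nu> :: "(real ^ 'n) measure" and l :: real
  assumes "l > 0"
    and "f \<in> borel_measurable borel" and "\<And>x. f x \<ge> 0" and "W11_loc f"
    and "finite_entropy f" and "finite_fisher_information f"
    and "\<nu> = density std_gaussian (\<lambda>x. ennreal (f x))"
    and "\<nu> \<in> poincare_class l"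
  shows "lsi_deficit f \<ge>
    c1_const l * (\<integral>x. (norm (grad_log f x - barycenter \<nu>))\<^sup>2 \<partial>\<nu>)"
proof -
  let ?G = "weak_gradient f"
  have [measurable]: "f \<in> borel_measurable borel" by fact
  have loc: "locally_integrable f" and ex: "\<exists>G. has_weak_gradient f G"
    using \<open>W11_loc f\<close> by (simp_all add: W11_loc_def)
  have G: "has_weak_gradient f ?G" unfolding weak_gradient_def by (rule someI_ex[OF ex])
  have [measurable]: "?G \<in> borel_measurable borel"
    using G by (intro locally_integrable_borel) (simp add: has_weak_gradient_def)
  have \<nu>: "\<nu> = density lborel (\<lambda>x. ennreal (f x * gauss 1 x))"
    unfolding assms(7) std_gaussian_eq using assms(3)
    by (subst density_density_eq) (auto simp: ennreal_mult' gauss_nonneg mult.commute)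
  \<comment> \<open>The normalisation of \<open>f\<close> is contained in membership in
    \<open>poincare_class\<close>, which consists of probability measures.\<close>
  have "emeasure \<nu> (space \<nu>) = 1"
    using \<open>\<nu> \<in> poincare_class l\<close> prob_space.emeasure_space_1 unfolding poincare_class_def by blast
  then have nn: "(\<integral>\<^sup>+x. ennreal (f x * gauss 1 x) \<partial>lborel) = 1"
    unfolding \<nu> by (simp add: emeasure_density)
  have nonneg: "f x * gauss 1 x \<ge> 0" for x using assms(3) gauss_nonneg by (intro mult_nonneg_nonneg)
  have fi: "integrable lborel (\<lambda>x. f x * gauss 1 x)"
    by (rule integrableI_bounded) (use nn nonneg in \<open>simp_all add: abs_of_nonneg del: abs_mult\<close>)
  have fm: "(LBINT x. f x * gauss 1 x) = 1"
    using nn nonneg by (subst integral_eq_nn_integral) auto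
  have ent: "integrable lborel (\<lambda>x. gauss 1 x * (f x * ln (f x)))"
    using assms(5) unfolding finite_entropy_def std_gaussian_eq
    by (subst (asm) integrable_density) (auto simp: gauss_nonneg)
  have fis_eq: "indicator {x. f x > 0} x * ((norm (?G x))\<^sup>2 / f x) = (norm (?G x))\<^sup>2 / f x" for x
    using assms(3)[of x] by (cases "f x = 0") (auto simp: indicator_def)
  have fis: "integrable lborel (\<lambda>x. gauss 1 x * ((norm (?G x))\<^sup>2 / f x))"
    using assms(6) unfolding finite_fisher_information_def set_integrable_def std_gaussian_eq real_scaleR_def fis_eq
    by (subst (asm) integrable_density) (auto simp: gauss_nonneg)
  interpret gaussian_density f ?G
    by unfold_locales (fact assms(2) assms(3) fi fm loc G ent fis)+
  have \<nu>u: "\<nu> = density lborel (\<lambda>x. ennreal (u x))" unfolding \<nu> by (simp add: u_def)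
  interpret poincare_density f ?G l
    by unfold_locales (use assms(1,8) \<nu>u in auto)
  have gl: "grad_log f x = score x" for x by (simp add: grad_log_def score_def)
  have rhs: "(\<integral>x. (norm (grad_log f x - barycenter \<nu>))\<^sup>2 \<partial>\<nu>) = (\<Sum>b\<in>Basis. score_variance b)"
    unfolding gl \<nu>u by (rule score_variance_total)
  have H: "rel_entropy f = (LBINT x. gauss 1 x * (f x * ln (f x)))"
    unfolding rel_entropy_def std_gaussian_eq by (subst integral_density) (auto simp: gauss_nonneg)
  have "fisher_information f = (LBINT x. gauss 1 x * ((norm (?G x))\<^sup>2 / f x))"
    unfolding fisher_information_def set_lebesgue_integral_def std_gaussian_eq real_scaleR_def fis_eq
    by (subst integral_density) (auto simp: gauss_nonneg)
  also have "\<dots> = (LBINT x. (norm (score x))\<^sup>2 * u x)"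
  proof (intro Bochner_Integration.integral_cong refl)
    fix x show "gauss 1 x * ((norm (?G x))\<^sup>2 / f x) = (norm (score x))\<^sup>2 * u x"
      by (cases "f x = 0") (auto simp: score_def u_def power2_eq_square field_simps)
  qed
  also note score_power2_decomposition
  finally have "fisher_information f = (\<Sum>b\<in>Basis. score_variance b) + (\<Sum>b\<in>Basis. (mean b)\<^sup>2)" .
  with entropy_bound show ?thesis
    unfolding lsi_deficit_def rhs H c1_const_def by (simp add: field_simps)
qed

end
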